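(* Let $G^\Omega$ be a kernel on $\Omega$ satisfying properties (G1) and (G2) listed in the context, with $s,\gamma$ the exponents appearing in (G1). (i) Let $\gamma'\in[0,\gamma)$ and let $\alpha\in\mathbb{R}$ satisfy $$\max\Big\{-\gamma'-1,\ \gamma'-2s,\ -\frac{\gamma' N}{N-2s+\gamma'}\Big\}<\alpha<\frac{\gamma' N}{N-2s}.$$ Then the map $\mathbb{G}^\Omega:\mathcal{M}(\Omega,\delta^{\gamma'})\to L^q(\Omega,\delta^\alpha)$ is compact for every $1\le q<p^*_{\gamma',\alpha}:=\frac{N+\alpha}{N+\gamma'-2s}$. (ii) If, in addition, $G^\Omega$ satisfies property (G3) listed in the context, then the statement in (i) also holds for $\gamma'=\gamma$.
   Context: Throughout, $N\ge 3$, $\Omega\subset\mathbb{R}^N$ is a bounded $C^2$ domain, $\delta(x)=\operatorname{dist}(x,\mathbb{R}^N\setminus\Omega)$, $D_\Omega=\{(x,x):x\in\Omega\}$, $a\wedge b=\min\{a,b\}$; $f\asymp g$ means $C^{-1}g\le f\le Cg$ for some constant $C>0$. Properties of the Green function: (G1) $G^\Omega:(\Omega\times\Omega)\setminus D_\Omega\to(0,\infty)$ is Borel measurable, symmetric, and for some $s,\gamma\in(0,1]$ with $N>2s$, $$G^\Omega(x,y)\asymp\frac{1}{|x-y|^{N-2s}}\Big(\frac{\delta(x)}{|x-y|}\wedge1\Big)^\gamma\Big(\frac{\delta(y)}{|x-y|}\wedge1\Big)^\gamma,\quad x,y\in\Omega,\ x\ne y.$$ (G2) $G^\Omega$ is jointly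 continuous in $(\Omega\times\Omega)\setminus D_\Omega$. (G3) For every $x_0\in\Omega$, $z_0\in\partial\Omega$ the limit $M^\Omega(x_0,z_0)=\lim_{(x,y)\to(x_0,z_0)}\frac{G^\Omega(x,y)}{\delta(y)^\gamma}$ (with $(x,y)\in(\Omega\times\Omega)\setminus D_\Omega$) exists, and $M^\Omega:\Omega\times\partial\Omega\to\mathbb{R}^+$ is continuous. Spaces: for $1\le q<\infty$, $\alpha\in\mathbb{R}$, $L^q(\Omega,\delta^\alpha)$ is the space of $u\in L^1_{\rm loc}(\Omega)$ with $\|u\|_{L^q(\Omega,\delta^\alpha)}=(\int_\Omega|u|^q\delta^\alpha dx)^{1/q}<\infty$. For $\alpha\ge0$, $\mathcal{M}(\Omega,\delta^\alpha)$ is the space of (signed) Radon measures $\mu$ on $\Omega$ with $\|\mu\|_{\mathcal{M}(\Omega,\delta^\alpha)}=\int_\Omega\delta^\alpha d|\mu|<\infty$. Green operator: $\mathbb{G}^\Omega[\mu](x)=\int_\Omega G^\Omega(x,y)\,d\mu(y)$, $x\in\Omega$. A linear map is compact if it maps bounded sets to relatively compact sets. *)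

theory Defs
  imports "HOL-Analysis.Analysis"
begin

section \<open>Domains of class \<open>C\<^sup>2\<close>\<close>

definition C2_function :: "('a::euclidean_space \<Rightarrow> real) \<Rightarrow> bool" where
  "C2_function \<phi> \<longleftrightarrow>
    (\<exists>(g :: 'a \<Rightarrow> 'a) (H :: 'a \<Rightarrow> 'a \<Rightarrow>\<^sub>L 'a).
      (\<forall>x. (\<phi> has_derivative (\<lambda>h. g x \<bullet> h)) (at x)) \<and>
      (\<forall>x. (g has_derivative blinfun_apply (H x)) (at x)) \<and>
      continuous_on UNIV H)"

text \<open>
  Near each boundary point, \<open>\<Omega>\<close> is the region above a \<open>C\<^sup>2\<close> graph over the hyperplane orthogonal
  to a unit vector \<open>\<nu>\<close>.  The function \<open>\<phi>\<close> is formally given on the whole space, but only its values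
  at the orthogonal projection \<open>x - (x \<bullet> \<nu>) \<nu>\<close> on that hyperplane are used; conversely every
  \<open>C\<^sup>2\<close> function on the hyperplane extends by composition with the projection.
\<close>

definition C2_domain :: "'a::euclidean_space set \<Rightarrow> bool" where
  "C2_domain \<Omega> \<longleftrightarrow> open \<Omega> \<and> connected \<Omega> \<and> \<Omega> \<noteq> {} \<and>
    (\<forall>z\<in>frontier \<Omega>. \<exists>r>0. \<exists>\<nu> \<phi>. norm \<nu> = 1 \<and> C2_function \<phi> \<and>
      \<Omega> \<inter> ball z r = {x \<in> ball z r. \<phi> (x - (x \<bullet> \<nu>) *\<^sub>R \<nu>) < x \<bullet> \<nu>})"

definition bdist :: "'a::euclidean_space set \<Rightarrow> 'a \<Rightarrow> real" where
  "bdist \<Omega> x = infdist x (- \<Omega>)"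


section \<open>Green kernels\<close>

definition offdiag :: "'a set \<Rightarrow> ('a \<times> 'a) set" where
  "offdiag \<Omega> = {(x, y). x \<in> \<Omega> \<and> y \<in> \<Omega> \<and> x \<noteq> y}"

text \<open>
  A kernel is a total function \<open>G\<close>; only its values on \<open>offdiag \<Omega>\<close> are ever constrained.
\<close>

definition green_G1 ::
  "'a::euclidean_space set \<Rightarrow> real \<Rightarrow> real \<Rightarrow> ('a \<Rightarrow> 'a \<Rightarrow> real) \<Rightarrow> bool" where
  "green_G1 \<Omega> s \<gamma> G \<longleftrightarrow>
    0 < s \<and> s \<le> 1 \<and> 0 < \<gamma> \<and> \<gamma> \<le> 1 \<and> 2 * s < real DIM('a) \<and>
    (\<lambda>(x, y). G x y) \<in> borel_measurable (restrict_space borel (offdiag \<Omega>)) \<and>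
    (\<forall>(x, y) \<in> offdiag \<Omega>. 0 < G x y \<and> G x y = G y x) \<and>
    (\<exists>C>0. \<forall>(x, y) \<in> offdiag \<Omega>.
      let K = 1 / dist x y powr (real DIM('a) - 2 * s)
              * min (bdist \<Omega> x / dist x y) 1 powr \<gamma>
              * min (bdist \<Omega> y / dist x y) 1 powr \<gamma>
      in 1 / C * K \<le> G x y \<and> G x y \<le> C * K)"

definition green_G2 :: "'a::euclidean_space set \<Rightarrow> ('a \<Rightarrow> 'a \<Rightarrow> real) \<Rightarrow> bool" where
  "green_G2 \<Omega> G \<longleftrightarrow> continuous_on (offdiag \<Omega>) (\<lambda>(x, y). G x y)"

definition green_G3 ::
  "'a::euclidean_space set \<Rightarrow> real \<Rightarrow> ('a \<Rightarrow> 'a \<Rightarrow> real) \<Rightarrow> bool" where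
  "green_G3 \<Omega> \<gamma> G \<longleftrightarrow>
    (\<exists>M :: 'a \<Rightarrow> 'a \<Rightarrow> real.
      (\<forall>x\<^sub>0\<in>\<Omega>. \<forall>z\<^sub>0\<in>frontier \<Omega>. 0 < M x\<^sub>0 z\<^sub>0 \<and>
        ((\<lambda>(x, y). G x y / bdist \<Omega> y powr \<gamma>) \<longlongrightarrow> M x\<^sub>0 z\<^sub>0)
          (at (x\<^sub>0, z\<^sub>0) within offdiag \<Omega>)) \<and>
      continuous_on (\<Omega> \<times> frontier \<Omega>) (\<lambda>(x, z). M x z))"


section \<open>Signed Radon measures\<close>

text \<open>
  A signed Radon measure on the open set \<open>\<Omega>\<close> may have infinite positive and infinite negative part
  near the boundary, so it has values only on Borel sets that are relatively compact in \<open>\<Omega>\<close>.  It is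
  a real set function, countably additive on those sets (values on other sets are irrelevant); as
  \<open>\<Omega>\<close> is an open subset of a Euclidean space, regularity is automatic.
\<close>

definition rc_borel :: "'a::euclidean_space set \<Rightarrow> 'a set set" where
  "rc_borel \<Omega> = {A \<in> sets borel. compact (closure A) \<and> closure A \<subseteq> \<Omega>}"

definition signed_radon :: "'a::euclidean_space set \<Rightarrow> ('a set \<Rightarrow> real) \<Rightarrow> bool" where
  "signed_radon \<Omega> \<mu> \<longleftrightarrow>
    (\<forall>A :: nat \<Rightarrow> 'a set. range A \<subseteq> rc_borel \<Omega> \<longrightarrow> disjoint_family A \<longrightarrow>
      (\<Union>i. A i) \<in> rc_borel \<Omega> \<longrightarrow> (\<lambda>i. \<mu> (A i)) sums \<mu> (\<Union>i. A i))"

text \<open>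
  The variations \<open>\<mu>\<^sup>+\<close>, \<open>\<mu>\<^sup>-\<close> and \<open>|\<mu>|\<close> are measures on the Borel subsets of \<open>\<Omega>\<close>, possibly of infinite
  total mass.  In \<open>pos_variation\<close>, the coercion \<open>ennreal\<close> truncates negative values to 0, which
  does not change the supremum because \<open>B = {}\<close> is admitted.
\<close>

definition pos_variation :: "'a::euclidean_space set \<Rightarrow> ('a set \<Rightarrow> real) \<Rightarrow> 'a measure" where
  "pos_variation \<Omega> \<mu> =
    measure_of \<Omega> {A \<in> sets borel. A \<subseteq> \<Omega>} (\<lambda>A. SUP B\<in>{B \<in> rc_borel \<Omega>. B \<subseteq> A}. ennreal (\<mu> B))"

definition neg_variation :: "'a::euclidean_space set \<Rightarrow> ('a set \<Rightarrow> real) \<Rightarrow> 'a measure" where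
  "neg_variation \<Omega> \<mu> = pos_variation \<Omega> (\<lambda>A. - \<mu> A)"

definition total_variation :: "'a::euclidean_space set \<Rightarrow> ('a set \<Rightarrow> real) \<Rightarrow> 'a measure" where
  "total_variation \<Omega> \<mu> =
    measure_of \<Omega> {A \<in> sets borel. A \<subseteq> \<Omega>}
      (\<lambda>A. emeasure (pos_variation \<Omega> \<mu>) A + emeasure (neg_variation \<Omega> \<mu>) A)"

definition M_norm :: "'a::euclidean_space set \<Rightarrow> real \<Rightarrow> ('a set \<Rightarrow> real) \<Rightarrow> ennreal" where
  "M_norm \<Omega> \<beta> \<mu> = (\<integral>\<^sup>+ x. ennreal (bdist \<Omega> x powr \<beta>) \<partial>total_variation \<Omega> \<mu>)"

definition M_space :: "'a::euclidean_space set \<Rightarrow> real \<Rightarrow> ('a set \<Rightarrow> real) set" where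
  "M_space \<Omega> \<beta> = {\<mu>. signed_radon \<Omega> \<mu> \<and> M_norm \<Omega> \<beta> \<mu> < \<infinity>}"

definition M_bounded :: "'a::euclidean_space set \<Rightarrow> real \<Rightarrow> ('a set \<Rightarrow> real) set \<Rightarrow> bool" where
  "M_bounded \<Omega> \<beta> S \<longleftrightarrow> S \<subseteq> M_space \<Omega> \<beta> \<and> (\<exists>C::real. \<forall>\<mu>\<in>S. M_norm \<Omega> \<beta> \<mu> \<le> ennreal C)"


section \<open>Weighted Lebesgue spaces\<close>

definition Lq_space :: "'a::euclidean_space set \<Rightarrow> real \<Rightarrow> real \<Rightarrow> ('a \<Rightarrow> real) set" where
  "Lq_space \<Omega> q \<alpha> = {u.
    (\<forall>K. compact K \<and> K \<subseteq> \<Omega> \<longrightarrow> u absolutely_integrable_on K) \<and>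
    (\<lambda>x. \<bar>u x\<bar> powr q * bdist \<Omega> x powr \<alpha>) absolutely_integrable_on \<Omega>}"

definition Lq_norm ::
  "'a::euclidean_space set \<Rightarrow> real \<Rightarrow> real \<Rightarrow> ('a \<Rightarrow> real) \<Rightarrow> real" where
  "Lq_norm \<Omega> q \<alpha> u =
    (LINT x:\<Omega>|lebesgue. \<bar>u x\<bar> powr q * bdist \<Omega> x powr \<alpha>) powr (1 / q)"

text \<open>
  The topology of \<open>L\<^sup>q(\<Omega>, \<delta>\<^sup>\<alpha>)\<close>.  Functions equal almost everywhere on \<open>\<Omega>\<close> are not identified, so
  this is the (non-Hausdorff) seminorm topology, and the normed space is its quotient by the
  topologically indistinguishable points.  Open sets are saturated for this identification, hence
  closure and compactness have the same meaning in both.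
\<close>

definition Lq_topology ::
  "'a::euclidean_space set \<Rightarrow> real \<Rightarrow> real \<Rightarrow> ('a \<Rightarrow> real) topology" where
  "Lq_topology \<Omega> q \<alpha> = topology (\<lambda>U. U \<subseteq> Lq_space \<Omega> q \<alpha> \<and>
    (\<forall>u\<in>U. \<exists>r>0. \<forall>v\<in>Lq_space \<Omega> q \<alpha>. Lq_norm \<Omega> q \<alpha> (\<lambda>x. v x - u x) < r \<longrightarrow> v \<in> U))"

lemma openin_Lq_topology:
  "openin (Lq_topology \<Omega> q \<alpha>) U \<longleftrightarrow> U \<subseteq> Lq_space \<Omega> q \<alpha> \<and>
    (\<forall>u\<in>U. \<exists>r>0. \<forall>v\<in>Lq_space \<Omega> q \<alpha>. Lq_norm \<Omega> q \<alpha> (\<lambda>x. v x - u x) < r \<longrightarrow> v \<in> U)"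
proof -
  define L where "L = Lq_space \<Omega> q \<alpha>"
  define d where "d u v = Lq_norm \<Omega> q \<alpha> (\<lambda>x. v x - u x)" for u v
  let ?P = "\<lambda>U. U \<subseteq> L \<and> (\<forall>u\<in>U. \<exists>r>0. \<forall>v\<in>L. d u v < r \<longrightarrow> v \<in> U)"
  have "istopology ?P"
    unfolding istopology_def
  proof (intro conjI allI impI)
    fix S T assume S: "?P S" and T: "?P T"
    show "S \<inter> T \<subseteq> L" using S by blast
    show "\<forall>u\<in>S \<inter> T. \<exists>r>0. \<forall>v\<in>L. d u v < r \<longrightarrow> v \<in> S \<inter> T"
    proof
      fix u assume u: "u \<in> S \<inter> T"
      obtain a where a: "a > 0" "\<forall>v\<in>L. d u v < a \<longrightarrow> v \<in> S" using S u by blast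
      obtain b where b: "b > 0" "\<forall>v\<in>L. d u v < b \<longrightarrow> v \<in> T" using T u by blast
      show "\<exists>r>0. \<forall>v\<in>L. d u v < r \<longrightarrow> v \<in> S \<inter> T"
        using a b by (intro exI[of _ "min a b"]) auto
    qed
  next
    fix \<K> assume K: "\<forall>K\<in>\<K>. ?P K"
    show "\<Union>\<K> \<subseteq> L" using K by blast
    show "\<forall>u\<in>\<Union>\<K>. \<exists>r>0. \<forall>v\<in>L. d u v < r \<longrightarrow> v \<in> \<Union>\<K>" using K by (meson UnionE UnionI)
  qed
  then show ?thesis
    unfolding Lq_topology_def L_def d_def by (simp add: topology_inverse')
qed

definition relatively_compact_in :: "'b topology \<Rightarrow> 'b set \<Rightarrow> bool" where
  "relatively_compact_in X S \<longleftrightarrow> S \<subseteq> topspace X \<and> compactin X (X closure_of S)"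


section \<open>The Green operator\<close>

text \<open>
  For \<open>\<mu> \<in> M_space \<Omega> \<beta>\<close>, the integral against the signed measure \<open>\<mu>\<close> is the difference of
  the integrals against \<open>\<mu>\<^sup>+\<close> and \<open>\<mu>\<^sup>-\<close>.  The unconstrained values \<open>G x x\<close> matter only at the (countably
  many) atoms \<open>x\<close> of \<open>\<mu>\<close>; there, and where an integral diverges, the value is an arbitrary real.
\<close>

definition green_op ::
  "'a::euclidean_space set \<Rightarrow> ('a \<Rightarrow> 'a \<Rightarrow> real) \<Rightarrow> ('a set \<Rightarrow> real) \<Rightarrow> 'a \<Rightarrow> real" where
  "green_op \<Omega> G \<mu> x =
    (LINT y|pos_variation \<Omega> \<mu>. G x y) - (LINT y|neg_variation \<Omega> \<mu>. G x y)"

text \<open>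
  Compact linear maps from \<open>\<M>(\<Omega>, \<delta>\<^sup>\<beta>)\<close> to \<open>L\<^sup>q(\<Omega>, \<delta>\<^sup>\<alpha>)\<close>.  Linearity is an identity in the target
  space, that is, almost everywhere.
\<close>

definition compact_linear_map ::
  "'a::euclidean_space set \<Rightarrow> real \<Rightarrow> real \<Rightarrow> real \<Rightarrow>
    (('a set \<Rightarrow> real) \<Rightarrow> ('a \<Rightarrow> real)) \<Rightarrow> bool" where
  "compact_linear_map \<Omega> \<beta> q \<alpha> T \<longleftrightarrow>
    (\<forall>\<mu>\<in>M_space \<Omega> \<beta>. T \<mu> \<in> Lq_space \<Omega> q \<alpha>) \<and>
    (\<forall>\<mu>\<in>M_space \<Omega> \<beta>. \<forall>\<nu>\<in>M_space \<Omega> \<beta>. \<forall>a b.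
      (AE x in lebesgue_on \<Omega>. T (\<lambda>A. a * \<mu> A + b * \<nu> A) x = a * T \<mu> x + b * T \<nu> x)) \<and>
    (\<forall>S. M_bounded \<Omega> \<beta> S \<longrightarrow> relatively_compact_in (Lq_topology \<Omega> q \<alpha>) (T ` S))"


section \<open>Exponents\<close>

definition p_crit :: "real \<Rightarrow> real \<Rightarrow> real \<Rightarrow> real \<Rightarrow> real" where
  "p_crit N s \<gamma>' \<alpha> = (N + \<alpha>) / (N + \<gamma>' - 2 * s)"

definition admissible_weight :: "real \<Rightarrow> real \<Rightarrow> real \<Rightarrow> real \<Rightarrow> bool" where
  "admissible_weight N s \<gamma>' \<alpha> \<longleftrightarrow>
    Max {- \<gamma>' - 1, \<gamma>' - 2 * s, - (\<gamma>' * N / (N - 2 * s + \<gamma>'))} < \<alpha> \<and>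
    \<alpha> < \<gamma>' * N / (N - 2 * s)"

end

theory Submission
  imports Defs
begin

text \<open>
  Put \<open>g y = G(\<cdot>, y) / \<delta>(y)\<^sup>\<gamma>\<^sup>'\<close>, so that the Green potential of \<open>\<mu>\<close> is the integral of \<open>g\<close> against
  \<open>\<nu> = \<delta>\<^sup>\<gamma>\<^sup>' \<mu>\<close>, a measure of bounded total mass.  It suffices that \<open>{g y | y \<in> \<Omega>}\<close> is totally bounded in
  the target space: by Minkowski's integral inequality, the potential is then uniformly close to
  a combination of finitely many fixed functions \<open>g y\<close>, with coefficients bounded by the mass of \<open>\<nu>\<close>.

  Total boundedness follows from the compactness of the closure of \<open>\<Omega>\<close>, because \<open>g y\<close> converges almost
  everywhere when \<open>y\<close> approaches a point of the closure.  At interior points this is (G2); at boundary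
  points the limit is 0 if \<open>\<gamma>' < \<gamma>\<close>, and it is given by (G3) if \<open>\<gamma>' = \<gamma>\<close>.  Convergence in norm then holds by
  Vitali's argument, since (G1) bounds \<open>g y\<close> uniformly in \<open>L\<^sup>p(\<Omega>, \<delta>\<^sup>\<alpha>)\<close> for some \<open>p > q\<close> and in
  \<open>L\<^sup>q(\<Omega>, \<delta>\<^sup>\<alpha>\<^sup>-\<^sup>\<eta>)\<close> for some \<open>\<eta> > 0\<close>; the only information on the boundary that enters is that the layer
  \<open>\<delta> \<le> t\<close> occupies at most a multiple of \<open>t r\<^sup>N\<^sup>-\<^sup>1\<close> in a ball of radius \<open>r\<close>.
\<close>

text \<open>A bounded family may push its mass to the boundary, and \<mu> itself may have infinite
  mass there, so no limit measure inside \<Omega> is available. Dividing the kernel by the weight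
  moves the difficulty to its columns, indexed by points up to the frontier. The estimates rest on
  three strict inequalities. \<open>q * (N - 2 * s + \<gamma>') < N + \<alpha>\<close> restates
  \<open>q < p_crit\<close> and governs poles that approach the boundary.
  \<open>q * (N - 2 * s) < N\<close> follows from the upper bound on \<alpha> and is integrability
  at an interior pole. \<open>- 1 < q * \<gamma> + \<alpha>\<close> follows from
  \<open>- \<gamma>' - 1 < \<alpha>\<close> and is integrability in the layer, where the kernel
  decays like the power \<gamma> of the distance. Being strict, they survive a slightly larger
  \<open>q\<close> or a slightly smaller \<alpha>, which is the source of equi-integrability. Two
  obstacles are formal. The values \<open>G x x\<close> are free and \<mu> may charge
  \<open>x\<close>, so the operator is compared with a well-behaved potential off a countable set.
  The variations may be infinite, so identities between them are written without
  subtraction.\<close>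

section \<open>Boundary layers of \<open>C\<^sup>2\<close> domains\<close>

text \<open>The translates of the layer by \<open>k t \<nu>\<close>, \<open>k = 0, \<dots>, \<lceil>r / t\<rceil> - 1\<close>, are disjoint and
  stay in the ball of radius \<open>2 r\<close>.\<close>

lemma emeasure_graph_layer_le:
  fixes h :: "'a::euclidean_space \<Rightarrow> real" and \<nu> :: 'a
  assumes h: "h \<in> borel_measurable borel" and \<nu>: "norm \<nu> = 1"
    and shift: "\<And>x c. h (x + c *\<^sub>R \<nu>) = h x + c"
    and r: "0 < r" and t: "0 < t"
  shows "emeasure lborel {x \<in> cball y r. 0 < h x \<and> h x \<le> t}
    \<le> ennreal (unit_ball_vol DIM('a) * 2 ^ DIM('a) * t * r powr (real DIM('a) - 1))"
proof -
  define E where "E = {x \<in> cball y r. 0 < h x \<and> h x \<le> t}"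
  define E' where "E' k = (\<lambda>x. (real k * t) *\<^sub>R \<nu> + x) ` E" for k
  define m where "m = nat \<lceil>r / t\<rceil>"
  have mpos: "0 < m" using r t unfolding m_def by simp
  have mr: "r / t \<le> real m" unfolding m_def by linarith
  have m1: "(real m - 1) * t \<le> r"
  proof -
    have "real m - 1 \<le> r / t" using r t unfolding m_def
      by (smt (verit) ceiling_correct divide_pos_pos of_nat_nat zero_le_ceiling)
    then show ?thesis using t by (simp add: field_simps)
  qed
  have hm[measurable]: "h \<in> borel_measurable borel" by fact
  have Eb: "E \<in> sets borel" unfolding E_def by measurable
  have E'_eq: "E' k = {x. x - (real k * t) *\<^sub>R \<nu> \<in> E}" for k
    unfolding E'_def by (force simp: image_iff)
  have E'b: "E' k \<in> sets borel" for k
  proof -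
    have "(\<lambda>x. x - (real k * t) *\<^sub>R \<nu>) \<in> borel_measurable borel" by measurable
    from measurable_sets[OF this Eb] show ?thesis
      unfolding E'_eq by (simp add: vimage_def)
  qed
  have em: "emeasure lborel (E' k) = emeasure lborel E" for k
  proof -
    have "emeasure lborel E = emeasure (distr lborel borel ((+) (- ((real k * t) *\<^sub>R \<nu>)))) E"
      by (simp add: lborel_distr_plus)
    also have "\<dots> = emeasure lborel (E' k)"
      using Eb by (subst emeasure_distr) (auto simp: E'_eq vimage_def algebra_simps)
    finally show ?thesis by simp
  qed
  \<comment> \<open>The slabs \<open>k * t < h \<le> (k + 1) * t\<close> are half-open; the strict
    lower bound in the layer keeps neighbouring translates disjoint.\<close>
  have hE': "real k * t < h x \<and> h x \<le> (real k + 1) * t" if "x \<in> E' k" for x k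
  proof -
    have "h (x - (real k * t) *\<^sub>R \<nu>) = h x - real k * t"
      using shift[of x "- (real k * t)"] by simp
    then show ?thesis using that unfolding E'_eq E_def by (auto simp: algebra_simps)
  qed
  have "disjoint_family_on E' {..<m}"
    unfolding disjoint_family_on_def
  proof (intro ballI impI)
    fix i j assume "i \<in> {..<m}" "j \<in> {..<m}" and ij: "i \<noteq> j"
    show "E' i \<inter> E' j = {}"
    proof (rule ccontr)
      assume "E' i \<inter> E' j \<noteq> {}"
      then obtain x where x: "x \<in> E' i" "x \<in> E' j" by auto
      have "real i * t < (real j + 1) * t" "real j * t < (real i + 1) * t"
        using hE'[OF x(1)] hE'[OF x(2)] by linarith+
      then have "real i < real j + 1" "real j < real i + 1" using t by auto
      with ij show False by simp
    qed
  qed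
  then have "(\<Sum>k<m. emeasure lborel (E' k)) = emeasure lborel (\<Union>k<m. E' k)"
    using E'b by (intro sum_emeasure) auto
  moreover have "(\<Union>k<m. E' k) \<subseteq> cball y (2 * r)"
  proof
    fix x assume "x \<in> (\<Union>k<m. E' k)"
    then obtain k where k: "k < m" "x \<in> E' k" by auto
    then obtain z where z: "z \<in> E" "x = (real k * t) *\<^sub>R \<nu> + z" unfolding E'_def by auto
    have "real k * t \<le> (real m - 1) * t" using k t by (intro mult_right_mono) auto
    then have "real k * t \<le> r" using m1 by linarith
    then have "norm ((real k * t) *\<^sub>R \<nu>) \<le> r" using \<nu> t by simp
    moreover have "dist y z \<le> r" using z unfolding E_def by simp
    moreover have "dist y x \<le> dist y z + dist z x" by (rule dist_triangle)
    moreover have "dist z x = norm ((real k * t) *\<^sub>R \<nu>)" unfolding z(2) by (simp add: dist_norm)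
    ultimately have "dist y x \<le> 2 * r" by linarith
    then show "x \<in> cball y (2 * r)" by simp
  qed
  then have "emeasure lborel (\<Union>k<m. E' k) \<le> emeasure lborel (cball y (2 * r))"
    by (intro emeasure_mono) auto
  ultimately have A: "of_nat m * emeasure lborel E \<le> ennreal (unit_ball_vol DIM('a) * (2 * r) ^ DIM('a))"
    using em r by (simp add: emeasure_cball)
  have fin: "emeasure lborel E < \<infinity>"
  proof -
    have "emeasure lborel E \<le> emeasure lborel (cball y r)" by (intro emeasure_mono) (auto simp: E_def)
    then show ?thesis using emeasure_lborel_cball_finite[of y r] by (simp add: order_le_less_trans)
  qed
  then have "emeasure lborel E = ennreal (measure lborel E)" by (intro emeasure_eq_ennreal_measure) auto
  with A have "ennreal (real m * measure lborel E) \<le> ennreal (unit_ball_vol DIM('a) * (2 * r) ^ DIM('a))"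
    by (simp add: ennreal_mult' ennreal_of_nat_eq_real_of_nat)
  then have B: "real m * measure lborel E \<le> unit_ball_vol DIM('a) * (2 * r) ^ DIM('a)"
    using r by (subst (asm) ennreal_le_iff) auto
  have "r / t * measure lborel E \<le> real m * measure lborel E"
    using mr by (intro mult_right_mono) auto
  with B have "r / t * measure lborel E \<le> unit_ball_vol DIM('a) * (2 * r) ^ DIM('a)" by linarith
  then have "measure lborel E \<le> unit_ball_vol DIM('a) * (2 * r) ^ DIM('a) * t / r"
    using r t by (simp add: field_simps)
  also have "\<dots> = unit_ball_vol DIM('a) * 2 ^ DIM('a) * t * r powr (real DIM('a) - 1)"
    using r by (simp add: powr_diff powr_realpow power_mult_distrib)
  finally show ?thesis
    unfolding E_def[symmetric] \<open>emeasure lborel E = ennreal (measure lborel E)\<close>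
    by (rule ennreal_leI)
qed

text \<open>The gradient is continuous, hence bounded on the compact ball, and the mean value
  inequality applies because the ball is convex.\<close>

lemma C2_function_lipschitz_on_ball:
  fixes \<phi> :: "'a::euclidean_space \<Rightarrow> real"
  assumes "C2_function \<phi>"
  shows "\<exists>L\<ge>0. \<forall>x\<in>cball z r. \<forall>y\<in>cball z r. \<bar>\<phi> x - \<phi> y\<bar> \<le> L * norm (x - y)"
proof -
  obtain g :: "'a \<Rightarrow> 'a" and H :: "'a \<Rightarrow> 'a \<Rightarrow>\<^sub>L 'a" where
    g: "\<And>x. (\<phi> has_derivative (\<lambda>h. g x \<bullet> h)) (at x)"
    and H: "\<And>x. (g has_derivative blinfun_apply (H x)) (at x)"
    using assms unfolding C2_function_def by blast
  have "continuous_on (cball z r) g"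
    using H by (intro has_derivative_continuous_on) (auto intro: has_derivative_at_withinI)
  then have "bounded (g ` cball z r)"
    by (intro compact_imp_bounded compact_continuous_image) auto
  then obtain L where L: "L > 0" "\<And>x. x \<in> cball z r \<Longrightarrow> norm (g x) \<le> L"
    unfolding bounded_pos by auto
  have "norm (\<phi> x - \<phi> y) \<le> L * norm (x - y)" if "x \<in> cball z r" "y \<in> cball z r" for x y
  proof (rule differentiable_bound[where S = "cball z r" and f' = "\<lambda>x h. g x \<bullet> h"])
    fix w assume w: "w \<in> cball z r"
    show "(\<phi> has_derivative (\<lambda>h. g w \<bullet> h)) (at w within cball z r)"
      using g by (rule has_derivative_at_withinI)
    show "onorm (\<lambda>h. g w \<bullet> h) \<le> L"
    proof (rule onorm_le)
      fix h
      have "\<bar>g w \<bullet> h\<bar> \<le> norm (g w) * norm h" by (rule Cauchy_Schwarz_ineq2)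
      also have "\<dots> \<le> L * norm h" using L(2)[OF w] by (intro mult_right_mono) auto
      finally show "norm (g w \<bullet> h) \<le> L * norm h" by simp
    qed
  qed (use that in auto)
  then show ?thesis using L(1) by (intro exI[of _ L]) auto
qed

lemma bdist_attained:
  fixes \<Omega> :: "'a::euclidean_space set"
  assumes "open \<Omega>" "\<Omega> \<noteq> UNIV"
  obtains w where "w \<notin> \<Omega>" "bdist \<Omega> x = dist x w"
proof -
  have "closed (- \<Omega>)" "- \<Omega> \<noteq> {}" using assms by (auto simp: closed_def)
  then obtain w where "w \<in> - \<Omega>" "infdist x (- \<Omega>) = dist x w"
    using infdist_attains_inf by blast
  then show ?thesis using that unfolding bdist_def by auto
qed

text \<open>The height of \<open>x\<close> above the graph is at most a constant times its distance to the complement,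
  because the nearest point of the complement lies below the (Lipschitz) graph.\<close>

lemma C2_domain_boundary_chart:
  fixes \<Omega> :: "'a::euclidean_space set"
  assumes \<Omega>: "C2_domain \<Omega>" and z: "z \<in> frontier \<Omega>"
  shows "\<exists>\<rho> c h \<nu>. 0 < \<rho> \<and> 0 < c \<and> h \<in> borel_measurable borel \<and> norm \<nu> = 1 \<and>
    (\<forall>x a. h (x + a *\<^sub>R \<nu>) = h x + a) \<and>
    (\<forall>x. x \<in> \<Omega> \<longrightarrow> x \<in> ball z \<rho> \<longrightarrow> 0 < h x \<and> h x \<le> c * bdist \<Omega> x)"
proof -
  obtain r \<nu> \<phi> where r: "r > 0" and \<nu>: "norm \<nu> = 1" and \<phi>: "C2_function \<phi>"
    and eq: "\<Omega> \<inter> ball z r = {x \<in> ball z r. \<phi> (x - (x \<bullet> \<nu>) *\<^sub>R \<nu>) < x \<bullet> \<nu>}"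
    using \<Omega> z unfolding C2_domain_def by meson
  have op: "open \<Omega>" using \<Omega> unfolding C2_domain_def by simp
  have z\<Omega>: "z \<notin> \<Omega>" using z op by (simp add: frontier_def interior_open)
  define P where "P x = x - (x \<bullet> \<nu>) *\<^sub>R \<nu>" for x
  define h where "h x = x \<bullet> \<nu> - \<phi> (P x)" for x
  have \<nu>\<nu>: "\<nu> \<bullet> \<nu> = 1" using \<nu> by (simp add: dot_square_norm)
  have Pdiff: "norm (P x - P y) \<le> 2 * norm (x - y)" for x y
  proof -
    have "P x - P y = (x - y) - ((x - y) \<bullet> \<nu>) *\<^sub>R \<nu>" by (simp add: P_def algebra_simps)
    then have "norm (P x - P y) \<le> norm (x - y) + \<bar>(x - y) \<bullet> \<nu>\<bar>"
      using norm_triangle_ineq4[of "x - y" "((x - y) \<bullet> \<nu>) *\<^sub>R \<nu>"] \<nu> by simp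
    moreover have "\<bar>(x - y) \<bullet> \<nu>\<bar> \<le> norm (x - y)"
      using Cauchy_Schwarz_ineq2[of "x - y" \<nu>] \<nu> by simp
    ultimately show ?thesis by simp
  qed
  \<comment> \<open>The crude bound \<open>Pdiff\<close> makes the projection \<open>P\<close>
    2-Lipschitz, so it maps \<open>ball z r\<close> into this ball of twice the radius.\<close>
  obtain L where L: "L \<ge> 0" "\<And>x y. x \<in> cball (P z) (2 * r) \<Longrightarrow> y \<in> cball (P z) (2 * r) \<Longrightarrow>
      \<bar>\<phi> x - \<phi> y\<bar> \<le> L * norm (x - y)"
    using C2_function_lipschitz_on_ball[OF \<phi>] by meson
  have "continuous_on UNIV \<phi>"
    using \<phi> unfolding C2_function_def
    by (metis has_derivative_continuous continuous_at_imp_continuous_on)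
  then have m1: "\<phi> \<in> borel_measurable borel" by (rule borel_measurable_continuous_onI)
  have m2: "P \<in> borel_measurable borel" unfolding P_def
    by (intro borel_measurable_continuous_onI continuous_intros)
  have "(\<lambda>x. x \<bullet> \<nu>) \<in> borel_measurable borel"
    by (intro borel_measurable_continuous_onI continuous_intros)
  then have hm: "h \<in> borel_measurable borel"
    unfolding h_def using measurable_compose[OF m2 m1] by (intro borel_measurable_diff)
  have sh: "h (x + a *\<^sub>R \<nu>) = h x + a" for x a
  proof -
    have "P (x + a *\<^sub>R \<nu>) = P x" using \<nu>\<nu> by (simp add: P_def algebra_simps)
    then show ?thesis using \<nu>\<nu> by (simp add: h_def algebra_simps)
  qed
  \<comment> \<open>Half the radius: a nearest point \<open>w\<close> of the complement has
    \<open>dist x w \<le> dist x z\<close>, so it stays in \<open>ball z r\<close>, where the graph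
    describes \<Omega>. In the constant, 1 bounds the change of \<open>x \<bullet> \<nu>\<close> and
    \<open>2 * L\<close> that of the graph function after projection.\<close>
  have est: "0 < h x \<and> h x \<le> (1 + 2 * L) * bdist \<Omega> x" if x: "x \<in> \<Omega>" "x \<in> ball z (r / 2)" for x
  proof -
    have xr: "x \<in> ball z r" using x r by auto
    then have "x \<in> \<Omega> \<inter> ball z r" using x by simp
    then have pos: "0 < h x" unfolding eq h_def P_def by simp
    obtain w where w: "w \<notin> \<Omega>" "bdist \<Omega> x = dist x w"
      using bdist_attained[OF op] z\<Omega> by blast
    have "bdist \<Omega> x \<le> dist x z" unfolding bdist_def using z\<Omega> by (intro infdist_le) auto
    then have wr: "w \<in> ball z r"
      using w(2) x(2) dist_triangle[of z w x] by (simp add: dist_commute)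
    moreover have "w \<notin> \<Omega> \<inter> ball z r" using w by simp
    ultimately have "h w \<le> 0" unfolding eq h_def P_def by simp
    then have "h x \<le> h x - h w" by simp
    also have "\<dots> = (x - w) \<bullet> \<nu> + (\<phi> (P w) - \<phi> (P x))" by (simp add: h_def algebra_simps)
    also have "(x - w) \<bullet> \<nu> \<le> norm (x - w)"
      using Cauchy_Schwarz_ineq2[of "x - w" \<nu>] \<nu> by simp
    also have "\<phi> (P w) - \<phi> (P x) \<le> L * norm (P w - P x)"
    proof -
      have "P v \<in> cball (P z) (2 * r)" if "v \<in> ball z r" for v
        using Pdiff[of z v] that by (simp add: dist_norm)
      then show ?thesis using L(2)[of "P w" "P x"] wr xr by auto
    qed
    also have "L * norm (P w - P x) \<le> L * (2 * norm (x - w))"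
      using Pdiff[of w x] L(1) by (intro mult_left_mono) (auto simp: norm_minus_commute)
    finally show ?thesis using pos w(2) by (simp add: dist_norm algebra_simps)
  qed
  show ?thesis
    by (rule exI[of _ "r / 2"], rule exI[of _ "1 + 2 * L"], rule exI[of _ h], rule exI[of _ \<nu>])
       (use r L(1) hm \<nu> sh est in simp)
qed

lemma borel_measurable_bdist[measurable]: "bdist \<Omega> \<in> borel_measurable borel"
  unfolding bdist_def[abs_def] by (intro borel_measurable_continuous_onI continuous_intros)

lemma bdist_pos:
  fixes \<Omega> :: "'a::euclidean_space set"
  assumes "open \<Omega>" "\<Omega> \<noteq> UNIV" "x \<in> \<Omega>"
  shows "0 < bdist \<Omega> x"
  using bdist_attained[OF assms(1,2), of x] assms(3) by (metis zero_less_dist_iff)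

lemma bdist_nonneg: "0 \<le> bdist \<Omega> x"
  unfolding bdist_def by (rule infdist_nonneg)

lemma bdist_triangle: "bdist \<Omega> x \<le> bdist \<Omega> y + dist x y"
  unfolding bdist_def by (rule infdist_triangle)

lemma bdist_eq_0: "x \<notin> \<Omega> \<Longrightarrow> bdist \<Omega> x = 0"
  unfolding bdist_def by simp

lemma bounded_neq_UNIV: "bounded (\<Omega> :: 'a::euclidean_space set) \<Longrightarrow> \<Omega> \<noteq> UNIV"
  using not_bounded_UNIV by blast

lemma bdist_le_frontier:
  fixes \<Omega> :: "'a::euclidean_space set"
  assumes "open \<Omega>" "z \<in> frontier \<Omega>"
  shows "bdist \<Omega> x \<le> dist x z"
  unfolding bdist_def using assms by (intro infdist_le) (auto simp: frontier_def interior_open)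

text \<open>Finitely many charts cover the compact frontier, with a Lebesgue number
  \<open>e\<close>. If \<open>t < e\<close>, each point of the layer lies in a chart and the graph
  estimate applies with height \<open>c z * t\<close>. If \<open>e \<le> t\<close>, the whole ball
  is taken, and \<open>r \<le> R * (t / e)\<close> trades one power of \<open>r\<close> for
  \<open>t\<close>.\<close>

lemma emeasure_boundary_layer_le:
  fixes \<Omega> :: "'a::euclidean_space set"
  assumes \<Omega>: "C2_domain \<Omega>" and bd: "bounded \<Omega>" and R: "0 < R"
  shows "\<exists>C\<ge>0. \<forall>y r t. 0 < r \<longrightarrow> r \<le> R \<longrightarrow> 0 < t \<longrightarrow>
    emeasure lborel {x \<in> \<Omega>. dist x y \<le> r \<and> bdist \<Omega> x \<le> t}
      \<le> ennreal (C * t * r powr (real DIM('a) - 1))"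
proof -
  have op: "open \<Omega>" using \<Omega> unfolding C2_domain_def by simp
  define V where "V = unit_ball_vol (real DIM('a)) * 2 ^ DIM('a)"
  have V: "0 \<le> V" unfolding V_def by simp
  \<comment> \<open>The chart data are packed into one predicate so that a single choice function
    selects them as a tuple.\<close>
  define Q where "Q z \<rho> c h \<nu> \<longleftrightarrow> 0 < \<rho> \<and> 0 < c \<and> h \<in> borel_measurable borel \<and> norm \<nu> = 1 \<and>
    (\<forall>x a. h (x + a *\<^sub>R \<nu>) = h x + a) \<and>
    (\<forall>x. x \<in> \<Omega> \<longrightarrow> x \<in> ball z \<rho> \<longrightarrow> 0 < h x \<and> h x \<le> c * bdist \<Omega> x)"
    for z :: 'a and \<rho> c and h :: "'a \<Rightarrow> real" and \<nu>
  have "\<exists>q. Q z (fst q) (fst (snd q)) (fst (snd (snd q))) (snd (snd (snd q)))"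
    if z: "z \<in> frontier \<Omega>" for z
  proof -
    obtain \<rho> c h \<nu> where "Q z \<rho> c h \<nu>"
      using C2_domain_boundary_chart[OF \<Omega> z] unfolding Q_def by (elim exE) 
    then show ?thesis by (intro exI[of _ "(\<rho>, c, h, \<nu>)"]) simp
  qed
  then obtain q where q: "\<And>z. z \<in> frontier \<Omega> \<Longrightarrow>
      Q z (fst (q z)) (fst (snd (q z))) (fst (snd (snd (q z)))) (snd (snd (snd (q z))))"
    by metis
  define \<rho> c h \<nu> where "\<rho> z = fst (q z)" and "c z = fst (snd (q z))"
    and "h z = fst (snd (snd (q z)))" and "\<nu> z = snd (snd (snd (q z)))" for z
  have Q: "Q z (\<rho> z) (c z) (h z) (\<nu> z)" if "z \<in> frontier \<Omega>" for z
    using q[OF that] by (simp add: \<rho>_def c_def h_def \<nu>_def)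
  have cpt: "compact (frontier \<Omega>)" using bd by (rule compact_frontier_bounded)
  have "z \<in> ball z (\<rho> z)" if "z \<in> frontier \<Omega>" for z
    using Q[OF that] by (simp add: Q_def)
  then have cover: "frontier \<Omega> \<subseteq> (\<Union>z\<in>frontier \<Omega>. ball z (\<rho> z))" by blast
  obtain F where F: "F \<subseteq> frontier \<Omega>" "finite F" "frontier \<Omega> \<subseteq> (\<Union>z\<in>F. ball z (\<rho> z))"
    by (rule compactE_image[OF cpt _ cover]) auto
  obtain e where e: "e > 0" "\<And>x. x \<in> frontier \<Omega> \<Longrightarrow> ball x e \<subseteq> (\<Union>z\<in>F. ball z (\<rho> z))"
  proof -
    have "\<exists>e>0. \<forall>x\<in>frontier \<Omega>. \<exists>G\<in>(\<lambda>z. ball z (\<rho> z)) ` F. ball x e \<subseteq> G"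
    proof (rule Heine_Borel_lemma[OF cpt, of "(\<lambda>z. ball z (\<rho> z)) ` F"])
      fix e :: real
      assume "0 < e" "\<And>x. x \<in> frontier \<Omega> \<Longrightarrow> \<exists>G\<in>(\<lambda>z. ball z (\<rho> z)) ` F. ball x e \<subseteq> G"
      then show "\<exists>e>0. \<forall>x\<in>frontier \<Omega>. \<exists>G\<in>(\<lambda>z. ball z (\<rho> z)) ` F. ball x e \<subseteq> G"
        by blast
    qed (use F(3) in auto)
    then obtain e where "e > 0"
      and e: "\<And>x. x \<in> frontier \<Omega> \<Longrightarrow> \<exists>G\<in>(\<lambda>z. ball z (\<rho> z)) ` F. ball x e \<subseteq> G" by auto
    have "ball x e \<subseteq> (\<Union>z\<in>F. ball z (\<rho> z))" if x: "x \<in> frontier \<Omega>" for x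
    proof -
      obtain G where "G \<in> (\<lambda>z. ball z (\<rho> z)) ` F" "ball x e \<subseteq> G" using e[OF x] ..
      then show ?thesis by (meson Union_upper subset_trans)
    qed
    with \<open>e > 0\<close> show thesis by (rule that)
  qed
  \<comment> \<open>The sum serves the layers thinner than the Lebesgue number, the second term the
    thicker ones.\<close>
  define C where "C = (\<Sum>z\<in>F. V * c z) + V * R / e"
  have csum: "0 \<le> (\<Sum>z\<in>F. V * c z)"
  proof (intro sum_nonneg mult_nonneg_nonneg V)
    fix z assume "z \<in> F"
    then have "Q z (\<rho> z) (c z) (h z) (\<nu> z)" using Q F(1) by auto
    then show "0 \<le> c z" by (simp add: Q_def)
  qed
  have C: "0 \<le> C" unfolding C_def using csum V R e(1) by simp
  have "emeasure lborel {x \<in> \<Omega>. dist x y \<le> r \<and> bdist \<Omega> x \<le> t}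
      \<le> ennreal (C * t * r powr (real DIM('a) - 1))" if r: "0 < r" "r \<le> R" and t: "0 < t" for y r t
  proof (cases "t < e")
    case True
    have "{x \<in> \<Omega>. dist x y \<le> r \<and> bdist \<Omega> x \<le> t}
      \<subseteq> (\<Union>z\<in>F. {x \<in> cball y r. 0 < h z x \<and> h z x \<le> c z * t})"
    proof
      fix x assume x: "x \<in> {x \<in> \<Omega>. dist x y \<le> r \<and> bdist \<Omega> x \<le> t}"
      obtain w where w: "w \<notin> \<Omega>" "bdist \<Omega> x = dist x w"
        using bdist_attained[OF op bounded_neq_UNIV[OF bd]] by blast
      \<comment> \<open>The segment from \<open>x\<close> to a nearest point of the complement must
        cross the frontier, which yields a frontier point at distance at most
        \<open>t < e\<close>.\<close>
      obtain w' where w': "w' \<in> closed_segment x w" "w' \<in> frontier \<Omega>"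
      proof -
        have "closed_segment x w \<inter> \<Omega> \<noteq> {}" "closed_segment x w - \<Omega> \<noteq> {}"
          using x w(1) by (auto intro: ends_in_segment)
        then have "closed_segment x w \<inter> frontier \<Omega> \<noteq> {}"
          by (intro connected_Int_frontier connected_segment)
        then show thesis using that by blast
      qed
      have "dist x w' \<le> dist x w"
        using w'(1) by (metis dist_commute dist_in_closed_segment(1))
      then have "x \<in> ball w' e" using x w True by (simp add: dist_commute)
      then obtain z where z: "z \<in> F" "x \<in> ball z (\<rho> z)" using e(2)[OF w'(2)] by auto
      then have qz: "0 < h z x \<and> h z x \<le> c z * bdist \<Omega> x" "0 < c z"
        using Q[of z] F(1) x unfolding Q_def by auto
      have "c z * bdist \<Omega> x \<le> c z * t" using qz x by (intro mult_left_mono) auto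
      then have "h z x \<le> c z * t" using qz by linarith
      then show "x \<in> (\<Union>z\<in>F. {x \<in> cball y r. 0 < h z x \<and> h z x \<le> c z * t})"
        using z(1) qz x by (intro UN_I[of z]) (auto simp: dist_commute)
    qed
    moreover have meas: "{x \<in> cball y r. 0 < h z x \<and> h z x \<le> c z * t} \<in> sets borel" if "z \<in> F" for z
    proof -
      have [measurable]: "h z \<in> borel_measurable borel" using Q that F(1) unfolding Q_def by auto
      show ?thesis by measurable
    qed
    ultimately have "emeasure lborel {x \<in> \<Omega>. dist x y \<le> r \<and> bdist \<Omega> x \<le> t}
      \<le> emeasure lborel (\<Union>z\<in>F. {x \<in> cball y r. 0 < h z x \<and> h z x \<le> c z * t})"
      using F(2) by (intro emeasure_mono) auto
    also have "\<dots> \<le> (\<Sum>z\<in>F. emeasure lborel {x \<in> cball y r. 0 < h z x \<and> h z x \<le> c z * t})"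
      using F(2) meas by (intro emeasure_subadditive_finite) auto
    also have "\<dots> \<le> (\<Sum>z\<in>F. ennreal (V * (c z * t) * r powr (real DIM('a) - 1)))"
    proof (intro sum_mono)
      fix z assume "z \<in> F"
      then have "Q z (\<rho> z) (c z) (h z) (\<nu> z)" using Q F(1) by auto
      then show "emeasure lborel {x \<in> cball y r. 0 < h z x \<and> h z x \<le> c z * t}
          \<le> ennreal (V * (c z * t) * r powr (real DIM('a) - 1))"
        unfolding V_def using r t
        by (intro emeasure_graph_layer_le[where \<nu> = "\<nu> z"]) (auto simp: Q_def)
    qed
    also have "\<dots> = ennreal (\<Sum>z\<in>F. V * (c z * t) * r powr (real DIM('a) - 1))"
    proof (intro sum_ennreal mult_nonneg_nonneg V)
      fix z assume "z \<in> F"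
      then have "Q z (\<rho> z) (c z) (h z) (\<nu> z)" using Q F(1) by auto
      then show "0 \<le> c z" by (simp add: Q_def)
    qed (use t in auto)
    also have "(\<Sum>z\<in>F. V * (c z * t) * r powr (real DIM('a) - 1))
        = (\<Sum>z\<in>F. V * c z) * t * r powr (real DIM('a) - 1)"
      by (simp add: sum_distrib_left sum_distrib_right mult_ac)
    also have "ennreal \<dots> \<le> ennreal (C * t * r powr (real DIM('a) - 1))"
      unfolding C_def using V R e(1) t by (intro ennreal_leI mult_right_mono) auto
    finally show ?thesis .
  next
    case False
    have "emeasure lborel {x \<in> \<Omega>. dist x y \<le> r \<and> bdist \<Omega> x \<le> t} \<le> emeasure lborel (cball y r)"
      by (intro emeasure_mono) (auto simp: dist_commute)
    also have "\<dots> = ennreal (unit_ball_vol (real DIM('a)) * r ^ DIM('a))"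
      using r by (simp add: emeasure_cball)
    also have "\<dots> \<le> ennreal (C * t * r powr (real DIM('a) - 1))"
    proof (rule ennreal_leI)
      have "unit_ball_vol (real DIM('a)) * r ^ DIM('a) \<le> V * r ^ DIM('a)"
        unfolding V_def using r by (intro mult_right_mono) (auto intro: order_trans[OF _ mult_left_mono[where a = 1]])
      also have "V * r ^ DIM('a) = V * (r * r powr (real DIM('a) - 1))"
        using r by (simp add: powr_diff powr_realpow)
      also have "V * (r * r powr (real DIM('a) - 1)) \<le> V * ((R * (t / e)) * r powr (real DIM('a) - 1))"
      proof (intro mult_left_mono mult_right_mono V)
        have "r * 1 \<le> R * (t / e)" using r False e(1) R by (intro mult_mono) auto
        then show "r \<le> R * (t / e)" by simp
      qed auto
      also have "\<dots> = V * R / e * t * r powr (real DIM('a) - 1)" by simp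
      also have "\<dots> \<le> C * t * r powr (real DIM('a) - 1)"
        unfolding C_def using csum t by (intro mult_right_mono) auto
      finally show "unit_ball_vol (real DIM('a)) * r ^ DIM('a) \<le> C * t * r powr (real DIM('a) - 1)" .
    qed
    finally show ?thesis .
  qed
  then show ?thesis using C by blast
qed

text \<open>Decompose dyadically in both \<open>dist x y\<close> and \<open>bdist \<Omega> x\<close>.  Interpolating
  \<open>min (2\<^sup>-\<^sup>j) (2\<^sup>-\<^sup>k) \<le> 2 powr (- k \<theta> - j (1 - \<theta>))\<close> in the layer estimate with
  \<open>\<beta> < \<theta> < min 1 (N - b)\<close> turns the double sum into a product of geometric series.\<close>

lemma riesz_potential_boundary_weight_bounded:
  fixes \<Omega> :: "'a::euclidean_space set"
  assumes \<Omega>: "C2_domain \<Omega>" and bd: "bounded \<Omega>"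
    and \<beta>: "0 \<le> \<beta>" "\<beta> < 1" and b: "b + \<beta> < real DIM('a)"
  shows "\<exists>B\<ge>0. \<forall>y\<in>\<Omega>. (\<integral>\<^sup>+x\<in>\<Omega>. ennreal (dist x y powr (- b) * bdist \<Omega> x powr (- \<beta>)) \<partial>lborel) \<le> ennreal B"
proof -
  have op: "open \<Omega>" and ne: "\<Omega> \<noteq> {}" using \<Omega> unfolding C2_domain_def by auto
  have [measurable]: "\<Omega> \<in> sets borel" using op by simp
  define N where "N = real DIM('a)"
  \<comment> \<open>The extra 1 makes all distances between points of \<Omega>, and all boundary
    distances, strictly smaller than the coarsest scale \<open>a 0 = R\<close>.\<close>
  define R where "R = diameter \<Omega> + 1"
  have R: "1 \<le> R" unfolding R_def using bd by (simp add: diameter_ge_0)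
  have dR: "dist x y < R" if "x \<in> \<Omega>" "y \<in> \<Omega>" for x y
    using diameter_bounded_bound[OF bd that] unfolding R_def by simp
  have \<delta>R: "bdist \<Omega> x < R" if x: "x \<in> \<Omega>" for x
  proof -
    have "frontier \<Omega> \<noteq> {}" using ne bounded_neq_UNIV[OF bd] by (simp add: frontier_eq_empty)
    then obtain z where z: "z \<in> frontier \<Omega>" by auto
    have "bdist \<Omega> x \<le> dist x z" by (rule bdist_le_frontier[OF op z])
    also have "\<dots> \<le> diameter (closure \<Omega>)"
      using x z bd closure_subset
      by (intro diameter_bounded_bound) (auto simp: frontier_def)
    also have "\<dots> = diameter \<Omega>" using bd by (rule diameter_closure)
    finally show ?thesis unfolding R_def by simp
  qed
  obtain C where C: "0 \<le> C" "\<And>y r t. 0 < r \<Longrightarrow> r \<le> R \<Longrightarrow> 0 < t \<Longrightarrow>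
    emeasure lborel {x \<in> \<Omega>. dist x y \<le> r \<and> bdist \<Omega> x \<le> t} \<le> ennreal (C * t * r powr (N - 1))"
    using emeasure_boundary_layer_le[OF \<Omega> bd, of R] R unfolding N_def by auto
  \<comment> \<open>The midpoint of \<beta> and \<open>min 1 (N - b)\<close>, so that both exponents
    \<open>\<theta> - \<beta>\<close> and \<open>N - \<theta> - b\<close> of the geometric series
    are positive.\<close>
  define \<theta> where "\<theta> = (\<beta> + min 1 (N - b)) / 2"
  have \<theta>: "\<beta> < \<theta>" "\<theta> < 1" "\<theta> < N - b" "0 \<le> \<theta>"
    using \<beta> b unfolding \<theta>_def N_def by (auto simp: min_def field_simps)
  define a where "a i = R * 2 powr (- real i)" for i :: nat
  have a: "0 < a i" "a i \<le> R" for i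
  proof -
    have "2 powr (- real i) \<le> (2::real) powr 0" by (intro powr_mono) auto
    then show "a i \<le> R" unfolding a_def using R by (simp add: mult_left_le)
    show "0 < a i" unfolding a_def using R by simp
  qed
  have a_Suc: "a (Suc i) = a i / 2" for i unfolding a_def by (simp add: powr_diff powr_minus powr_add field_simps)
  have a_ex: "\<exists>i. a (Suc i) < t \<and> t \<le> a i" if t: "0 < t" "t < R" for t
  proof -
    have "(\<lambda>i. R * (1 / 2) ^ i) \<longlonglongrightarrow> R * 0"
      by (rule tendsto_mult_left[OF LIMSEQ_realpow_zero]) auto
    moreover have "R * (1/2) ^ i = a i" for i unfolding a_def by (simp add: powr_minus powr_realpow power_one_over inverse_eq_divide)
    ultimately have "a \<longlonglongrightarrow> 0" by simp
    then have "eventually (\<lambda>i. a i < t) sequentially" using t(1) by (rule order_tendstoD(2))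
    then obtain i where i: "a i < t" by (auto simp: eventually_sequentially)
    define m where "m = (LEAST i. a i < t)"
    have "a m < t" unfolding m_def using i by (rule LeastI)
    moreover have "a 0 = R" by (simp add: a_def)
    ultimately have "m \<noteq> 0" using t by (metis less_asym)
    then obtain k where k: "m = Suc k" by (cases m) auto
    have "\<not> a k < t" using not_less_Least[of k "\<lambda>i. a i < t"] unfolding m_def[symmetric] k by simp
    with \<open>a m < t\<close> k show ?thesis by (intro exI[of _ k]) auto
  qed
  define S where "S y j k = {x \<in> \<Omega>. dist x y \<le> a j \<and> bdist \<Omega> x \<le> a k}" for y j k
  have Sm[measurable]: "S y j k \<in> sets borel" for y j k unfolding S_def by measurable
  define D where "D = 2 powr \<bar>b\<bar>"
  define E where "E = 2 powr \<beta>"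
  define c where "c j k = D * a j powr (- b) * (E * a k powr (- \<beta>))" for j k
  have cpos: "0 \<le> c j k" for j k unfolding c_def D_def E_def by simp
  define K where "K = C + unit_ball_vol N"
  have K: "C \<le> K" "unit_ball_vol N \<le> K" "0 \<le> K"
    unfolding K_def N_def using C(1) by (auto intro: add_nonneg_nonneg)
  \<comment> \<open>For \<open>a k \<le> a j\<close> this interpolates the layer estimate. Otherwise
    the layer condition is dropped, and the volume of the ball suffices because
    \<open>a j < a k\<close>.\<close>
  have Sle: "emeasure lborel (S y j k) \<le> ennreal (K * (a k powr \<theta> * a j powr (N - \<theta>)))" for y j k
  proof (cases "a k \<le> a j")
    case True
    have "emeasure lborel (S y j k) \<le> ennreal (C * a k * a j powr (N - 1))"
      unfolding S_def using C(2)[of "a j" "a k" y] a by auto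
    also have "\<dots> \<le> ennreal (K * (a k powr \<theta> * a j powr (N - \<theta>)))"
    proof (rule ennreal_leI)
      have "a k = a k powr \<theta> * a k powr (1 - \<theta>)" using a(1)[of k] by (simp add: powr_add[symmetric])
      also have "\<dots> \<le> a k powr \<theta> * a j powr (1 - \<theta>)"
        using True a(1)[of k] \<theta> by (intro mult_left_mono powr_mono2) auto
      finally have "a k * a j powr (N - 1) \<le> (a k powr \<theta> * a j powr (1 - \<theta>)) * a j powr (N - 1)"
        by (intro mult_right_mono) auto
      also have "\<dots> = a k powr \<theta> * a j powr (N - \<theta>)"
        by (simp add: mult.assoc powr_add[symmetric])
      finally have "C * (a k * a j powr (N - 1)) \<le> K * (a k powr \<theta> * a j powr (N - \<theta>))"
        using K a(1)[of k] by (rule_tac mult_mono) auto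
      then show "C * a k * a j powr (N - 1) \<le> K * (a k powr \<theta> * a j powr (N - \<theta>))"
        by (simp add: mult.assoc)
    qed
    finally show ?thesis .
  next
    case False
    have "emeasure lborel (S y j k) \<le> emeasure lborel (cball y (a j))"
      unfolding S_def by (intro emeasure_mono) (auto simp: dist_commute)
    also have "\<dots> = ennreal (unit_ball_vol N * a j powr N)"
      unfolding N_def using a(1)[of j] by (simp add: emeasure_cball powr_realpow)
    also have "\<dots> \<le> ennreal (K * (a k powr \<theta> * a j powr (N - \<theta>)))"
    proof (rule ennreal_leI)
      have "a j powr N = a j powr \<theta> * a j powr (N - \<theta>)" using a(1)[of j] by (simp add: powr_add[symmetric])
      also have "\<dots> \<le> a k powr \<theta> * a j powr (N - \<theta>)"
        using False a(1)[of j] \<theta> by (intro mult_right_mono powr_mono2) auto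
      finally show "unit_ball_vol N * a j powr N \<le> K * (a k powr \<theta> * a j powr (N - \<theta>))"
        using K by (intro mult_mono) auto
    qed
    finally show ?thesis .
  qed
  \<comment> \<open>Within a dyadic shell a power is comparable to its value at the outer radius.
    The exponent \<open>b\<close> may be negative, hence the absolute value in the constant.\<close>
  have comp: "t powr (- e) \<le> 2 powr \<bar>e\<bar> * a i powr (- e)" if "a (Suc i) < t" "t \<le> a i" for t e i
  proof -
    have t: "0 < t" using a(1)[of "Suc i"] that by linarith
    show ?thesis
    proof (cases "0 \<le> e")
      case True
      have "t powr (- e) \<le> (a i / 2) powr (- e)"
        using that True a(1)[of i] unfolding a_Suc by (intro powr_mono2') auto
      also have "\<dots> = 2 powr \<bar>e\<bar> * a i powr (- e)"
        using True a(1)[of i] by (simp add: powr_divide powr_minus field_simps)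
      finally show ?thesis .
    next
      case False
      have "t powr (- e) \<le> 1 * a i powr (- e)" using that False t by (auto intro!: powr_mono2)
      also have "\<dots> \<le> 2 powr \<bar>e\<bar> * a i powr (- e)"
        by (intro mult_right_mono ge_one_powr_ge_zero) auto
      finally show ?thesis .
    qed
  qed
  \<comment> \<open>A single term of the double sum already dominates: the one for the shells of
    \<open>dist x y\<close> and \<open>bdist \<Omega> x\<close>. On the diagonal the left-hand side
    is 0, because \<open>0 powr (- b) = 0\<close>.\<close>
  have pt: "ennreal (dist x y powr (- b) * bdist \<Omega> x powr (- \<beta>)) * indicator \<Omega> x
      \<le> (\<Sum>j. \<Sum>k. ennreal (c j k) * indicator (S y j k) x)" if y: "y \<in> \<Omega>" for x y
  proof (cases "x \<in> \<Omega> \<and> x \<noteq> y")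
    case True
    then have x: "x \<in> \<Omega>" "x \<noteq> y" by auto
    obtain j where j: "a (Suc j) < dist x y" "dist x y \<le> a j" using a_ex[of "dist x y"] x dR y by auto
    obtain k where k: "a (Suc k) < bdist \<Omega> x" "bdist \<Omega> x \<le> a k"
      using a_ex[of "bdist \<Omega> x"] \<delta>R x(1) bdist_pos[OF op bounded_neq_UNIV[OF bd] x(1)] by auto
    have xS: "x \<in> S y j k" unfolding S_def using x j k by simp
    have "dist x y powr (- b) * bdist \<Omega> x powr (- \<beta>) \<le> c j k"
      unfolding c_def D_def E_def using comp[OF j, of b] comp[OF k, of \<beta>] \<beta>
      by (intro mult_mono) auto
    then have "ennreal (dist x y powr (- b) * bdist \<Omega> x powr (- \<beta>)) \<le> ennreal (c j k)"
      by (rule ennreal_leI)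
    also have "\<dots> = (\<Sum>k'\<in>{k}. ennreal (c j k') * indicator (S y j k') x)" using xS by simp
    also have "\<dots> \<le> (\<Sum>k'. ennreal (c j k') * indicator (S y j k') x)"
      by (rule sum_le_suminf) auto
    also have "\<dots> = (\<Sum>j'\<in>{j}. \<Sum>k'. ennreal (c j' k') * indicator (S y j' k') x)" by simp
    also have "\<dots> \<le> (\<Sum>j'. \<Sum>k'. ennreal (c j' k') * indicator (S y j' k') x)"
      by (rule sum_le_suminf) auto
    finally show ?thesis using x by simp
  qed (auto simp: indicator_def)
  have summ: "summable (\<lambda>i. a i powr e)" if e: "0 < e" for e
  proof -
    have "a i powr e = R powr e * (2 powr (- e)) ^ i" for i
      unfolding a_def using R by (simp add: powr_mult powr_powr powr_realpow[symmetric] mult_ac)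
    moreover have "summable (\<lambda>i. R powr e * (2 powr (- e)) ^ i)"
      using e by (intro summable_mult summable_geometric) (auto simp: powr_less_one)
    ultimately show ?thesis by simp
  qed
  define A1 where "A1 = (\<Sum>j. a j powr (N - \<theta> - b))"
  define A2 where "A2 = (\<Sum>k. a k powr (\<theta> - \<beta>))"
  have A: "0 \<le> A1" "0 \<le> A2"
    unfolding A1_def A2_def using summ \<theta> by (auto intro!: suminf_nonneg)
  have "(\<integral>\<^sup>+x\<in>\<Omega>. ennreal (dist x y powr (- b) * bdist \<Omega> x powr (- \<beta>)) \<partial>lborel)
      \<le> ennreal (D * E * K * A1 * A2)" if y: "y \<in> \<Omega>" for y
  proof -
    have "(\<integral>\<^sup>+x\<in>\<Omega>. ennreal (dist x y powr (- b) * bdist \<Omega> x powr (- \<beta>)) \<partial>lborel)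
        \<le> (\<integral>\<^sup>+x. (\<Sum>j. \<Sum>k. ennreal (c j k) * indicator (S y j k) x) \<partial>lborel)"
      using pt[OF y] by (intro nn_integral_mono) auto
    also have "\<dots> = (\<Sum>j. \<Sum>k. ennreal (c j k) * emeasure lborel (S y j k))"
      by (simp add: nn_integral_suminf nn_integral_cmult)
    also have "\<dots> \<le> (\<Sum>j. \<Sum>k. ennreal (D * E * K) * ennreal (a j powr (N - \<theta> - b)) * ennreal (a k powr (\<theta> - \<beta>)))"
    proof (intro suminf_le summableI)
      fix j k
      have "ennreal (c j k) * emeasure lborel (S y j k)
          \<le> ennreal (c j k) * ennreal (K * (a k powr \<theta> * a j powr (N - \<theta>)))"
        using Sle by (intro mult_left_mono) auto
      also have "\<dots> = ennreal (c j k * (K * (a k powr \<theta> * a j powr (N - \<theta>))))"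
        using cpos by (simp add: ennreal_mult')
      also have "c j k * (K * (a k powr \<theta> * a j powr (N - \<theta>)))
          = (D * E * K) * (a j powr (- b) * a j powr (N - \<theta>)) * (a k powr \<theta> * a k powr (- \<beta>))"
        unfolding c_def by (simp add: mult_ac)
      also have "a j powr (- b) * a j powr (N - \<theta>) = a j powr (N - \<theta> - b)" by (simp add: powr_add[symmetric])
      also have "a k powr \<theta> * a k powr (- \<beta>) = a k powr (\<theta> - \<beta>)" by (simp add: powr_add[symmetric])
      finally show "ennreal (c j k) * emeasure lborel (S y j k)
          \<le> ennreal (D * E * K) * ennreal (a j powr (N - \<theta> - b)) * ennreal (a k powr (\<theta> - \<beta>))"
        using K(3) by (simp add: ennreal_mult D_def E_def)
    qed
    also have "\<dots> = ennreal (D * E * K) * ennreal A1 * ennreal A2"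
    proof -
      have "(\<Sum>k. ennreal (a k powr (\<theta> - \<beta>))) = ennreal A2"
        unfolding A2_def using summ[of "\<theta> - \<beta>"] \<theta> by (intro suminf_ennreal2) auto
      moreover have "(\<Sum>j. ennreal (a j powr (N - \<theta> - b))) = ennreal A1"
        unfolding A1_def using summ[of "N - \<theta> - b"] \<theta> by (intro suminf_ennreal2) auto
      ultimately show ?thesis by (simp add: ennreal_suminf_cmult ennreal_suminf_multc)
    qed
    also have "\<dots> = ennreal (D * E * K * A1 * A2)"
      using A K(3) by (simp add: ennreal_mult D_def E_def)
    finally show ?thesis .
  qed
  then show ?thesis using A K(3) by (intro exI[of _ "D * E * K * A1 * A2"]) (simp add: D_def E_def)
qed

section \<open>Pseudometric compactness and \<open>L\<^sup>p\<close> seminorms\<close>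

text \<open>The corresponding fact for \<open>Metric_space\<close> is transferred along a choice of
  representatives of the classes at distance 0; open sets are saturated for these classes.\<close>

lemma compactin_closure_of_pseudometric:
  fixes L :: "'b set" and d :: "'b \<Rightarrow> 'b \<Rightarrow> real"
  assumes nonneg: "\<And>x y. 0 \<le> d x y" and comm: "\<And>x y. d x y = d y x"
    and refl: "\<And>x. d x x = 0"
    and tri: "\<And>x y z. x \<in> L \<Longrightarrow> y \<in> L \<Longrightarrow> z \<in> L \<Longrightarrow> d x z \<le> d x y + d y z"
    and complete: "\<And>\<sigma> :: nat \<Rightarrow> 'b. range \<sigma> \<subseteq> L \<Longrightarrow>
      (\<forall>e>0. \<exists>N. \<forall>m\<ge>N. \<forall>n\<ge>N. d (\<sigma> m) (\<sigma> n) < e) \<Longrightarrow> \<exists>l\<in>L. (\<lambda>n. d (\<sigma> n) l) \<longlonglongrightarrow> 0"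
    and X: "\<And>U. openin X U \<longleftrightarrow> U \<subseteq> L \<and> (\<forall>u\<in>U. \<exists>r>0. \<forall>v\<in>L. d u v < r \<longrightarrow> v \<in> U)"
    and S: "S \<subseteq> L"
    and tb: "\<And>e. 0 < e \<Longrightarrow> \<exists>F. finite F \<and> F \<subseteq> L \<and> (\<forall>s\<in>S. \<exists>f\<in>F. d s f < e)"
  shows "compactin X (X closure_of S)"
proof -
  define rep where "rep u = (SOME v. v \<in> L \<and> d u v = 0)" for u
  have rep: "rep u \<in> L" "d u (rep u) = 0" if "u \<in> L" for u
  proof -
    have "\<exists>v. v \<in> L \<and> d u v = 0" using that refl by blast
    from someI_ex[OF this] show "rep u \<in> L" "d u (rep u) = 0" unfolding rep_def by auto
  qed
  have d_eq: "d u w = d v w" if "u \<in> L" "v \<in> L" "w \<in> L" "d u v = 0" for u v w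
    using tri[of u v w] tri[of v u w] that comm[of v u] by linarith
  \<comment> \<open>For points at distance 0 the choice predicates are equal as functions, so
    \<open>SOME\<close> picks the same representative.\<close>
  have rep_eq: "rep u = rep v" if "u \<in> L" "v \<in> L" "d u v = 0" for u v
  proof -
    have "(\<lambda>w. w \<in> L \<and> d u w = 0) = (\<lambda>w. w \<in> L \<and> d v w = 0)"
      using d_eq[OF that(1,2) _ that(3)] by auto
    then show ?thesis unfolding rep_def by simp
  qed
  define M where "M = rep ` L"
  have repM: "rep u \<in> M" if "u \<in> L" for u unfolding M_def using that by simp
  have M_sub: "M \<subseteq> L" unfolding M_def using rep by auto
  interpret M: Metric_space M d
  proof
    fix x y assume x: "x \<in> M" and y: "y \<in> M"
    show "d x y = 0 \<longleftrightarrow> x = y"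
    proof
      assume 0: "d x y = 0"
      obtain u v where u: "u \<in> L" "x = rep u" and v: "v \<in> L" "y = rep v" using x y unfolding M_def by auto
      have "d u v = 0"
        using d_eq[OF u(1) rep(1)[OF u(1)] v(1) rep(2)[OF u(1)]]
          d_eq[OF v(1) rep(1)[OF v(1)] rep(1)[OF u(1)] rep(2)[OF v(1)]] 0
        by (simp add: u(2) v(2) comm)
      then show "x = y" unfolding u(2) v(2) using u(1) v(1) by (intro rep_eq)
    qed (simp add: refl)
  next
    fix x y z assume "x \<in> M" "y \<in> M" "z \<in> M"
    then show "d x z \<le> d x y + d y z" using M_sub by (intro tri) auto
  qed (fact nonneg comm)+
  have complete': "M.mcomplete"
    unfolding M.mcomplete_def
  proof (intro allI impI)
    fix \<sigma> assume \<sigma>: "M.MCauchy \<sigma>"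
    then have rM: "range \<sigma> \<subseteq> M" by (simp add: M.MCauchy_def)
    have C: "\<forall>e>0. \<exists>N. \<forall>m\<ge>N. \<forall>n\<ge>N. d (\<sigma> m) (\<sigma> n) < e"
      using \<sigma> unfolding M.MCauchy_def by meson
    have "\<exists>l\<in>L. (\<lambda>n. d (\<sigma> n) l) \<longlonglongrightarrow> 0"
      using order_trans[OF rM M_sub] C by (rule complete)
    then obtain l where l: "l \<in> L" "(\<lambda>n. d (\<sigma> n) l) \<longlonglongrightarrow> 0" ..
    have "d (\<sigma> n) (rep l) = d (\<sigma> n) l" for n
    proof -
      have "\<sigma> n \<in> L" using rM M_sub by auto
      from d_eq[OF l(1) rep(1)[OF l(1)] this rep(2)[OF l(1)]] show ?thesis
        by (simp only: comm[of "\<sigma> n"])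
    qed
    then have "limitin M.mtopology \<sigma> (rep l) sequentially"
      unfolding M.limitin_metric_dist_null using l rM by (auto simp: repM image_subset_iff)
    then show "\<exists>x. limitin M.mtopology \<sigma> x sequentially" ..
  qed
  have tb': "M.mtotally_bounded (rep ` S)"
    unfolding M.mtotally_bounded_def
  proof (intro allI impI)
    fix e :: real assume e: "0 < e"
    obtain F where F: "finite F" "F \<subseteq> L" "\<And>s. s \<in> S \<Longrightarrow> \<exists>f\<in>F. d s f < e / 2" using tb[of "e / 2"] e by auto
    \<comment> \<open>\<open>mtotally_bounded\<close> wants its centres in the set itself, while the
      net \<open>F\<close> merely lies in \<open>L\<close>. Each useful \<open>f\<close> is replaced
      by a nearby point of \<open>S\<close>, at the price of doubling the radius.\<close>
    define c where "c f = (SOME s. s \<in> S \<and> d s f < e / 2)" for f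
    define F' where "F' = {f \<in> F. \<exists>s\<in>S. d s f < e / 2}"
    have c: "c f \<in> S \<and> d (c f) f < e / 2" if "f \<in> F'" for f
      unfolding c_def using that by (intro someI_ex[where P = "\<lambda>s. s \<in> S \<and> d s f < e / 2"]) (auto simp: F'_def)
    have "rep ` S \<subseteq> (\<Union>x\<in>(rep \<circ> c) ` F'. M.mball x e)"
    proof
      fix x assume "x \<in> rep ` S"
      then obtain s where s: "s \<in> S" "x = rep s" by auto
      obtain f where f: "f \<in> F" "d s f < e / 2" using F(3)[OF s(1)] by auto
      then have f': "f \<in> F'" using s unfolding F'_def by auto
      have L: "s \<in> L" "c f \<in> L" "f \<in> L" using s S c[OF f'] f F(2) by auto
      have "d (c f) s \<le> d (c f) f + d f s" using L by (intro tri)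
      then have "d (c f) s < e" using c[OF f'] f(2) comm[of f s] by linarith
      moreover have "d (rep (c f)) (rep s) = d (c f) s"
        using d_eq[OF L(2) rep(1)[OF L(2)] L(1) rep(2)[OF L(2)]]
          d_eq[OF L(1) rep(1)[OF L(1)] rep(1)[OF L(2)] rep(2)[OF L(1)]] by (simp add: comm)
      ultimately have "x \<in> M.mball (rep (c f)) e" using L s(2) by (auto simp: M.in_mball repM)
      then show "x \<in> (\<Union>x\<in>(rep \<circ> c) ` F'. M.mball x e)" using f' by auto
    qed
    moreover have "finite ((rep \<circ> c) ` F')" "(rep \<circ> c) ` F' \<subseteq> rep ` S"
      using F(1) c by (auto simp: F'_def)
    ultimately show "\<exists>K. finite K \<and> K \<subseteq> rep ` S \<and> rep ` S \<subseteq> (\<Union>x\<in>K. M.mball x e)" by blast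
  qed
  define K where "K = X closure_of S"
  define K' where "K' = M.mtopology closure_of (rep ` S)"
  have cK': "compactin M.mtopology K'"
    using tb' complete' M.mtotally_bounded_eq_compact_closure_of unfolding K'_def by blast
  have top: "topspace X = L"
  proof -
    have "openin X L" unfolding X by (auto intro: zero_less_one)
    then have "L \<subseteq> topspace X" by (rule openin_subset)
    moreover have "topspace X \<subseteq> L" using openin_topspace[of X] unfolding X by simp
    ultimately show ?thesis by simp
  qed
  have ball_open: "openin X {v \<in> L. d u v < r}" if "u \<in> L" for u r
    unfolding X
  proof (intro conjI ballI)
    fix v assume v: "v \<in> {v \<in> L. d u v < r}"
    have "d u w \<le> d u v + d v w" if "w \<in> L" for w
      using v that \<open>u \<in> L\<close> by (intro tri) auto
    then show "\<exists>r'>0. \<forall>w\<in>L. d v w < r' \<longrightarrow> w \<in> {v \<in> L. d u v < r}"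
      using v by (intro exI[of _ "r - d u v"]) force
  qed auto
  have KL: "K \<subseteq> L" unfolding K_def using closure_of_subset_topspace[of X S] top by simp
  \<comment> \<open>The two closures correspond: \<open>rep\<close> maps \<open>K\<close> into
    \<open>K'\<close>, and \<open>K'\<close> lies in \<open>K\<close>. A finite subcover for
    \<open>K'\<close> then covers \<open>K\<close>, since an open set that contains
    \<open>rep u\<close> also contains \<open>u\<close>.\<close>
  have KK': "rep u \<in> K'" if u: "u \<in> K" for u
    unfolding K'_def M.metric_closure_of
  proof (safe)
    have uL: "u \<in> L" using u KL by auto
    then show "rep u \<in> M" by (rule repM)
    fix r :: real assume r: "0 < r"
    have B: "u \<in> {v \<in> L. d u v < r} \<and> openin X {v \<in> L. d u v < r}"
      using uL r refl ball_open[OF uL] by simp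
    have cl: "\<forall>T. u \<in> T \<and> openin X T \<longrightarrow> (\<exists>y. y \<in> S \<and> y \<in> T)"
      using u by (simp add: K_def in_closure_of)
    obtain y where y: "y \<in> S" "y \<in> L" "d u y < r"
      using cl[rule_format, OF B] by auto
    have "d (rep u) (rep y) = d u y"
        using d_eq[OF uL rep(1)[OF uL] y(2) rep(2)[OF uL]]
          d_eq[OF y(2) rep(1)[OF y(2)] rep(1)[OF uL] rep(2)[OF y(2)]] by (simp add: comm)
    then show "\<exists>y\<in>rep ` S. y \<in> M.mball (rep u) r"
      using y uL by (intro bexI[of _ "rep y"]) (auto simp: M.in_mball repM)
  qed
  have K'K: "x \<in> K" if x: "x \<in> K'" for x
    unfolding K_def in_closure_of
  proof (intro conjI allI impI)
    have xM: "x \<in> M" and cl: "\<And>r. r > 0 \<Longrightarrow> \<exists>y\<in>rep ` S. y \<in> M.mball x r"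
      using x unfolding K'_def M.metric_closure_of by auto
    then show "x \<in> topspace X" using M_sub top by auto
    fix T assume T: "x \<in> T \<and> openin X T"
    then obtain r where r: "0 < r" "\<And>v. v \<in> L \<Longrightarrow> d x v < r \<Longrightarrow> v \<in> T"
      unfolding X by meson
    obtain s where s: "s \<in> S" "d x (rep s) < r" using cl[OF r(1)] by (auto simp: M.in_mball)
    have sL: "s \<in> L" using s S by auto
    have "x \<in> L" using xM M_sub by auto
    from d_eq[OF sL rep(1)[OF sL] this rep(2)[OF sL]] have "d x s = d x (rep s)"
      by (simp only: comm[of x])
    then show "\<exists>y. y \<in> S \<and> y \<in> T" using s r(2)[OF sL] by auto
  qed
  show ?thesis
    unfolding K_def[symmetric] compactin_def
  proof (intro conjI allI impI)
    show "K \<subseteq> topspace X" using KL top by simp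
    fix \<U> assume \<U>: "Ball \<U> (openin X) \<and> K \<subseteq> \<Union>\<U>"
    define V where "V U = U \<inter> M" for U :: "'b set"
    have V: "openin M.mtopology (V U)" if "U \<in> \<U>" for U
      unfolding M.openin_mtopology
    proof (intro conjI allI impI)
      fix x assume "x \<in> V U"
      then have "x \<in> U" by (simp add: V_def)
      moreover have "openin X U" using \<U> that by blast
      ultimately obtain r where r: "0 < r" "\<And>v. v \<in> L \<Longrightarrow> d x v < r \<Longrightarrow> v \<in> U"
        unfolding X by meson
      then show "\<exists>r>0. M.mball x r \<subseteq> V U"
        using M_sub by (intro exI[of _ r]) (auto simp: M.in_mball V_def)
    qed (simp add: V_def)
    have K'V: "K' \<subseteq> \<Union>(V ` \<U>)"
    proof
      fix x assume x: "x \<in> K'"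
      then have "x \<in> M" unfolding K'_def M.metric_closure_of by simp
      moreover obtain U where "U \<in> \<U>" "x \<in> U" using K'K[OF x] \<U> by auto
      ultimately show "x \<in> \<Union>(V ` \<U>)" by (auto simp: V_def)
    qed
    have "\<exists>\<F>. finite \<F> \<and> \<F> \<subseteq> V ` \<U> \<and> K' \<subseteq> \<Union>\<F>"
      using V K'V by (intro compactinD[OF cK']) auto
    then obtain \<F> where \<F>: "finite \<F>" "\<F> \<subseteq> V ` \<U>" "K' \<subseteq> \<Union>\<F>" by blast
    obtain \<G> where \<G>: "finite \<G>" "\<G> \<subseteq> \<U>" "\<F> = V ` \<G>"
      using finite_subset_image[OF \<F>(1,2)] by blast
    have "K \<subseteq> \<Union>\<G>"
    proof
      fix u assume u: "u \<in> K"
      then have uL: "u \<in> L" using KL by auto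
      have "rep u \<in> \<Union>(V ` \<G>)" using KK'[OF u] \<F>(3) unfolding \<G>(3) by (rule rev_subsetD)
      then obtain U where U: "U \<in> \<G>" "rep u \<in> U" unfolding V_def by auto
      then have "openin X U" using \<U> \<G>(2) by blast
      with U(2) obtain r where r: "0 < r" "\<And>v. v \<in> L \<Longrightarrow> d (rep u) v < r \<Longrightarrow> v \<in> U"
        unfolding X by meson
      have "d (rep u) u < r" using r(1) rep(2)[OF uL] comm[of u "rep u"] by linarith
      then have "u \<in> U" using r(2) uL by blast
      then show "u \<in> \<Union>\<G>" using U(1) by auto
    qed
    then show "\<exists>\<F>. finite \<F> \<and> \<F> \<subseteq> \<U> \<and> K \<subseteq> \<Union>\<F>" using \<G> by blast
  qed
qed

section \<open>Convexity inequalities for real powers\<close>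

text \<open>Convexity of the power is invoked on the open half-line. If \<open>a\<close> or
  \<open>b\<close> vanishes, the claim reduces to \<open>c powr q \<le> c\<close> for
  \<open>c\<close> between 0 and 1.\<close>

lemma powr_add_le_convex_comb:
  fixes a b t q :: real
  assumes q: "1 \<le> q" and ab: "0 \<le> a" "0 \<le> b" and t: "0 \<le> t" "t \<le> 1"
  shows "(t * a + (1 - t) * b) powr q \<le> t * a powr q + (1 - t) * b powr q"
proof -
  have sc: "(c * x) powr q \<le> c * x powr q" if "0 \<le> c" "c \<le> 1" "0 \<le> x" for c x :: real
  proof -
    have "c powr q \<le> c powr 1" using that q by (intro powr_mono') auto
    then have "c powr q * x powr q \<le> c * x powr q" using that by (intro mult_right_mono) auto
    then show ?thesis using that by (simp add: powr_mult)
  qed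
  show ?thesis
  proof (cases "a = 0 \<or> b = 0")
    case True
    then show ?thesis using sc[of t a] sc[of "1 - t" b] t ab by auto
  next
    case False
    then have "convex_on {0<..} (\<lambda>x. x powr q)" "a \<in> {0<..}" "b \<in> {0<..}"
      using powr_convex[OF q] ab by auto
    then show ?thesis using convex_onD[of "{0<..}" "\<lambda>x. x powr q" "1 - t" a b] t by simp
  qed
qed

lemma powr_add_le:
  fixes a b q :: real
  assumes "1 \<le> q" "0 \<le> a" "0 \<le> b"
  shows "(a + b) powr q \<le> 2 powr q * (a powr q + b powr q)"
proof -
  have "(a + b) powr q = 2 powr q * ((1 / 2) * a + (1 - 1 / 2) * b) powr q"
    using assms by (simp add: powr_mult[symmetric])
  also have "\<dots> \<le> 2 powr q * ((1 / 2) * a powr q + (1 - 1 / 2) * b powr q)"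
    using assms by (intro mult_left_mono powr_add_le_convex_comb) auto
  also have "\<dots> \<le> 2 powr q * (a powr q + b powr q)"
    by (intro mult_left_mono add_mono) auto
  finally show ?thesis .
qed

text \<open>The tangent at \<open>c\<close> stays below the convex graph. It comes from Young's
  inequality for \<open>x\<close> and \<open>c powr (q - 1)\<close> with the conjugate exponents
  \<open>q\<close> and \<open>q / (q - 1)\<close>; integrating it gives the Jensen inequality
  below.\<close>

lemma powr_tangent_le:
  fixes x c q :: real
  assumes q: "1 \<le> q" and x: "0 \<le> x" and c: "0 < c"
  shows "c powr q + q * c powr (q - 1) * (x - c) \<le> x powr q"
proof (cases "q = 1")
  case True
  then show ?thesis using x c by simp
next
  case False
  then have q1: "1 < q" using q by simp
  have "x * c powr (q - 1) \<le> x powr q / q + (c powr (q - 1)) powr (q / (q - 1)) / (q / (q - 1))"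
    using q1 x c by (intro Youngs_inequality) (auto simp: field_simps)
  also have "(c powr (q - 1)) powr (q / (q - 1)) = c powr q" using q1 by (simp add: powr_powr)
  finally have "q * (x * c powr (q - 1)) \<le> q * (x powr q / q + c powr q / (q / (q - 1)))"
    using q1 by (intro mult_left_mono) auto
  also have "\<dots> = x powr q + (q - 1) * c powr q" using q1 by (simp add: field_simps)
  finally have "q * (x * c powr (q - 1)) \<le> x powr q + (q - 1) * c powr q" .
  moreover have "c powr q = c powr (q - 1) * c" using c by (simp add: powr_diff)
  ultimately show ?thesis by (simp add: algebra_simps)
qed

text \<open>If \<open>k\<close> is not integrable, the left-hand side is 0, the junk value of the Bochner integral.\<close>

lemma powr_lebesgue_integral_le:
  fixes k :: "'b \<Rightarrow> real"
  assumes \<nu>: "finite_measure \<nu>" "emeasure \<nu> (space \<nu>) \<le> ennreal m" and m: "0 < m" and q: "1 \<le> q"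
    and k: "k \<in> borel_measurable \<nu>" "\<And>y. 0 \<le> k y"
  shows "ennreal ((\<integral>y. k y \<partial>\<nu>) powr q) \<le> ennreal (m powr (q - 1)) * (\<integral>\<^sup>+y. ennreal (k y powr q) \<partial>\<nu>)"
proof (cases "(\<integral>y. k y \<partial>\<nu>) = 0 \<or> (\<integral>\<^sup>+y. ennreal (k y powr q) \<partial>\<nu>) = \<infinity>")
  case True
  then show ?thesis using m by (auto simp: ennreal_mult_top)
next
  case False
  interpret finite_measure \<nu> by fact
  note [measurable] = k(1)
  define A where "A = (\<integral>y. k y \<partial>\<nu>)"
  define I where "I = (\<integral>y. k y powr q \<partial>\<nu>)"
  have A: "0 < A" using False k(2) unfolding A_def by (simp add: less_le)
  then have ik: "integrable \<nu> k" unfolding A_def using not_integrable_integral_eq by fastforce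
  have iq: "integrable \<nu> (\<lambda>y. k y powr q)"
    using False by (intro integrableI_nonneg) (auto simp: less_top)
  \<comment> \<open>The tangent is taken at the mean that \<open>k\<close> would have if the total
    mass were exactly \<open>m\<close>. The true mass \<open>v\<close> may be smaller; the deficit
    enters as \<open>q * c powr q * (m - v)\<close>, which is at least
    \<open>c powr q * (m - v)\<close> because \<open>1 \<le> q\<close>.\<close>
  define c where "c = A / m"
  have c: "0 < c" using A m by (simp add: c_def)
  define v where "v = measure \<nu> (space \<nu>)"
  have v: "v \<le> m" using \<nu>(2) m unfolding v_def by (simp add: emeasure_eq_measure)
  have "(\<integral>y. c powr q + q * c powr (q - 1) * (k y - c) \<partial>\<nu>) \<le> I"
    unfolding I_def using ik iq powr_tangent_le[OF q k(2) c] by (intro integral_mono) auto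
  also have "(\<integral>y. c powr q + q * c powr (q - 1) * (k y - c) \<partial>\<nu>)
      = c powr q * v + q * c powr (q - 1) * (A - c * v)"
    using ik by (simp add: A_def v_def mult.commute)
  finally have 1: "c powr q * v + q * c powr (q - 1) * (A - c * v) \<le> I" .
  have cq: "c powr (q - 1) * c = c powr q" using c by (simp add: powr_diff)
  have Am: "A = c * m" using m by (simp add: c_def)
  have "q * c powr (q - 1) * (A - c * v) = q * (c powr (q - 1) * c) * (m - v)"
    by (simp add: Am algebra_simps)
  with 1 have "c powr q * v + q * c powr q * (m - v) \<le> I" by (simp only: cq)
  moreover have "c powr q * (m - v) \<le> q * (c powr q * (m - v))"
    using v q mult_right_mono[of 1 q "c powr q * (m - v)"] by simp
  ultimately have "c powr q * m \<le> I" by (simp add: algebra_simps)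
  then have "m powr (q - 1) * (c powr q * m) \<le> m powr (q - 1) * I" by (intro mult_left_mono) auto
  also have "m powr (q - 1) * (c powr q * m) = A powr q"
    using A m unfolding c_def by (simp add: powr_divide powr_diff)
  finally have "ennreal (A powr q) \<le> ennreal (m powr (q - 1) * I)" by (rule ennreal_leI)
  also have "\<dots> = ennreal (m powr (q - 1)) * (\<integral>\<^sup>+y. ennreal (k y powr q) \<partial>\<nu>)"
    unfolding I_def using iq by (simp add: ennreal_mult' nn_integral_eq_integral)
  finally show ?thesis by (simp add: A_def)
qed

section \<open>L^p seminorms: triangle inequality and completeness\<close>

definition Lp_fun :: "'b measure \<Rightarrow> real \<Rightarrow> ('b \<Rightarrow> real) set" where
  "Lp_fun W q = {u \<in> borel_measurable W. integrable W (\<lambda>x. \<bar>u x\<bar> powr q)}"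

definition Lp_seminorm :: "'b measure \<Rightarrow> real \<Rightarrow> ('b \<Rightarrow> real) \<Rightarrow> real" where
  "Lp_seminorm W q u = (\<integral>x. \<bar>u x\<bar> powr q \<partial>W) powr (1 / q)"

lemma Lp_fun_iff_nn:
  "u \<in> Lp_fun W q \<longleftrightarrow> u \<in> borel_measurable W \<and> (\<integral>\<^sup>+x. ennreal (\<bar>u x\<bar> powr q) \<partial>W) < \<infinity>"
  unfolding Lp_fun_def by (auto simp: integrable_iff_bounded)

lemma Lp_seminorm_nonneg: "0 \<le> Lp_seminorm W q u"
  unfolding Lp_seminorm_def by simp

lemma nn_integral_Lp:
  assumes q: "1 \<le> q" and u: "u \<in> Lp_fun W q"
  shows "(\<integral>\<^sup>+x. ennreal (\<bar>u x\<bar> powr q) \<partial>W) = ennreal (Lp_seminorm W q u powr q)"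
proof -
  have "(\<integral>\<^sup>+x. ennreal (\<bar>u x\<bar> powr q) \<partial>W) = ennreal (\<integral>x. \<bar>u x\<bar> powr q \<partial>W)"
    using u unfolding Lp_fun_def by (intro nn_integral_eq_integral) auto
  also have "(\<integral>x. \<bar>u x\<bar> powr q \<partial>W) = Lp_seminorm W q u powr q"
    using q unfolding Lp_seminorm_def by (simp add: powr_powr)
  finally show ?thesis .
qed

lemma Lp_seminorm_le_iff:
  assumes q: "1 \<le> q" and u: "u \<in> Lp_fun W q" and B: "0 \<le> B"
  shows "Lp_seminorm W q u \<le> B \<longleftrightarrow> (\<integral>\<^sup>+x. ennreal (\<bar>u x\<bar> powr q) \<partial>W) \<le> ennreal (B powr q)"
proof -
  have "Lp_seminorm W q u powr q \<le> B powr q \<longleftrightarrow> Lp_seminorm W q u \<le> B"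
    using q B Lp_seminorm_nonneg[of W q u]
    by (metis less_le_trans not_le powr_less_mono2 powr_mono2 zero_less_one less_imp_le)
  then show ?thesis using nn_integral_Lp[OF q u] by simp
qed

lemma Lp_fun_uminus: "u \<in> Lp_fun W q \<Longrightarrow> (\<lambda>x. - u x) \<in> Lp_fun W q"
  unfolding Lp_fun_def by simp

lemma Lp_fun_cmult: "u \<in> Lp_fun W q \<Longrightarrow> (\<lambda>x. c * u x) \<in> Lp_fun W q"
  unfolding Lp_fun_def by (auto simp: abs_mult powr_mult)

lemma Lp_seminorm_cmult:
  assumes q: "1 \<le> q"
  shows "Lp_seminorm W q (\<lambda>x. c * u x) = \<bar>c\<bar> * Lp_seminorm W q u"
  using q unfolding Lp_seminorm_def by (simp add: abs_mult powr_mult powr_powr)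

lemma Lp_fun_add:
  assumes q: "1 \<le> q" and u: "u \<in> Lp_fun W q" and v: "v \<in> Lp_fun W q"
  shows "(\<lambda>x. u x + v x) \<in> Lp_fun W q"
proof -
  have [measurable]: "u \<in> borel_measurable W" "v \<in> borel_measurable W"
    and iu: "integrable W (\<lambda>x. \<bar>u x\<bar> powr q)" and iv: "integrable W (\<lambda>x. \<bar>v x\<bar> powr q)"
    using u v unfolding Lp_fun_def by auto
  have "integrable W (\<lambda>x. \<bar>u x + v x\<bar> powr q)"
  proof (rule Bochner_Integration.integrable_bound)
    show "integrable W (\<lambda>x. 2 powr q * (\<bar>u x\<bar> powr q + \<bar>v x\<bar> powr q))" using iu iv by simp
    show "AE x in W. norm (\<bar>u x + v x\<bar> powr q) \<le> norm (2 powr q * (\<bar>u x\<bar> powr q + \<bar>v x\<bar> powr q))"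
    proof (rule AE_I2)
      fix x
      have "\<bar>u x + v x\<bar> powr q \<le> (\<bar>u x\<bar> + \<bar>v x\<bar>) powr q" using q by (intro powr_mono2) auto
      also have "\<dots> \<le> 2 powr q * (\<bar>u x\<bar> powr q + \<bar>v x\<bar> powr q)" using q by (intro powr_add_le) auto
      finally show "norm (\<bar>u x + v x\<bar> powr q) \<le> norm (2 powr q * (\<bar>u x\<bar> powr q + \<bar>v x\<bar> powr q))" by simp
    qed
  qed measurable
  then show ?thesis unfolding Lp_fun_def by simp
qed

lemma Lp_fun_diff:
  assumes "1 \<le> q" "u \<in> Lp_fun W q" "v \<in> Lp_fun W q"
  shows "(\<lambda>x. u x - v x) \<in> Lp_fun W q"
  using Lp_fun_add[OF assms(1,2) Lp_fun_uminus[OF assms(3)]] by simp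

lemma Lp_fun_zero: "(\<lambda>x. 0) \<in> Lp_fun W q"
  unfolding Lp_fun_def by simp

lemma Lp_fun_sum:
  assumes "1 \<le> q" "\<And>i. i \<in> I \<Longrightarrow> u i \<in> Lp_fun W q"
  shows "(\<lambda>x. \<Sum>i\<in>I. u i x) \<in> Lp_fun W q"
  using assms(2)
proof (induction I rule: infinite_finite_induct)
  case (insert i I)
  then show ?case using Lp_fun_add[OF assms(1), of "u i" W "\<lambda>x. \<Sum>i\<in>I. u i x"] by simp
qed (auto simp: Lp_fun_zero)

text \<open>Minkowski's inequality by convexity: with \<open>a\<close> and \<open>b\<close> just
  above the two seminorms, \<open>(\<bar>u\<bar> + \<bar>v\<bar>) / (a + b)\<close> is the convex
  combination of \<open>\<bar>u\<bar> / a\<close> and \<open>\<bar>v\<bar> / b\<close> with weights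
  \<open>a / (a + b)\<close> and \<open>b / (a + b)\<close>. The slack \<open>e / 2\<close> rules
  out division by 0.\<close>

lemma Lp_seminorm_triangle:
  assumes q: "1 \<le> q" and u: "u \<in> Lp_fun W q" and v: "v \<in> Lp_fun W q"
  shows "Lp_seminorm W q (\<lambda>x. u x + v x) \<le> Lp_seminorm W q u + Lp_seminorm W q v"
proof (rule field_le_epsilon)
  fix e :: real assume e: "0 < e"
  define a where "a = Lp_seminorm W q u + e / 2"
  define b where "b = Lp_seminorm W q v + e / 2"
  have a: "0 < a" and b: "0 < b" and ua: "Lp_seminorm W q u \<le> a" and vb: "Lp_seminorm W q v \<le> b"
    using e Lp_seminorm_nonneg[of W q u] Lp_seminorm_nonneg[of W q v] by (auto simp: a_def b_def)
  define t where "t = a / (a + b)"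
  have t: "0 \<le> t" "t \<le> 1" "t * (a + b) = a" "(1 - t) * (a + b) = b" 
    using a b by (auto simp: t_def field_simps)
  have [measurable]: "u \<in> borel_measurable W" "v \<in> borel_measurable W"
    and iu: "integrable W (\<lambda>x. \<bar>u x\<bar> powr q)" and iv: "integrable W (\<lambda>x. \<bar>v x\<bar> powr q)"
    using u v unfolding Lp_fun_def by auto
  have int_le: "(\<integral>x. \<bar>w x\<bar> powr q \<partial>W) \<le> c powr q" if "w \<in> Lp_fun W q" "Lp_seminorm W q w \<le> c" "0 < c" for w c
  proof -
    have "(\<integral>x. \<bar>w x\<bar> powr q \<partial>W) = Lp_seminorm W q w powr q"
      using q unfolding Lp_seminorm_def by (simp add: powr_powr)
    also have "\<dots> \<le> c powr q" using that q Lp_seminorm_nonneg by (intro powr_mono2) auto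
    finally show ?thesis .
  qed
  define ca where "ca = (a + b) powr q * t / a powr q"
  define cb where "cb = (a + b) powr q * (1 - t) / b powr q"
  have pt: "\<bar>u x + v x\<bar> powr q \<le> ca * \<bar>u x\<bar> powr q + cb * \<bar>v x\<bar> powr q" for x
  proof -
    have "\<bar>u x + v x\<bar> \<le> \<bar>u x\<bar> + \<bar>v x\<bar>" by simp
    also have "\<dots> = (a + b) * (t * (\<bar>u x\<bar> / a) + (1 - t) * (\<bar>v x\<bar> / b))"
    proof -
      have "(a + b) * (t * (\<bar>u x\<bar> / a) + (1 - t) * (\<bar>v x\<bar> / b))
          = (t * (a + b)) * (\<bar>u x\<bar> / a) + ((1 - t) * (a + b)) * (\<bar>v x\<bar> / b)"
        by (simp add: algebra_simps del: times_divide_eq_right times_divide_eq_left)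
      then show ?thesis using t(3,4) a b by simp
    qed
    finally have "\<bar>u x + v x\<bar> powr q \<le> ((a + b) * (t * (\<bar>u x\<bar> / a) + (1 - t) * (\<bar>v x\<bar> / b))) powr q"
      using q by (intro powr_mono2) auto
    also have "\<dots> = (a + b) powr q * (t * (\<bar>u x\<bar> / a) + (1 - t) * (\<bar>v x\<bar> / b)) powr q"
      using a b t by (intro powr_mult)
    also have "\<dots> \<le> (a + b) powr q * (t * (\<bar>u x\<bar> / a) powr q + (1 - t) * (\<bar>v x\<bar> / b) powr q)"
      using a b t q by (intro mult_left_mono powr_add_le_convex_comb) auto
    also have "\<dots> = ca * \<bar>u x\<bar> powr q + cb * \<bar>v x\<bar> powr q"
      using a b by (simp add: ca_def cb_def powr_divide algebra_simps)
    finally show ?thesis .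
  qed
  have "(\<integral>x. \<bar>u x + v x\<bar> powr q \<partial>W) \<le> (\<integral>x. ca * \<bar>u x\<bar> powr q + cb * \<bar>v x\<bar> powr q \<partial>W)"
    using pt iu iv Lp_fun_add[OF q u v] by (intro integral_mono) (auto simp: Lp_fun_def)
  also have "\<dots> = ca * (\<integral>x. \<bar>u x\<bar> powr q \<partial>W) + cb * (\<integral>x. \<bar>v x\<bar> powr q \<partial>W)"
    using iu iv by simp
  also have "\<dots> \<le> ca * a powr q + cb * b powr q"
    using int_le[OF u ua a] int_le[OF v vb b] t by (intro add_mono mult_left_mono) (auto simp: ca_def cb_def)
  also have "\<dots> = (a + b) powr q" using a b by (simp add: ca_def cb_def) (simp add: algebra_simps)
  finally have "Lp_seminorm W q (\<lambda>x. u x + v x) \<le> ((a + b) powr q) powr (1 / q)"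
    unfolding Lp_seminorm_def using q by (intro powr_mono2) auto
  also have "\<dots> = a + b" using a b q by (simp add: powr_powr)
  finally show "Lp_seminorm W q (\<lambda>x. u x + v x) \<le> Lp_seminorm W q u + Lp_seminorm W q v + e"
    by (simp add: a_def b_def)
qed

lemma Lp_seminorm_minus_commute:
  "Lp_seminorm W q (\<lambda>x. u x - v x) = Lp_seminorm W q (\<lambda>x. v x - u x)"
  unfolding Lp_seminorm_def by (simp add: abs_minus_commute)

lemma Lp_seminorm_diff_triangle:
  assumes "1 \<le> q" "u \<in> Lp_fun W q" "v \<in> Lp_fun W q" "w \<in> Lp_fun W q"
  shows "Lp_seminorm W q (\<lambda>x. u x - w x) \<le> Lp_seminorm W q (\<lambda>x. u x - v x) + Lp_seminorm W q (\<lambda>x. v x - w x)"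
  using Lp_seminorm_triangle[OF assms(1) Lp_fun_diff[OF assms(1,2,3)] Lp_fun_diff[OF assms(1,3,4)]]
  by (simp add: algebra_simps)

lemma Lp_seminorm_sum_le:
  assumes "1 \<le> q" "\<And>i. i \<in> I \<Longrightarrow> u i \<in> Lp_fun W q"
  shows "Lp_seminorm W q (\<lambda>x. \<Sum>i\<in>I. u i x) \<le> (\<Sum>i\<in>I. Lp_seminorm W q (u i))"
  using assms(2)
proof (induction I rule: infinite_finite_induct)
  case (insert i I)
  have "Lp_seminorm W q (\<lambda>x. u i x + (\<Sum>i\<in>I. u i x)) \<le> Lp_seminorm W q (u i) + Lp_seminorm W q (\<lambda>x. \<Sum>i\<in>I. u i x)"
    using insert.prems by (intro Lp_seminorm_triangle Lp_fun_sum assms(1)) auto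
  also have "\<dots> \<le> Lp_seminorm W q (u i) + (\<Sum>i\<in>I. Lp_seminorm W q (u i))"
    using insert by auto
  finally show ?case using insert by simp
qed (auto simp: Lp_seminorm_def)

text \<open>Riesz-Fischer. Along a subsequence the increments \<open>d k\<close> have seminorm at
  most \<open>(1 / 4) ^ k\<close>. The factor \<open>2 ^ k\<close> leaves the powers of
  \<open>2 ^ k * d k\<close> summable in the mean, so almost everywhere
  \<open>\<bar>d k x\<bar>\<close> is at most a constant times \<open>(1 / 2) ^ k\<close> and the
  subsequence converges. Fatou's lemma turns the Cauchy condition into convergence in
  seminorm.\<close>

theorem Lp_complete:
  fixes \<sigma> :: "nat \<Rightarrow> 'b \<Rightarrow> real"
  assumes q: "1 \<le> q" and \<sigma>: "\<And>n. \<sigma> n \<in> Lp_fun W q"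
    and Cauchy: "\<And>e. 0 < e \<Longrightarrow> \<exists>N. \<forall>m\<ge>N. \<forall>n\<ge>N. Lp_seminorm W q (\<lambda>x. \<sigma> m x - \<sigma> n x) < e"
  shows "\<exists>l\<in>Lp_fun W q. (\<lambda>n. Lp_seminorm W q (\<lambda>x. \<sigma> n x - l x)) \<longlonglongrightarrow> 0"
proof -
  have [measurable]: "\<sigma> n \<in> borel_measurable W" for n using \<sigma>[of n] unfolding Lp_fun_def by simp
  have "\<exists>N. \<forall>m\<ge>N. \<forall>n\<ge>N. Lp_seminorm W q (\<lambda>x. \<sigma> m x - \<sigma> n x) < (1 / 4) ^ k" for k :: nat
    by (rule Cauchy) simp
  then obtain N where N: "\<And>k m n. m \<ge> N k \<Longrightarrow> n \<ge> N k \<Longrightarrow>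
      Lp_seminorm W q (\<lambda>x. \<sigma> m x - \<sigma> n x) < (1 / 4) ^ k"
    by metis
  \<comment> \<open>The partial sums make \<open>r\<close> increasing, so both \<open>r k\<close>
    and \<open>r (Suc k)\<close> are past \<open>N k\<close>; the summand \<open>k\<close> makes the
    indices tend to infinity.\<close>
  define r where "r k = k + (\<Sum>i\<le>k. N i)" for k
  have rN: "N k \<le> r k" for k
    unfolding r_def by (rule trans_le_add2) (rule member_le_sum, auto)
  have rN': "N k \<le> r (Suc k)" for k
    using rN[of k] unfolding r_def by simp
  have rk: "k \<le> r k" for k unfolding r_def by simp
  define d where "d k x = \<sigma> (r (Suc k)) x - \<sigma> (r k) x" for k x
  have [measurable]: "d k \<in> borel_measurable W" for k unfolding d_def[abs_def] by measurable
  have d: "d k \<in> Lp_fun W q" for k unfolding d_def by (intro Lp_fun_diff q \<sigma>)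
  have dn: "Lp_seminorm W q (d k) \<le> (1 / 4) ^ k" for k
    unfolding d_def using N[OF rN' rN] by (rule less_imp_le)
  have dint: "(\<integral>\<^sup>+x. ennreal (\<bar>2 ^ k * d k x\<bar> powr q) \<partial>W) \<le> ennreal ((1 / 2) ^ k)" for k
  proof -
    have "Lp_seminorm W q (\<lambda>x. 2 ^ k * d k x) = 2 ^ k * Lp_seminorm W q (d k)"
      using q by (simp add: Lp_seminorm_cmult)
    also have "\<dots> \<le> 2 ^ k * (1 / 4) ^ k" using dn by (intro mult_left_mono) auto
    also have "\<dots> = (1 / 2) ^ k" by (simp add: power_mult_distrib[symmetric])
    finally have "(\<integral>\<^sup>+x. ennreal (\<bar>2 ^ k * d k x\<bar> powr q) \<partial>W) \<le> ennreal (((1 / 2) ^ k) powr q)"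
      by (rule iffD1[OF Lp_seminorm_le_iff[OF q Lp_fun_cmult[OF d]], rotated]) simp
    also have "((1 / 2) ^ k) powr q \<le> ((1 / 2 :: real) ^ k) powr 1"
      using q by (intro powr_mono') (auto simp: power_le_one)
    finally show ?thesis by (simp add: ennreal_leI order_trans)
  qed
  have "(\<integral>\<^sup>+x. (\<Sum>k. ennreal (\<bar>2 ^ k * d k x\<bar> powr q)) \<partial>W)
      = (\<Sum>k. \<integral>\<^sup>+x. ennreal (\<bar>2 ^ k * d k x\<bar> powr q) \<partial>W)"
    by (intro nn_integral_suminf) measurable
  also have "\<dots> \<le> (\<Sum>k. ennreal ((1 / 2) ^ k))"
    using dint by (intro suminf_le summableI) auto
  also have "\<dots> = ennreal (\<Sum>k. (1 / 2) ^ k)"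
    by (intro suminf_ennreal2 summable_geometric) auto
  also have "\<dots> < \<infinity>" by simp
  finally have "AE x in W. (\<Sum>k. ennreal (\<bar>2 ^ k * d k x\<bar> powr q)) \<noteq> \<infinity>"
    by (intro nn_integral_PInf_AE) auto
  then have conv: "AE x in W. (\<lambda>k. \<sigma> (r k) x) \<longlonglongrightarrow> lim (\<lambda>k. \<sigma> (r k) x)"
  proof eventually_elim
    case (elim x)
    define S where "S = enn2real (\<Sum>k. ennreal (\<bar>2 ^ k * d k x\<bar> powr q))"
    have S_eq: "(\<Sum>k. ennreal (\<bar>2 ^ k * d k x\<bar> powr q)) = ennreal S"
      unfolding S_def using elim by (intro ennreal_enn2real[symmetric]) (simp add: less_top)
    have S: "\<bar>2 ^ k * d k x\<bar> powr q \<le> S" for k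
    proof -
      have "ennreal (\<bar>2 ^ k * d k x\<bar> powr q) = (\<Sum>i\<in>{k}. ennreal (\<bar>2 ^ i * d i x\<bar> powr q))" by simp
      also have "\<dots> \<le> (\<Sum>k. ennreal (\<bar>2 ^ k * d k x\<bar> powr q))" by (rule sum_le_suminf) auto
      finally have "ennreal (\<bar>2 ^ k * d k x\<bar> powr q) \<le> ennreal S" unfolding S_eq .
      moreover have "0 \<le> S" unfolding S_def by (rule enn2real_nonneg)
      ultimately show ?thesis by (simp only: ennreal_le_iff)
    qed
    have bnd: "\<bar>d k x\<bar> \<le> S powr (1 / q) * (1 / 2) ^ k" for k
    proof -
      have "(\<bar>2 ^ k * d k x\<bar> powr q) powr (1 / q) \<le> S powr (1 / q)"
        using S q by (intro powr_mono2) auto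
      then have "2 ^ k * \<bar>d k x\<bar> \<le> S powr (1 / q)" using q by (simp add: powr_powr abs_mult)
      then show ?thesis by (simp add: field_simps)
    qed
    have "summable (\<lambda>k. S powr (1 / q) * (1 / 2) ^ k)"
      by (intro summable_mult summable_geometric) auto
    then have "summable (\<lambda>k. d k x)"
      by (rule summable_comparison_test') (simp add: bnd)
    then have "convergent (\<lambda>k. \<sigma> (r 0) x + (\<Sum>i<k. d i x))"
      by (intro convergent_add convergent_const) (simp add: summable_iff_convergent)
    moreover have "\<sigma> (r 0) x + (\<Sum>i<k. d i x) = \<sigma> (r k) x" for k
      unfolding d_def by (subst sum_lessThan_telescope) simp
    ultimately show ?case by (simp add: convergent_LIMSEQ_iff)
  qed
  define l where "l x = lim (\<lambda>k. \<sigma> (r k) x)" for x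
  have [measurable]: "l \<in> borel_measurable W" unfolding l_def[abs_def] by measurable
  have key: "\<exists>N. \<forall>n\<ge>N. (\<integral>\<^sup>+x. ennreal (\<bar>\<sigma> n x - l x\<bar> powr q) \<partial>W) \<le> ennreal (e powr q)" if e: "0 < e" for e
  proof -
    obtain N where N: "\<And>m n. m \<ge> N \<Longrightarrow> n \<ge> N \<Longrightarrow> Lp_seminorm W q (\<lambda>x. \<sigma> m x - \<sigma> n x) < e"
      using Cauchy[OF e] by meson
    have "(\<integral>\<^sup>+x. ennreal (\<bar>\<sigma> n x - l x\<bar> powr q) \<partial>W) \<le> ennreal (e powr q)" if n: "n \<ge> N" for n
    proof -
      have "(\<integral>\<^sup>+x. ennreal (\<bar>\<sigma> n x - l x\<bar> powr q) \<partial>W)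
          = (\<integral>\<^sup>+x. liminf (\<lambda>k. ennreal (\<bar>\<sigma> n x - \<sigma> (r k) x\<bar> powr q)) \<partial>W)"
      proof (rule nn_integral_cong_AE)
        show "AE x in W. ennreal (\<bar>\<sigma> n x - l x\<bar> powr q) = liminf (\<lambda>k. ennreal (\<bar>\<sigma> n x - \<sigma> (r k) x\<bar> powr q))"
          using conv
        proof eventually_elim
          case (elim x)
          then have "(\<lambda>k. \<bar>\<sigma> n x - \<sigma> (r k) x\<bar> powr q) \<longlonglongrightarrow> \<bar>\<sigma> n x - l x\<bar> powr q"
            unfolding l_def using q by (intro tendsto_powr' tendsto_intros) auto
          then have "(\<lambda>k. ennreal (\<bar>\<sigma> n x - \<sigma> (r k) x\<bar> powr q)) \<longlonglongrightarrow> ennreal (\<bar>\<sigma> n x - l x\<bar> powr q)"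
            by (rule tendsto_ennrealI)
          from lim_imp_Liminf[OF _ this] show ?case by simp
        qed
      qed
      also have "\<dots> \<le> liminf (\<lambda>k. \<integral>\<^sup>+x. ennreal (\<bar>\<sigma> n x - \<sigma> (r k) x\<bar> powr q) \<partial>W)"
        by (intro nn_integral_liminf) measurable
      also have "\<dots> \<le> ennreal (e powr q)"
      proof (rule Liminf_le)
        have "(\<integral>\<^sup>+x. ennreal (\<bar>\<sigma> n x - \<sigma> (r k) x\<bar> powr q) \<partial>W) \<le> ennreal (e powr q)" if "k \<ge> N" for k
        proof (rule iffD1[OF Lp_seminorm_le_iff[OF q Lp_fun_diff[OF q \<sigma> \<sigma>]]])
          show "Lp_seminorm W q (\<lambda>x. \<sigma> n x - \<sigma> (r k) x) \<le> e"
            using N[OF n, of "r k"] that rk[of k] by linarith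
        qed (use e in simp)
        then show "\<forall>\<^sub>F k in sequentially. (\<integral>\<^sup>+x. ennreal (\<bar>\<sigma> n x - \<sigma> (r k) x\<bar> powr q) \<partial>W) \<le> ennreal (e powr q)"
          unfolding eventually_sequentially by blast
      qed simp
      finally show ?thesis .
    qed
    then show ?thesis by blast
  qed
  have diff: "\<exists>N. \<forall>n\<ge>N. (\<lambda>x. \<sigma> n x - l x) \<in> Lp_fun W q \<and> Lp_seminorm W q (\<lambda>x. \<sigma> n x - l x) \<le> e"
    if e: "0 < e" for e
  proof -
    obtain N where N: "\<And>n. n \<ge> N \<Longrightarrow> (\<integral>\<^sup>+x. ennreal (\<bar>\<sigma> n x - l x\<bar> powr q) \<partial>W) \<le> ennreal (e powr q)"
      using key[OF e] by meson
    have "(\<lambda>x. \<sigma> n x - l x) \<in> Lp_fun W q \<and> Lp_seminorm W q (\<lambda>x. \<sigma> n x - l x) \<le> e" if "n \<ge> N" for n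
    proof
      show *: "(\<lambda>x. \<sigma> n x - l x) \<in> Lp_fun W q"
        unfolding Lp_fun_iff_nn
      proof
        show "(\<integral>\<^sup>+x. ennreal (\<bar>\<sigma> n x - l x\<bar> powr q) \<partial>W) < \<infinity>"
          using N[OF that] by (rule order_le_less_trans) simp
      qed measurable
      show "Lp_seminorm W q (\<lambda>x. \<sigma> n x - l x) \<le> e"
        using N[OF that] e by (intro iffD2[OF Lp_seminorm_le_iff[OF q *]]) simp_all
    qed
    then show ?thesis by blast
  qed
  obtain n where "(\<lambda>x. \<sigma> n x - l x) \<in> Lp_fun W q" using diff[of 1] by auto
  from Lp_fun_diff[OF q \<sigma>[of n] this] have l: "l \<in> Lp_fun W q" by simp
  have "(\<lambda>n. Lp_seminorm W q (\<lambda>x. \<sigma> n x - l x)) \<longlonglongrightarrow> 0"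
  proof (rule LIMSEQ_I)
    fix e :: real assume e: "0 < e"
    obtain N where N: "\<And>n. n \<ge> N \<Longrightarrow> Lp_seminorm W q (\<lambda>x. \<sigma> n x - l x) \<le> e / 2"
      using diff[of "e / 2"] e by auto
    have "norm (Lp_seminorm W q (\<lambda>x. \<sigma> n x - l x) - 0) < e" if "n \<ge> N" for n
      using N[OF that] e Lp_seminorm_nonneg[of W q "\<lambda>x. \<sigma> n x - l x"] by simp
    then show "\<exists>N. \<forall>n\<ge>N. norm (Lp_seminorm W q (\<lambda>x. \<sigma> n x - l x) - 0) < e" by blast
  qed
  with l show ?thesis by blast
qed

text \<open>Vitali's theorem in the form used here: up to an error of small integral, uniformly in
  \<open>n\<close>, the sequence has an integrable majorant \<open>H\<close>, which may depend on
  the error. Dominated convergence handles \<open>min (F n) H\<close>, and the excess is at most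
  \<open>R n\<close>.\<close>

lemma nn_integral_tendsto_0_of_almost_dominated:
  fixes F :: "nat \<Rightarrow> 'b \<Rightarrow> ennreal"
  assumes [measurable]: "\<And>n. F n \<in> borel_measurable M"
    and lim: "AE x in M. (\<lambda>n. F n x) \<longlonglongrightarrow> 0"
    and dom: "\<And>e :: real. 0 < e \<Longrightarrow> \<exists>H R. H \<in> borel_measurable M \<and> (\<integral>\<^sup>+x. H x \<partial>M) < \<infinity> \<and>
      (\<forall>n. R n \<in> borel_measurable M \<and> (\<integral>\<^sup>+x. R n x \<partial>M) \<le> ennreal e \<and> (\<forall>x. F n x \<le> H x + R n x))"
  shows "(\<lambda>n. \<integral>\<^sup>+x. F n x \<partial>M) \<longlonglongrightarrow> 0"
proof -
  have "\<forall>\<^sub>F n in sequentially. (\<integral>\<^sup>+x. F n x \<partial>M) < e" if e: "0 < e" for e :: ennreal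
  proof -
    obtain e' :: real where e': "0 < e'" "ennreal (2 * e') < e"
    proof -
      show thesis
      proof (cases e rule: ennreal_cases)
        case (real r)
        then have "0 < r" using e by simp
        then have "0 < r / 3" "ennreal (2 * (r / 3)) < e" by (simp_all add: real ennreal_lessI)
        then show thesis by (rule that)
      next
        case top
        then show thesis by (intro that[of 1]) simp_all
      qed
    qed
    obtain H R where HR: "H \<in> borel_measurable M \<and> (\<integral>\<^sup>+x. H x \<partial>M) < \<infinity> \<and>
      (\<forall>n. R n \<in> borel_measurable M \<and> (\<integral>\<^sup>+x. R n x \<partial>M) \<le> ennreal e' \<and> (\<forall>x. F n x \<le> H x + R n x))"
      using dom[OF e'(1)] by (elim exE)
    then have [measurable]: "H \<in> borel_measurable M" "R n \<in> borel_measurable M" for n by simp_all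
    from HR have H: "(\<integral>\<^sup>+x. H x \<partial>M) < \<infinity>" and R: "(\<integral>\<^sup>+x. R n x \<partial>M) \<le> ennreal e'"
      and FH: "F n x \<le> H x + R n x" for n x by simp_all
    have "(\<lambda>n. \<integral>\<^sup>+x. min (F n x) (H x) \<partial>M) \<longlonglongrightarrow> (\<integral>\<^sup>+x. 0 \<partial>M)"
    proof (rule nn_integral_dominated_convergence[where w = H])
      show "AE x in M. (\<lambda>n. min (F n x) (H x)) \<longlonglongrightarrow> 0"
        using lim
      proof eventually_elim
        case (elim x)
        show ?case by (rule tendsto_sandwich[OF _ _ tendsto_const elim]) auto
      qed
    qed (use H in auto)
    then have "\<forall>\<^sub>F n in sequentially. (\<integral>\<^sup>+x. min (F n x) (H x) \<partial>M) < ennreal e'"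
      using e'(1) by (intro order_tendstoD(2)) auto
    then show ?thesis
    proof eventually_elim
      case (elim n)
      have pt: "F n x \<le> min (F n x) (H x) + R n x" for x
        using FH[of n x] by (cases "F n x \<le> H x") (auto simp: min_def add_increasing2)
      have "(\<integral>\<^sup>+x. F n x \<partial>M) \<le> (\<integral>\<^sup>+x. min (F n x) (H x) + R n x \<partial>M)"
        using pt by (intro nn_integral_mono)
      also have "\<dots> = (\<integral>\<^sup>+x. min (F n x) (H x) \<partial>M) + (\<integral>\<^sup>+x. R n x \<partial>M)"
        by (intro nn_integral_add) auto
      also have "\<dots> \<le> ennreal e' + ennreal e'" using elim R by (intro add_mono) auto
      also have "\<dots> = ennreal (2 * e')" using e'(1) by (simp flip: ennreal_plus)
      finally show ?case using e'(2) by (rule order_le_less_trans)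
    qed
  qed
  then show ?thesis by (intro order_tendstoI) auto
qed

section \<open>Variations of signed Radon measures\<close>

lemma rc_borel_Int: "B \<in> rc_borel \<Omega> \<Longrightarrow> A \<in> sets borel \<Longrightarrow> B \<inter> A \<in> rc_borel \<Omega>"
  unfolding rc_borel_def
proof safe
  assume B: "compact (closure B)" "closure B \<subseteq> \<Omega>"
  have sub: "closure (B \<inter> A) \<subseteq> closure B" by (rule closure_mono) simp
  then have "closure (B \<inter> A) = closure B \<inter> closure (B \<inter> A)" by blast
  then show "compact (closure (B \<inter> A))" using compact_Int_closed[OF B(1) closed_closure] by metis
  show "x \<in> \<Omega>" if "x \<in> closure (B \<inter> A)" for x using that sub B(2) by auto
qed auto

lemma rc_borel_Un: "A \<in> rc_borel \<Omega> \<Longrightarrow> B \<in> rc_borel \<Omega> \<Longrightarrow> A \<union> B \<in> rc_borel \<Omega>"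
  unfolding rc_borel_def by (auto simp: compact_Un)

lemma rc_borel_empty: "{} \<in> rc_borel \<Omega>"
  unfolding rc_borel_def by simp

lemma rc_borel_borel: "A \<in> rc_borel \<Omega> \<Longrightarrow> A \<in> sets borel"
  unfolding rc_borel_def by simp

lemma rc_borel_subset: "A \<in> rc_borel \<Omega> \<Longrightarrow> A \<subseteq> \<Omega>"
  unfolding rc_borel_def using closure_subset by blast

lemma rc_borel_Diff: "A \<in> rc_borel \<Omega> \<Longrightarrow> B \<in> rc_borel \<Omega> \<Longrightarrow> A - B \<in> rc_borel \<Omega>"
  using rc_borel_Int[of A \<Omega> "- B"] rc_borel_borel[of B \<Omega>] by (simp add: Diff_eq borel_comp)

lemma signed_radon_empty:
  assumes "signed_radon \<Omega> \<mu>" shows "\<mu> {} = 0"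
proof -
  have "(\<lambda>i::nat. \<mu> {}) sums \<mu> (\<Union>i::nat. {})"
    using assms[unfolded signed_radon_def, rule_format, of "\<lambda>_. {}"] rc_borel_empty[of \<Omega>]
    by (simp add: disjoint_family_on_def)
  then have "(\<lambda>i::nat. \<mu> {}) \<longlonglongrightarrow> 0" by (intro summable_LIMSEQ_zero) (auto simp: sums_iff)
  then show ?thesis by (simp add: LIMSEQ_const_iff)
qed

lemma signed_radon_Un:
  assumes \<mu>: "signed_radon \<Omega> \<mu>" and A: "A \<in> rc_borel \<Omega>" and B: "B \<in> rc_borel \<Omega>" and d: "A \<inter> B = {}"
  shows "\<mu> (A \<union> B) = \<mu> A + \<mu> B"
proof -
  have "(\<lambda>i. \<mu> (binaryset A B i)) sums \<mu> (\<Union>i. binaryset A B i)"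
  proof (rule \<mu>[unfolded signed_radon_def, rule_format])
    show "range (binaryset A B) \<subseteq> rc_borel \<Omega>"
      using A B rc_borel_empty by (simp add: range_binaryset_eq)
    show "disjoint_family (binaryset A B)"
      using d by (auto simp: disjoint_family_on_def binaryset_def)
    show "(\<Union>i. binaryset A B i) \<in> rc_borel \<Omega>" using rc_borel_Un[OF A B] by (simp add: UN_binaryset_eq)
  qed
  moreover have "(\<lambda>i. \<mu> (binaryset A B i)) sums (\<mu> A + \<mu> B)"
    by (rule binaryset_sums) (rule signed_radon_empty[OF \<mu>])
  ultimately show ?thesis using sums_unique2 by (fastforce simp: UN_binaryset_eq)
qed

lemma signed_radon_lincomb:
  assumes "signed_radon \<Omega> \<mu>" "signed_radon \<Omega> \<nu>"
  shows "signed_radon \<Omega> (\<lambda>A. a * \<mu> A + b * \<nu> A)"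
  using assms unfolding signed_radon_def by (auto intro!: sums_add sums_mult)

lemma signed_radon_cmult: "signed_radon \<Omega> \<mu> \<Longrightarrow> signed_radon \<Omega> (\<lambda>A. a * \<mu> A)"
  unfolding signed_radon_def by (auto intro!: sums_mult)

lemma signed_radon_uminus: "signed_radon \<Omega> \<mu> \<Longrightarrow> signed_radon \<Omega> (\<lambda>A. - \<mu> A)"
  unfolding signed_radon_def by (auto intro!: sums_minus)

lemma ennreal_add_le: "ennreal (x + y) \<le> ennreal x + ennreal y"
proof (cases "0 \<le> x \<and> 0 \<le> y")
  case True then show ?thesis by simp
next
  case False
  then consider "x < 0" | "y < 0" by linarith
  then show ?thesis
  proof cases
    case 1
    then have "ennreal (x + y) \<le> ennreal y" by (intro ennreal_leI) simp
    then show ?thesis by (simp add: add_increasing)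
  next
    case 2
    then have "ennreal (x + y) \<le> ennreal x" by (intro ennreal_leI) simp
    then show ?thesis by (simp add: add_increasing2)
  qed
qed

text \<open>Negative terms are truncated by \<open>ennreal\<close>, so the right-hand side is the
  sum of the positive parts, possibly infinite, and dominates every partial sum.\<close>

lemma ennreal_sums_le:
  assumes "f sums x"
  shows "ennreal x \<le> (\<Sum>i. ennreal (f i))"
proof (rule LIMSEQ_le_const2)
  show "(\<lambda>n. ennreal (\<Sum>i<n. f i)) \<longlonglongrightarrow> ennreal x"
    using assms unfolding sums_def by (rule tendsto_ennrealI)
  have "ennreal (\<Sum>i<n. f i) \<le> (\<Sum>i<n. ennreal (f i))" for n
  proof (induction n)
    case (Suc n)
    then show ?case using ennreal_add_le[of "\<Sum>i<n. f i" "f n"] by (simp add: order_trans add_mono)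
  qed simp
  moreover have "(\<Sum>i<n. ennreal (f i)) \<le> (\<Sum>i. ennreal (f i))" for n
    by (rule sum_le_suminf) auto
  ultimately show "\<exists>N. \<forall>n\<ge>N. ennreal (\<Sum>i<n. f i) \<le> (\<Sum>i. ennreal (f i))"
    using order_trans by blast
qed

lemma borel_subsets_eq: "\<Omega> \<in> sets borel \<Longrightarrow> {A \<in> sets borel. A \<subseteq> \<Omega>} = sets (restrict_space borel \<Omega>)"
  by (auto simp: sets_restrict_space)

lemma sigma_algebra_borel_subsets:
  "\<Omega> \<in> sets borel \<Longrightarrow> sigma_algebra \<Omega> {A \<in> sets borel. A \<subseteq> \<Omega>}"
  using sets.sigma_algebra_axioms[of "restrict_space borel \<Omega>"]
  by (simp add: borel_subsets_eq space_restrict_space)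

section \<open>Countable additivity of the positive variation\<close>

text \<open>The set function inside \<open>pos_variation\<close>, named separately because it can be
  handled before it is known to be a measure.\<close>

definition pos_part_fun :: "'a::euclidean_space set \<Rightarrow> ('a set \<Rightarrow> real) \<Rightarrow> 'a set \<Rightarrow> ennreal" where
  "pos_part_fun \<Omega> \<mu> A = (SUP B\<in>{B \<in> rc_borel \<Omega>. B \<subseteq> A}. ennreal (\<mu> B))"

lemma pos_part_fun_upper: "B \<in> rc_borel \<Omega> \<Longrightarrow> B \<subseteq> A \<Longrightarrow> ennreal (\<mu> B) \<le> pos_part_fun \<Omega> \<mu> A"
  unfolding pos_part_fun_def by (rule SUP_upper) simp

lemma pos_part_fun_least:
  "(\<And>B. B \<in> rc_borel \<Omega> \<Longrightarrow> B \<subseteq> A \<Longrightarrow> ennreal (\<mu> B) \<le> x) \<Longrightarrow> pos_part_fun \<Omega> \<mu> A \<le> x"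
  unfolding pos_part_fun_def by (rule SUP_least) simp

lemma pos_part_fun_mono: "A \<subseteq> B \<Longrightarrow> pos_part_fun \<Omega> \<mu> A \<le> pos_part_fun \<Omega> \<mu> B"
  by (rule pos_part_fun_least) (rule pos_part_fun_upper, auto)

lemma pos_part_fun_empty: "signed_radon \<Omega> \<mu> \<Longrightarrow> pos_part_fun \<Omega> \<mu> {} = 0"
  by (intro antisym pos_part_fun_least) (auto simp: signed_radon_empty)

text \<open>Competitors \<open>C \<subseteq> A\<close> and \<open>D \<subseteq> B\<close> are
  disjoint and unite to a competitor for the union. If one of the two values is negative, it is
  truncated to 0 and the other competitor alone suffices.\<close>

lemma pos_part_fun_superadd:
  assumes \<mu>: "signed_radon \<Omega> \<mu>" and d: "A \<inter> B = {}"
  shows "pos_part_fun \<Omega> \<mu> A + pos_part_fun \<Omega> \<mu> B \<le> pos_part_fun \<Omega> \<mu> (A \<union> B)"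
proof -
  have le: "ennreal (\<mu> C) + ennreal (\<mu> D) \<le> pos_part_fun \<Omega> \<mu> (A \<union> B)"
    if C: "C \<in> rc_borel \<Omega>" "C \<subseteq> A" and D: "D \<in> rc_borel \<Omega>" "D \<subseteq> B" for C D
  proof -
    consider "0 \<le> \<mu> C" "0 \<le> \<mu> D" | "\<mu> C < 0" | "\<mu> D < 0" by linarith
    then show ?thesis
    proof cases
      case 1
      have "ennreal (\<mu> C) + ennreal (\<mu> D) = ennreal (\<mu> (C \<union> D))"
        using signed_radon_Un[OF \<mu> C(1) D(1)] C D d 1 by (subst signed_radon_Un[OF \<mu> C(1) D(1)]) auto
      also have "\<dots> \<le> pos_part_fun \<Omega> \<mu> (A \<union> B)"
        using rc_borel_Un[OF C(1) D(1)] C D by (intro pos_part_fun_upper) auto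
      finally show ?thesis .
    next
      case 2
      have "ennreal (\<mu> D) \<le> pos_part_fun \<Omega> \<mu> (A \<union> B)" using D by (intro pos_part_fun_upper) auto
      then show ?thesis using 2 by (simp add: ennreal_neg)
    next
      case 3
      have "ennreal (\<mu> C) \<le> pos_part_fun \<Omega> \<mu> (A \<union> B)" using C by (intro pos_part_fun_upper) auto
      then show ?thesis using 3 by (simp add: ennreal_neg)
    qed
  qed
  have ne: "{B \<in> rc_borel \<Omega>. B \<subseteq> X} \<noteq> {}" for X using rc_borel_empty by auto
  have "ennreal (\<mu> C) + pos_part_fun \<Omega> \<mu> B \<le> pos_part_fun \<Omega> \<mu> (A \<union> B)"
    if C: "C \<in> rc_borel \<Omega>" "C \<subseteq> A" for C
  proof -
    have "ennreal (\<mu> C) + pos_part_fun \<Omega> \<mu> B = (SUP D\<in>{D \<in> rc_borel \<Omega>. D \<subseteq> B}. ennreal (\<mu> C) + ennreal (\<mu> D))"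
      unfolding pos_part_fun_def by (rule ennreal_SUP_add_right[OF ne])
    also have "\<dots> \<le> pos_part_fun \<Omega> \<mu> (A \<union> B)" using le[OF C] by (intro SUP_least) auto
    finally show ?thesis .
  qed
  then have "(SUP C\<in>{C \<in> rc_borel \<Omega>. C \<subseteq> A}. ennreal (\<mu> C) + pos_part_fun \<Omega> \<mu> B) \<le> pos_part_fun \<Omega> \<mu> (A \<union> B)"
    by (intro SUP_least) auto
  then show ?thesis
    unfolding pos_part_fun_def[of \<Omega> \<mu> A] by (simp only: ennreal_SUP_add_left[OF ne])
qed

text \<open>\<open>measure_of\<close> gives back the set function once it is countably additive. One
  inequality is finite superadditivity and passage to the limit. For the other, a competitor
  \<open>B\<close> for the union is cut into the pieces \<open>B \<inter> A i\<close>, whose values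
  sum to \<open>\<mu> B\<close>.\<close>

lemma emeasure_pos_variation:
  assumes \<mu>: "signed_radon \<Omega> \<mu>" and \<Omega>: "\<Omega> \<in> sets borel" and A: "A \<in> sets borel" "A \<subseteq> \<Omega>"
  shows "emeasure (pos_variation \<Omega> \<mu>) A = pos_part_fun \<Omega> \<mu> A"
proof -
  have "countably_additive {A \<in> sets borel. A \<subseteq> \<Omega>} (pos_part_fun \<Omega> \<mu>)"
    unfolding countably_additive_def
  proof (intro allI impI)
    fix A :: "nat \<Rightarrow> 'a set"
    assume A: "range A \<subseteq> {A \<in> sets borel. A \<subseteq> \<Omega>}" "disjoint_family A" "\<Union>(range A) \<in> {A \<in> sets borel. A \<subseteq> \<Omega>}"
    show "(\<Sum>i. pos_part_fun \<Omega> \<mu> (A i)) = pos_part_fun \<Omega> \<mu> (\<Union>(range A))"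
    proof (rule antisym)
      have "(\<Sum>i<n. pos_part_fun \<Omega> \<mu> (A i)) \<le> pos_part_fun \<Omega> \<mu> (\<Union>i<n. A i)" for n
      proof (induction n)
        case (Suc n)
        have "A i \<inter> A n = {}" if "i < n" for i
          using A(2) that by (simp add: disjoint_family_on_def)
        then have "(\<Union>i<n. A i) \<inter> A n = {}" by auto
        from pos_part_fun_superadd[OF \<mu> this]
        have "pos_part_fun \<Omega> \<mu> (\<Union>i<n. A i) + pos_part_fun \<Omega> \<mu> (A n) \<le> pos_part_fun \<Omega> \<mu> (\<Union>i<Suc n. A i)"
          by (simp add: lessThan_Suc Un_commute)
        from order_trans[OF add_right_mono[OF Suc] this] show ?case by simp
      qed (simp add: pos_part_fun_empty[OF \<mu>])
      moreover have "pos_part_fun \<Omega> \<mu> (\<Union>i<n. A i) \<le> pos_part_fun \<Omega> \<mu> (\<Union>(range A))" for n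
        by (rule pos_part_fun_mono) auto
      ultimately have "(\<Sum>i<n. pos_part_fun \<Omega> \<mu> (A i)) \<le> pos_part_fun \<Omega> \<mu> (\<Union>(range A))" for n
        by (rule order_trans)
      then show "(\<Sum>i. pos_part_fun \<Omega> \<mu> (A i)) \<le> pos_part_fun \<Omega> \<mu> (\<Union>(range A))"
        unfolding suminf_eq_SUP by (rule SUP_least)
      show "pos_part_fun \<Omega> \<mu> (\<Union>(range A)) \<le> (\<Sum>i. pos_part_fun \<Omega> \<mu> (A i))"
      proof (rule pos_part_fun_least)
        fix B assume B: "B \<in> rc_borel \<Omega>" "B \<subseteq> \<Union>(range A)"
        have BA: "B \<inter> A i \<in> rc_borel \<Omega>" for i using A(1) B(1) by (intro rc_borel_Int) auto
        have eq: "(\<Union>i. B \<inter> A i) = B" using B(2) by auto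
        have "(\<lambda>i. \<mu> (B \<inter> A i)) sums \<mu> (\<Union>i. B \<inter> A i)"
          using A(2) BA eq B(1)
          by (intro \<mu>[unfolded signed_radon_def, rule_format]) (auto simp: disjoint_family_on_def)
        then have "ennreal (\<mu> B) \<le> (\<Sum>i. ennreal (\<mu> (B \<inter> A i)))" unfolding eq by (rule ennreal_sums_le)
        also have "\<dots> \<le> (\<Sum>i. pos_part_fun \<Omega> \<mu> (A i))"
          using BA by (intro suminf_le summableI pos_part_fun_upper) auto
        finally show "ennreal (\<mu> B) \<le> (\<Sum>i. pos_part_fun \<Omega> \<mu> (A i))" .
      qed
    qed
  qed
  moreover have "positive {A \<in> sets borel. A \<subseteq> \<Omega>} (pos_part_fun \<Omega> \<mu>)"
    using pos_part_fun_empty[OF \<mu>] by (simp add: positive_def)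
  ultimately show ?thesis
    unfolding pos_variation_def pos_part_fun_def[symmetric]
    using A by (intro emeasure_measure_of_sigma sigma_algebra_borel_subsets[OF \<Omega>]) auto
qed

lemma sets_pos_variation:
  assumes "\<Omega> \<in> sets borel"
  shows "sets (pos_variation \<Omega> \<mu>) = sets (restrict_space borel \<Omega>)"
    and "space (pos_variation \<Omega> \<mu>) = \<Omega>"
proof -
  interpret sigma_algebra \<Omega> "{A \<in> sets borel. A \<subseteq> \<Omega>}"
    using assms by (rule sigma_algebra_borel_subsets)
  show "sets (pos_variation \<Omega> \<mu>) = sets (restrict_space borel \<Omega>)"
    unfolding pos_variation_def borel_subsets_eq[OF assms, symmetric] by (rule sets_measure_of_eq)
  show "space (pos_variation \<Omega> \<mu>) = \<Omega>"
    unfolding pos_variation_def by (rule space_measure_of_eq)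
qed

section \<open>Sums of measures, the Jordan decomposition and linear operations\<close>

text \<open>Meant for two measures with the same measurable sets. It allows equations between
  possibly infinite variations to be stated with sums on both sides.\<close>

definition add_measure :: "'b measure \<Rightarrow> 'b measure \<Rightarrow> 'b measure" where
  "add_measure M N = measure_of (space M) (sets M) (\<lambda>A. emeasure M A + emeasure N A)"

lemma sets_add_measure[simp, measurable_cong]: "sets (add_measure M N) = sets M"
  and space_add_measure[simp]: "space (add_measure M N) = space M"
  unfolding add_measure_def by simp_all

lemma emeasure_add_measure:
  assumes "sets M = sets N" "A \<in> sets M"
  shows "emeasure (add_measure M N) A = emeasure M A + emeasure N A"
  unfolding add_measure_def
proof (rule emeasure_measure_of_sigma)
  show "countably_additive (sets M) (\<lambda>A. emeasure M A + emeasure N A)"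
    unfolding countably_additive_def using assms(1)
    by (auto simp: suminf_add[symmetric] suminf_emeasure)
qed (use assms(2) in \<open>auto simp: positive_def sets.sigma_algebra_axioms\<close>)

lemma nn_integral_add_measure:
  assumes f: "f \<in> borel_measurable M" and MN: "sets M = sets N"
  shows "nn_integral (add_measure M N) f = nn_integral M f + nn_integral N f"
  using f
proof induction
  case (cong f g)
  have sp: "space N = space M" using MN by (rule sets_eq_imp_space_eq[symmetric])
  show ?case using cong by (simp add: sp cong: nn_integral_cong_simp)
next
  case (set A)
  then show ?case using MN by (simp add: emeasure_add_measure)
next
  case (mult f c)
  have [measurable]: "f \<in> borel_measurable N" using mult MN measurable_cong_sets by blast
  show ?case using mult by (simp add: nn_integral_cmult distrib_left)
next
  case (add f g)
  have [measurable]: "f \<in> borel_measurable N" "g \<in> borel_measurable N"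
    using add MN measurable_cong_sets by blast+
  show ?case using add by (simp add: nn_integral_add ac_simps)
next
  case (seq U)
  have [measurable]: "U i \<in> borel_measurable N" for i using seq MN measurable_cong_sets by blast
  have inc: "incseq (\<lambda>i. nn_integral M (U i))" "incseq (\<lambda>i. nn_integral N (U i))"
    using seq(3) by (auto simp: incseq_def le_fun_def intro!: nn_integral_mono)
  have SUP_eq: "Sup (range U) = (\<lambda>x. SUP i. U i x)" by (simp add: fun_eq_iff image_comp)
  have mc: "nn_integral X (Sup (range U)) = (SUP i. nn_integral X (U i))"
    if "\<And>i. U i \<in> borel_measurable X" for X
    unfolding SUP_eq using seq(3) that by (rule nn_integral_monotone_convergence_SUP)
  have "nn_integral (add_measure M N) (Sup (range U)) = (SUP i. nn_integral (add_measure M N) (U i))"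
    using seq(1) by (intro mc) (simp add: measurable_cong_sets[OF sets_add_measure refl])
  also have "\<dots> = (SUP i. nn_integral M (U i) + nn_integral N (U i))" using seq by simp
  also have "\<dots> = (SUP i. nn_integral M (U i)) + (SUP i. nn_integral N (U i))"
    using inc by (rule ennreal_SUP_add)
  also have "\<dots> = nn_integral M (Sup (range U)) + nn_integral N (Sup (range U))"
    using seq(1) by (simp add: mc)
  finally show ?case .
qed

lemma total_variation_eq:
  assumes "\<Omega> \<in> sets borel"
  shows "total_variation \<Omega> \<mu> = add_measure (pos_variation \<Omega> \<mu>) (neg_variation \<Omega> \<mu>)"
  unfolding total_variation_def add_measure_def
  by (simp add: sets_pos_variation[OF assms] borel_subsets_eq[OF assms])

text \<open>The Jordan decomposition without subtraction; the two \<open>ennreal\<close> terms are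
  the negative and positive parts of the number \<open>\<mu> A\<close>. It rests on
  \<open>- \<mu> B = \<mu> (A - B) - \<mu> A\<close> for \<open>B \<subseteq> A\<close>, which
  compares competitors for the two variations; the reverse inequality is the same statement for
  \<open>- \<mu>\<close>.\<close>

lemma variation_Jordan:
  assumes \<mu>: "signed_radon \<Omega> \<mu>" and \<Omega>: "\<Omega> \<in> sets borel" and A: "A \<in> rc_borel \<Omega>"
  shows "emeasure (pos_variation \<Omega> \<mu>) A + ennreal (- \<mu> A)
    = emeasure (neg_variation \<Omega> \<mu>) A + ennreal (\<mu> A)"
proof -
  have le: "pos_part_fun \<Omega> (\<lambda>A. - \<mu> A) A + ennreal (\<mu> A) \<le> pos_part_fun \<Omega> \<mu> A + ennreal (- \<mu> A)"
    if \<mu>: "signed_radon \<Omega> \<mu>" for \<mu>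
  proof -
    have "ennreal (- \<mu> B) + ennreal (\<mu> A) \<le> pos_part_fun \<Omega> \<mu> A + ennreal (- \<mu> A)"
      if B: "B \<in> rc_borel \<Omega>" "B \<subseteq> A" for B
    proof -
      have D: "A - B \<in> rc_borel \<Omega>" using A B(1) by (rule rc_borel_Diff)
      have eq: "\<mu> A = \<mu> B + \<mu> (A - B)"
        using signed_radon_Un[OF \<mu> B(1) D] B(2) by (simp add: Un_absorb1)
      have 1: "ennreal (\<mu> A) \<le> pos_part_fun \<Omega> \<mu> A" "ennreal (\<mu> (A - B)) \<le> pos_part_fun \<Omega> \<mu> A"
        using A D by (auto intro!: pos_part_fun_upper)
      consider "\<mu> B > 0" | "\<mu> B \<le> 0" "\<mu> A < 0" | "\<mu> B \<le> 0" "0 \<le> \<mu> A" by linarith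
      then show ?thesis
      proof cases
        case 1
        then show ?thesis using \<open>ennreal (\<mu> A) \<le> _\<close> by (simp add: ennreal_neg add_increasing2)
      next
        case 2
        have "ennreal (- \<mu> B) = ennreal (\<mu> (A - B) + - \<mu> A)" using eq by simp
        also have "\<dots> \<le> ennreal (\<mu> (A - B)) + ennreal (- \<mu> A)" by (rule ennreal_add_le)
        also have "\<dots> \<le> pos_part_fun \<Omega> \<mu> A + ennreal (- \<mu> A)" using 1(2) by (rule add_right_mono)
        finally show ?thesis using 2 by (simp add: ennreal_neg)
      next
        case 3
        have "ennreal (- \<mu> B) + ennreal (\<mu> A) = ennreal (\<mu> (A - B))" using 3 eq by (simp flip: ennreal_plus)
        then show ?thesis using 1(2) by (simp add: add_increasing2)
      qed
    qed
    then have "(SUP B\<in>{B \<in> rc_borel \<Omega>. B \<subseteq> A}. ennreal (- \<mu> B) + ennreal (\<mu> A))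
        \<le> pos_part_fun \<Omega> \<mu> A + ennreal (- \<mu> A)"
      by (intro SUP_least) auto
    moreover have ne: "{B \<in> rc_borel \<Omega>. B \<subseteq> A} \<noteq> {}" using rc_borel_empty by auto
    ultimately show ?thesis
      unfolding pos_part_fun_def[of _ "\<lambda>A. - \<mu> A"] by (subst ennreal_SUP_add_left[OF ne, symmetric])
  qed
  have m: "signed_radon \<Omega> (\<lambda>A. - \<mu> A)" using \<mu> by (rule signed_radon_uminus)
  have "pos_part_fun \<Omega> \<mu> A + ennreal (- \<mu> A) = pos_part_fun \<Omega> (\<lambda>A. - \<mu> A) A + ennreal (\<mu> A)"
    using le[OF \<mu>] le[OF m] by (intro antisym) simp_all
  then show ?thesis
    unfolding neg_variation_def
    using emeasure_pos_variation[OF \<mu> \<Omega> rc_borel_borel[OF A] rc_borel_subset[OF A]]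
      emeasure_pos_variation[OF m \<Omega> rc_borel_borel[OF A] rc_borel_subset[OF A]] by simp
qed

text \<open>For a common competitor the value of the sum splits, and each part is bounded by its own
  supremum. Equality fails in general, because the positive part of one measure may cancel against
  the negative part of the other.\<close>

lemma pos_variation_lincomb_le:
  assumes \<mu>: "signed_radon \<Omega> \<mu>" and \<nu>: "signed_radon \<Omega> \<nu>" and \<Omega>: "\<Omega> \<in> sets borel"
    and f: "f \<in> borel_measurable (restrict_space borel \<Omega>)"
  shows "nn_integral (pos_variation \<Omega> (\<lambda>A. \<mu> A + \<nu> A)) f
    \<le> nn_integral (pos_variation \<Omega> \<mu>) f + nn_integral (pos_variation \<Omega> \<nu>) f"
proof -
  note S = sets_pos_variation(1)[OF \<Omega>]
  have r: "signed_radon \<Omega> (\<lambda>A. \<mu> A + \<nu> A)" using signed_radon_lincomb[OF \<mu> \<nu>, of 1 1] by simp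
  have "pos_variation \<Omega> (\<lambda>A. \<mu> A + \<nu> A) \<le> add_measure (pos_variation \<Omega> \<mu>) (pos_variation \<Omega> \<nu>)"
  proof (subst le_measure)
    show "sets (pos_variation \<Omega> (\<lambda>A. \<mu> A + \<nu> A)) = sets (add_measure (pos_variation \<Omega> \<mu>) (pos_variation \<Omega> \<nu>))"
      by (simp add: S)
    show "\<forall>A\<in>sets (pos_variation \<Omega> (\<lambda>A. \<mu> A + \<nu> A)). emeasure (pos_variation \<Omega> (\<lambda>A. \<mu> A + \<nu> A)) A
        \<le> emeasure (add_measure (pos_variation \<Omega> \<mu>) (pos_variation \<Omega> \<nu>)) A"
    proof
      fix A assume "A \<in> sets (pos_variation \<Omega> (\<lambda>A. \<mu> A + \<nu> A))"
      then have A: "A \<in> sets borel" "A \<subseteq> \<Omega>" and As: "A \<in> sets (pos_variation \<Omega> \<mu>)"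
        unfolding S borel_subsets_eq[OF \<Omega>, symmetric] by auto
      have "pos_part_fun \<Omega> (\<lambda>A. \<mu> A + \<nu> A) A \<le> pos_part_fun \<Omega> \<mu> A + pos_part_fun \<Omega> \<nu> A"
        by (rule pos_part_fun_least, rule order_trans[OF ennreal_add_le])
           (intro add_mono pos_part_fun_upper)
      then show "emeasure (pos_variation \<Omega> (\<lambda>A. \<mu> A + \<nu> A)) A
          \<le> emeasure (add_measure (pos_variation \<Omega> \<mu>) (pos_variation \<Omega> \<nu>)) A"
        using As by (simp add: emeasure_add_measure S emeasure_pos_variation[OF _ \<Omega> A] \<mu> \<nu> r)
    qed
  qed
  then have "nn_integral (pos_variation \<Omega> (\<lambda>A. \<mu> A + \<nu> A)) f
      \<le> nn_integral (add_measure (pos_variation \<Omega> \<mu>) (pos_variation \<Omega> \<nu>)) f"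
    by (intro nn_integral_mono_measure) (simp_all add: S)
  also have "\<dots> = nn_integral (pos_variation \<Omega> \<mu>) f + nn_integral (pos_variation \<Omega> \<nu>) f"
    using f by (intro nn_integral_add_measure) (simp_all add: S measurable_cong_sets[OF S refl])
  finally show ?thesis .
qed

lemma pos_variation_cmult:
  assumes \<mu>: "signed_radon \<Omega> \<mu>" and \<Omega>: "\<Omega> \<in> sets borel" and a: "0 \<le> a"
  shows "pos_variation \<Omega> (\<lambda>A. a * \<mu> A) = scale_measure (ennreal a) (pos_variation \<Omega> \<mu>)"
proof (rule measure_eqI)
  note S = sets_pos_variation(1)[OF \<Omega>]
  show "sets (pos_variation \<Omega> (\<lambda>A. a * \<mu> A)) = sets (scale_measure (ennreal a) (pos_variation \<Omega> \<mu>))"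
    by (simp add: S)
  fix A assume "A \<in> sets (pos_variation \<Omega> (\<lambda>A. a * \<mu> A))"
  then have A: "A \<in> sets borel" "A \<subseteq> \<Omega>" and As: "A \<in> sets (pos_variation \<Omega> \<mu>)"
    unfolding S borel_subsets_eq[OF \<Omega>, symmetric] by auto
  have "pos_part_fun \<Omega> (\<lambda>A. a * \<mu> A) A = ennreal a * pos_part_fun \<Omega> \<mu> A"
    unfolding pos_part_fun_def using a by (simp add: SUP_mult_left_ennreal ennreal_mult')
  then show "emeasure (pos_variation \<Omega> (\<lambda>A. a * \<mu> A)) A = emeasure (scale_measure (ennreal a) (pos_variation \<Omega> \<mu>)) A"
    by (simp add: emeasure_pos_variation[OF _ \<Omega> A] \<mu> signed_radon_cmult)
qed

lemma nn_integral_total_variation: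
  assumes \<Omega>: "\<Omega> \<in> sets borel" and f: "f \<in> borel_measurable (restrict_space borel \<Omega>)"
  shows "nn_integral (total_variation \<Omega> \<mu>) f
    = nn_integral (pos_variation \<Omega> \<mu>) f + nn_integral (neg_variation \<Omega> \<mu>) f"
  unfolding total_variation_eq[OF \<Omega>] neg_variation_def using f
  by (intro nn_integral_add_measure)
     (simp_all add: sets_pos_variation[OF \<Omega>] measurable_cong_sets[OF sets_pos_variation(1)[OF \<Omega>] refl])

lemma M_norm_eq:
  assumes \<Omega>: "\<Omega> \<in> sets borel"
  shows "M_norm \<Omega> \<beta> \<mu> = (\<integral>\<^sup>+x. ennreal (bdist \<Omega> x powr \<beta>) \<partial>pos_variation \<Omega> \<mu>)
    + (\<integral>\<^sup>+x. ennreal (bdist \<Omega> x powr \<beta>) \<partial>neg_variation \<Omega> \<mu>)"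
  unfolding M_norm_def by (rule nn_integral_total_variation[OF \<Omega>]) (intro measurable_restrict_space1, measurable)

lemma M_norm_lincomb_le:
  assumes \<mu>: "signed_radon \<Omega> \<mu>" and \<nu>: "signed_radon \<Omega> \<nu>" and \<Omega>: "\<Omega> \<in> sets borel"
  shows "M_norm \<Omega> \<beta> (\<lambda>A. \<mu> A + \<nu> A) \<le> M_norm \<Omega> \<beta> \<mu> + M_norm \<Omega> \<beta> \<nu>"
proof -
  have f: "(\<lambda>x. ennreal (bdist \<Omega> x powr \<beta>)) \<in> borel_measurable (restrict_space borel \<Omega>)"
    by (intro measurable_restrict_space1) measurable
  show ?thesis
    using add_mono[OF pos_variation_lincomb_le[OF \<mu> \<nu> \<Omega> f]
        pos_variation_lincomb_le[OF signed_radon_uminus[OF \<mu>] signed_radon_uminus[OF \<nu>] \<Omega> f]]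
    unfolding M_norm_eq[OF \<Omega>] neg_variation_def by (simp add: add_ac)
qed

lemma variations_cmult:
  assumes \<mu>: "signed_radon \<Omega> \<mu>" and \<Omega>: "\<Omega> \<in> sets borel"
  shows "0 \<le> a \<Longrightarrow> pos_variation \<Omega> (\<lambda>A. a * \<mu> A) = scale_measure (ennreal a) (pos_variation \<Omega> \<mu>)"
    and "0 \<le> a \<Longrightarrow> neg_variation \<Omega> (\<lambda>A. a * \<mu> A) = scale_measure (ennreal a) (neg_variation \<Omega> \<mu>)"
    and "a \<le> 0 \<Longrightarrow> pos_variation \<Omega> (\<lambda>A. a * \<mu> A) = scale_measure (ennreal (- a)) (neg_variation \<Omega> \<mu>)"
    and "a \<le> 0 \<Longrightarrow> neg_variation \<Omega> (\<lambda>A. a * \<mu> A) = scale_measure (ennreal (- a)) (pos_variation \<Omega> \<mu>)"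
  using pos_variation_cmult[OF \<mu> \<Omega>, of a] pos_variation_cmult[OF \<mu> \<Omega>, of "- a"]
    pos_variation_cmult[OF signed_radon_uminus[OF \<mu>] \<Omega>, of a]
    pos_variation_cmult[OF signed_radon_uminus[OF \<mu>] \<Omega>, of "- a"]
  by (simp_all add: neg_variation_def)

lemma M_norm_cmult:
  assumes \<mu>: "signed_radon \<Omega> \<mu>" and \<Omega>: "\<Omega> \<in> sets borel"
  shows "M_norm \<Omega> \<beta> (\<lambda>A. a * \<mu> A) = ennreal \<bar>a\<bar> * M_norm \<Omega> \<beta> \<mu>"
proof -
  have f: "(\<lambda>x. ennreal (bdist \<Omega> x powr \<beta>)) \<in> borel_measurable (restrict_space borel \<Omega>)"
    by (intro measurable_restrict_space1) measurable
  have m: "(\<lambda>x. ennreal (bdist \<Omega> x powr \<beta>)) \<in> borel_measurable (pos_variation \<Omega> \<nu>)" for \<nu>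
    using f unfolding measurable_cong_sets[OF sets_pos_variation(1)[OF \<Omega>] refl] .
  show ?thesis
  proof (cases "0 \<le> a")
    case True
    then show ?thesis using m
      by (simp add: M_norm_eq[OF \<Omega>] variations_cmult[OF \<mu> \<Omega>] nn_integral_scale_measure neg_variation_def[of _ \<mu>] distrib_left)
  next
    case False
    then show ?thesis using m
      by (simp add: M_norm_eq[OF \<Omega>] variations_cmult[OF \<mu> \<Omega>] nn_integral_scale_measure neg_variation_def[of _ \<mu>] distrib_left add_ac)
  qed
qed

lemma M_space_add:
  assumes "\<mu> \<in> M_space \<Omega> \<beta>" "\<nu> \<in> M_space \<Omega> \<beta>" "\<Omega> \<in> sets borel"
  shows "(\<lambda>A. \<mu> A + \<nu> A) \<in> M_space \<Omega> \<beta>"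
  using assms M_norm_lincomb_le[of \<Omega> \<mu> \<nu> \<beta>] signed_radon_lincomb[of \<Omega> \<mu> \<nu> 1 1]
  unfolding M_space_def by (auto intro: order_le_less_trans simp: ennreal_add_eq_top less_top)

lemma M_space_cmult:
  assumes "\<mu> \<in> M_space \<Omega> \<beta>" "\<Omega> \<in> sets borel"
  shows "(\<lambda>A. a * \<mu> A) \<in> M_space \<Omega> \<beta>"
  using assms M_norm_cmult[of \<Omega> \<mu> \<beta> a] signed_radon_cmult[of \<Omega> \<mu> a]
  unfolding M_space_def by (auto simp: ennreal_mult_less_top)

section \<open>Local finiteness and additivity of the variations\<close>

lemma bdist_ge_on_rc_borel:
  assumes op: "open \<Omega>" "\<Omega> \<noteq> UNIV" and A: "A \<in> rc_borel \<Omega>"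
  obtains c where "0 < c" "\<And>x. x \<in> A \<Longrightarrow> c \<le> bdist \<Omega> x"
proof (cases "A = {}")
  case True
  then show ?thesis using that[of 1] by simp
next
  case False
  have cA: "compact (closure A)" "closure A \<subseteq> \<Omega>" using A by (auto simp: rc_borel_def)
  have "continuous_on (closure A) (bdist \<Omega>)" unfolding bdist_def[abs_def] by (intro continuous_intros)
  moreover have "closure A \<noteq> {}" using False by simp
  ultimately obtain z where z: "z \<in> closure A" "\<And>x. x \<in> closure A \<Longrightarrow> bdist \<Omega> z \<le> bdist \<Omega> x"
    using continuous_attains_inf[OF cA(1)] by metis
  show ?thesis
  proof (rule that)
    show "0 < bdist \<Omega> z" using bdist_pos[OF op] z(1) cA(2) by blast
    show "bdist \<Omega> z \<le> bdist \<Omega> x" if "x \<in> A" for x using z(2) that closure_subset by blast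
  qed
qed

text \<open>A Markov inequality: on \<open>A\<close> the weight is at least
  \<open>c powr \<beta>\<close> with \<open>0 < c\<close>. Since \<mu> is an arbitrary set function,
  the negative variation is covered by passing to \<open>- \<mu>\<close>.\<close>

lemma variation_finite_on_rc_borel:
  assumes op: "open \<Omega>" "\<Omega> \<noteq> UNIV" and \<beta>: "0 \<le> \<beta>" and A: "A \<in> rc_borel \<Omega>"
    and fin: "(\<integral>\<^sup>+x. ennreal (bdist \<Omega> x powr \<beta>) \<partial>pos_variation \<Omega> \<mu>) < \<infinity>"
  shows "emeasure (pos_variation \<Omega> \<mu>) A < \<infinity>"
proof -
  have \<Omega>: "\<Omega> \<in> sets borel" using op by simp
  obtain c where c: "0 < c" "\<And>x. x \<in> A \<Longrightarrow> c \<le> bdist \<Omega> x" using bdist_ge_on_rc_borel[OF op A] by blast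
  have As: "A \<in> sets (pos_variation \<Omega> \<mu>)"
    using rc_borel_borel[OF A] rc_borel_subset[OF A]
    unfolding sets_pos_variation(1)[OF \<Omega>] borel_subsets_eq[OF \<Omega>, symmetric] by simp
  have "ennreal (c powr \<beta>) * emeasure (pos_variation \<Omega> \<mu>) A
      = (\<integral>\<^sup>+x. ennreal (c powr \<beta>) * indicator A x \<partial>pos_variation \<Omega> \<mu>)"
    using As by (simp add: nn_integral_cmult)
  also have "\<dots> \<le> (\<integral>\<^sup>+x. ennreal (bdist \<Omega> x powr \<beta>) \<partial>pos_variation \<Omega> \<mu>)"
    using c \<beta> by (intro nn_integral_mono) (auto simp: indicator_def intro!: ennreal_leI powr_mono2)
  finally have "ennreal (c powr \<beta>) * emeasure (pos_variation \<Omega> \<mu>) A < \<infinity>" using fin by (rule order_le_less_trans)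
  then show ?thesis using c(1) by (auto simp: ennreal_mult_less_top)
qed

lemma M_space_variations_finite:
  assumes op: "open \<Omega>" "\<Omega> \<noteq> UNIV" and \<beta>: "0 \<le> \<beta>" and A: "A \<in> rc_borel \<Omega>" and \<mu>: "\<mu> \<in> M_space \<Omega> \<beta>"
  shows "emeasure (pos_variation \<Omega> \<mu>) A < \<infinity>" and "emeasure (neg_variation \<Omega> \<mu>) A < \<infinity>"
proof -
  have \<Omega>: "\<Omega> \<in> sets borel" using op by simp
  have "M_norm \<Omega> \<beta> \<mu> < \<infinity>" using \<mu> by (simp add: M_space_def)
  then have fin: "(\<integral>\<^sup>+x. ennreal (bdist \<Omega> x powr \<beta>) \<partial>pos_variation \<Omega> \<mu>) < \<infinity>"
    "(\<integral>\<^sup>+x. ennreal (bdist \<Omega> x powr \<beta>) \<partial>neg_variation \<Omega> \<mu>) < \<infinity>"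
    unfolding M_norm_eq[OF \<Omega>] by (auto simp: less_top)
  show "emeasure (pos_variation \<Omega> \<mu>) A < \<infinity>"
    by (rule variation_finite_on_rc_borel[OF op \<beta> A fin(1)])
  show "emeasure (neg_variation \<Omega> \<mu>) A < \<infinity>"
    using variation_finite_on_rc_borel[OF op \<beta> A fin(2)[unfolded neg_variation_def]]
    unfolding neg_variation_def .
qed

lemma rc_borel_compact:
  fixes K :: "'a::euclidean_space set"
  assumes "compact K" "K \<subseteq> \<Omega>"
  shows "K \<in> rc_borel \<Omega>"
  unfolding rc_borel_def mem_Collect_eq closure_closed[OF compact_imp_closed[OF assms(1)]]
  using assms by (simp add: compact_imp_closed)

text \<open>Superlevel sets of \<open>bdist\<close>: they are closed in the whole space by
  continuity, and they lie in \<Omega> because \<open>bdist\<close> vanishes elsewhere.\<close>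

lemma compact_exhaustion:
  fixes \<Omega> :: "'a::euclidean_space set"
  assumes op: "open \<Omega>" "bounded \<Omega>"
  shows "\<exists>K. (\<forall>n :: nat. compact (K n) \<and> K n \<subseteq> \<Omega>) \<and> incseq K \<and> (\<Union>n. K n) = \<Omega>"
proof -
  define K where "K n = {x. 1 / real (Suc n) \<le> bdist \<Omega> x}" for n
  have cont: "continuous_on UNIV (bdist \<Omega>)" unfolding bdist_def[abs_def] by (intro continuous_intros)
  have Kcl: "closed (K n)" for n unfolding K_def by (intro closed_Collect_le cont continuous_intros)
  have K\<Omega>: "K n \<subseteq> \<Omega>" for n
  proof
    fix x assume "x \<in> K n"
    moreover have "0 < 1 / real (Suc n)" by simp
    ultimately have "0 < bdist \<Omega> x" unfolding K_def mem_Collect_eq by linarith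
    then show "x \<in> \<Omega>" using bdist_eq_0[of x \<Omega>] by force
  qed
  have "bounded (K n)" for n using bounded_subset[OF op(2) K\<Omega>] .
  then have "compact (K n)" for n using Kcl by (simp add: compact_eq_bounded_closed)
  moreover have "incseq K"
  proof (rule incseq_SucI)
    fix n
    have "1 / real (Suc (Suc n)) \<le> 1 / real (Suc n)" by (simp add: field_simps)
    then show "K n \<le> K (Suc n)" unfolding K_def by auto
  qed
  moreover have "\<Omega> \<subseteq> (\<Union>n. K n)"
  proof
    fix x assume x: "x \<in> \<Omega>"
    then have "0 < bdist \<Omega> x" using bdist_pos[OF op(1) bounded_neq_UNIV[OF op(2)]] by blast
    then obtain n where "1 / real (Suc n) < bdist \<Omega> x" using nat_approx_posE by blast
    then show "x \<in> (\<Union>n. K n)" using x by (auto simp: K_def intro: less_imp_le)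
  qed
  ultimately show ?thesis using K\<Omega> by (intro exI[of _ K]) auto
qed

text \<open>Continuity from below along the exhaustion extends the agreement to all Borel subsets of
  \<Omega>, also when the masses are infinite.\<close>

lemma measure_eqI_rc_borel:
  assumes op: "open \<Omega>" "bounded \<Omega>"
    and S: "sets M = sets (restrict_space borel \<Omega>)" "sets N = sets (restrict_space borel \<Omega>)"
    and eq: "\<And>A. A \<in> rc_borel \<Omega> \<Longrightarrow> emeasure M A = emeasure N A"
  shows "M = N"
proof (rule measure_eqI)
  show "sets M = sets N" using S by simp
  have \<Omega>: "\<Omega> \<in> sets borel" using op by simp
  fix A assume "A \<in> sets M"
  then have A: "A \<in> sets borel" "A \<subseteq> \<Omega>" unfolding S borel_subsets_eq[OF \<Omega>, symmetric] by auto
  obtain K where K: "\<And>n :: nat. compact (K n)" "\<And>n. K n \<subseteq> \<Omega>" "incseq K" "(\<Union>n. K n) = \<Omega>"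
    using compact_exhaustion[OF op] by blast
  have "K n \<in> rc_borel \<Omega>" for n using K(1,2) by (rule rc_borel_compact)
  then have AK: "A \<inter> K n \<in> rc_borel \<Omega>" for n
    using rc_borel_Int[of "K n" \<Omega> A] A(1) by (simp add: Int_commute)
  have inc: "incseq (\<lambda>n. A \<inter> K n)" using K(3) by (auto simp: incseq_def)
  have un: "(\<Union>n. A \<inter> K n) = A" using K(4) A(2) by auto
  have sets: "range (\<lambda>n. A \<inter> K n) \<subseteq> sets X" if "sets X = sets (restrict_space borel \<Omega>)" for X
    unfolding that borel_subsets_eq[OF \<Omega>, symmetric] using AK rc_borel_borel rc_borel_subset by blast
  have "emeasure M A = (SUP n. emeasure M (A \<inter> K n))"
    using SUP_emeasure_incseq[OF sets[OF S(1)] inc] un by simp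
  also have "\<dots> = (SUP n. emeasure N (A \<inter> K n))" using eq AK by simp
  also have "\<dots> = emeasure N A"
    using SUP_emeasure_incseq[OF sets[OF S(2)] inc] un by simp
  finally show "emeasure M A = emeasure N A" .
qed

text \<open>The positive variation is not additive, but \<open>(\<mu> + \<nu>)\<^sup>+ +
  \<mu>\<^sup>- + \<nu>\<^sup>- = (\<mu> + \<nu>)\<^sup>- + \<mu>\<^sup>+ + \<nu>\<^sup>+\<close>
  holds as an equality of measures. On relatively compact sets all six masses are finite, and the
  Jordan decomposition turns it into additivity of the values.\<close>

lemma nn_integral_variations_add:
  assumes op: "open \<Omega>" "bounded \<Omega>" and \<beta>: "0 \<le> \<beta>"
    and \<mu>: "\<mu> \<in> M_space \<Omega> \<beta>" and \<nu>: "\<nu> \<in> M_space \<Omega> \<beta>"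
    and f: "f \<in> borel_measurable (restrict_space borel \<Omega>)"
  shows "nn_integral (pos_variation \<Omega> (\<lambda>A. \<mu> A + \<nu> A)) f + nn_integral (neg_variation \<Omega> \<mu>) f
      + nn_integral (neg_variation \<Omega> \<nu>) f
    = nn_integral (neg_variation \<Omega> (\<lambda>A. \<mu> A + \<nu> A)) f + nn_integral (pos_variation \<Omega> \<mu>) f
      + nn_integral (pos_variation \<Omega> \<nu>) f"
proof -
  have \<Omega>: "\<Omega> \<in> sets borel" and ne: "\<Omega> \<noteq> UNIV" using op bounded_neq_UNIV by auto
  define \<rho> where "\<rho> = (\<lambda>A. \<mu> A + \<nu> A)"
  have \<rho>: "\<rho> \<in> M_space \<Omega> \<beta>" unfolding \<rho>_def using \<mu> \<nu> \<Omega> by (rule M_space_add)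
  have S: "sets (pos_variation \<Omega> \<kappa>) = sets (restrict_space borel \<Omega>)"
    "sets (neg_variation \<Omega> \<kappa>) = sets (restrict_space borel \<Omega>)" for \<kappa>
    unfolding neg_variation_def by (rule sets_pos_variation(1)[OF \<Omega>])+
  have "add_measure (add_measure (pos_variation \<Omega> \<rho>) (neg_variation \<Omega> \<mu>)) (neg_variation \<Omega> \<nu>)
      = add_measure (add_measure (neg_variation \<Omega> \<rho>) (pos_variation \<Omega> \<mu>)) (pos_variation \<Omega> \<nu>)"
  proof (rule measure_eqI_rc_borel[OF op])
    fix A assume A: "A \<in> rc_borel \<Omega>"
    then have As: "A \<in> sets (restrict_space borel \<Omega>)"
      using rc_borel_borel[OF A] rc_borel_subset[OF A] unfolding borel_subsets_eq[OF \<Omega>, symmetric] by simp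
    define p n where "p \<kappa> = enn2real (emeasure (pos_variation \<Omega> \<kappa>) A)"
      and "n \<kappa> = enn2real (emeasure (neg_variation \<Omega> \<kappa>) A)" for \<kappa>
    have pn: "emeasure (pos_variation \<Omega> \<kappa>) A = ennreal (p \<kappa>)" "emeasure (neg_variation \<Omega> \<kappa>) A = ennreal (n \<kappa>)"
      "0 \<le> p \<kappa>" "0 \<le> n \<kappa>" "p \<kappa> - n \<kappa> = \<kappa> A" if \<kappa>: "\<kappa> \<in> M_space \<Omega> \<beta>" for \<kappa>
    proof -
      show 1: "emeasure (pos_variation \<Omega> \<kappa>) A = ennreal (p \<kappa>)" "emeasure (neg_variation \<Omega> \<kappa>) A = ennreal (n \<kappa>)"
        unfolding p_def n_def using M_space_variations_finite[OF op(1) ne \<beta> A \<kappa>] by simp_all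
      show 2: "0 \<le> p \<kappa>" "0 \<le> n \<kappa>" by (simp_all add: p_def n_def)
      have "ennreal (p \<kappa>) + ennreal (- \<kappa> A) = ennreal (n \<kappa>) + ennreal (\<kappa> A)"
        using variation_Jordan[OF _ \<Omega> A, of \<kappa>] \<kappa> 1 by (simp add: M_space_def)
      then show "p \<kappa> - n \<kappa> = \<kappa> A"
        using 2 by (cases "0 \<le> \<kappa> A") (simp_all add: ennreal_neg flip: ennreal_plus)
    qed
    have "p \<rho> + n \<mu> + n \<nu> = n \<rho> + p \<mu> + p \<nu>"
      using pn(5)[OF \<rho>] pn(5)[OF \<mu>] pn(5)[OF \<nu>] by (simp add: \<rho>_def)
    then have "ennreal (p \<rho>) + ennreal (n \<mu>) + ennreal (n \<nu>) = ennreal (n \<rho>) + ennreal (p \<mu>) + ennreal (p \<nu>)"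
      using pn(3,4)[OF \<rho>] pn(3,4)[OF \<mu>] pn(3,4)[OF \<nu>] by (simp flip: ennreal_plus)
    then show "emeasure (add_measure (add_measure (pos_variation \<Omega> \<rho>) (neg_variation \<Omega> \<mu>)) (neg_variation \<Omega> \<nu>)) A
      = emeasure (add_measure (add_measure (neg_variation \<Omega> \<rho>) (pos_variation \<Omega> \<mu>)) (pos_variation \<Omega> \<nu>)) A"
      using As by (simp add: emeasure_add_measure S pn(1,2)[OF \<rho>] pn(1,2)[OF \<mu>] pn(1,2)[OF \<nu>])
  qed (simp_all add: S)
  moreover have "nn_integral (add_measure (add_measure P Q) R) f = nn_integral P f + nn_integral Q f + nn_integral R f"
    if P: "sets P = sets (restrict_space borel \<Omega>)" and Q: "sets Q = sets (restrict_space borel \<Omega>)"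
      and R: "sets R = sets (restrict_space borel \<Omega>)" for P Q R
  proof -
    have fP: "f \<in> borel_measurable P" using f unfolding measurable_cong_sets[OF P refl] .
    then have "f \<in> borel_measurable (add_measure P Q)"
      unfolding measurable_cong_sets[OF sets_add_measure refl] .
    then have "nn_integral (add_measure (add_measure P Q) R) f = nn_integral (add_measure P Q) f + nn_integral R f"
      by (rule nn_integral_add_measure) (simp add: P R)
    also have "nn_integral (add_measure P Q) f = nn_integral P f + nn_integral Q f"
      using fP by (rule nn_integral_add_measure) (simp add: P Q)
    finally show ?thesis .
  qed
  ultimately show ?thesis unfolding \<rho>_def[symmetric] by (metis (no_types) S)
qed

section \<open>Estimates for the kernel\<close>

text \<open>Here \<open>d\<close>, \<open>e\<close>, \<open>r\<close> stand for the boundary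
  distances of \<open>x\<close> and \<open>y\<close> and for their mutual distance, and \<kappa> for
  \<open>N - 2 * s\<close>. The weighted power of the kernel is reduced to terms that a Riesz
  potential with boundary weight can integrate. If \<open>0 \<le> \<alpha>\<close>, the weight is
  bounded through \<open>d \<le> e + r\<close>; if \<open>\<alpha> < 0\<close>, the decay factor
  \<open>min (d / r) 1\<close> absorbs as much of the singular weight as it can.\<close>

lemma green_weight_pointwise_le:
  fixes N \<kappa> \<gamma> \<gamma>' p \<alpha> R :: real
  assumes \<gamma>: "0 \<le> \<gamma>'" "\<gamma>' \<le> \<gamma>" and \<kappa>: "0 < \<kappa>" and p: "1 \<le> p" and R: "1 \<le> R"
    and c1: "p * (\<kappa> + \<gamma>') < N + \<alpha>" and c2: "p * \<kappa> < N" and c3: "- 1 < p * \<gamma> + \<alpha>"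
  shows "\<exists>K b \<beta> b'. 0 \<le> K \<and> 0 \<le> \<beta> \<and> \<beta> < 1 \<and> b + \<beta> < N \<and> b' < N \<and>
    (\<forall>d e r. 0 < d \<longrightarrow> 0 < e \<longrightarrow> e \<le> R \<longrightarrow> 0 < r \<longrightarrow> d \<le> e + r \<longrightarrow>
      (r powr (- \<kappa>) * min (d / r) 1 powr \<gamma> * min (e / r) 1 powr \<gamma> * e powr (- \<gamma>')) powr p * d powr \<alpha>
        \<le> K * (r powr (- b) * d powr (- \<beta>) + r powr (- b')))"
proof -
  define X where "X d e r = (r powr (- \<kappa>) * min (d / r) 1 powr \<gamma> * min (e / r) 1 powr \<gamma> * e powr (- \<gamma>')) powr p * d powr \<alpha>"
    for d e r :: real
  have Xeq: "X d e r = r powr (- (\<kappa> * p)) * min (d / r) 1 powr (\<gamma> * p) * (min (e / r) 1 powr (\<gamma> * p) * e powr (- (\<gamma>' * p))) * d powr \<alpha>"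
    if "0 < d" "0 < e" "0 < r" for d e r
    using that unfolding X_def by (simp add: powr_mult powr_powr mult_ac)
  \<comment> \<open>The factor \<open>e powr (- \<gamma>')\<close> is absorbed by
    \<open>min (e / r) 1\<close>, whose exponent may be lowered from \<gamma> to \<gamma>' because
    its base is at most 1.\<close>
  have my: "min (e / r) 1 powr (\<gamma> * p) * e powr (- (\<gamma>' * p)) \<le> r powr (- (\<gamma>' * p))" if e: "0 < e" and r: "0 < r" for e r
  proof -
    have "min (e / r) 1 powr (\<gamma> * p) \<le> min (e / r) 1 powr (\<gamma>' * p)"
      using e r \<gamma> p by (intro powr_mono' mult_right_mono) auto
    also have "\<dots> \<le> (e / r) powr (\<gamma>' * p)" using e r \<gamma> p by (intro powr_mono2) auto
    finally have "min (e / r) 1 powr (\<gamma> * p) * e powr (- (\<gamma>' * p)) \<le> (e / r) powr (\<gamma>' * p) * e powr (- (\<gamma>' * p))"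
      by (intro mult_right_mono) auto
    also have "\<dots> = r powr (- (\<gamma>' * p))" using e r by (simp add: powr_divide powr_minus field_simps)
    finally show ?thesis .
  qed
  have m1: "min t 1 powr c \<le> 1" if "0 < t" "0 \<le> c" for t c :: real
    using that by (intro powr_le1) auto
  have Xle: "X d e r \<le> r powr (- (\<kappa> * p)) * min (d / r) 1 powr (\<gamma> * p) * r powr (- (\<gamma>' * p)) * d powr \<alpha>"
    if "0 < d" "0 < e" "0 < r" for d e r
    unfolding Xeq[OF that] using my[OF that(2,3)] by (intro mult_right_mono mult_left_mono) auto
  \<comment> \<open>The homogeneous exponent: the singularity that remains when the whole weight is
    counted as a power of \<open>r\<close>. The hypothesis \<open>c1\<close> says exactly
    \<open>b0 < N\<close>.\<close>
  define b0 where "b0 = (\<kappa> + \<gamma>') * p - \<alpha>"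
  have b0: "b0 < N" using c1 by (simp add: b0_def algebra_simps)
  show ?thesis
    unfolding X_def[symmetric]
  proof (cases "0 \<le> \<alpha>")
    case True
    define K where "K = 2 powr \<alpha> * (1 + R powr \<bar>\<alpha> - \<gamma>' * p\<bar>)"
    have K: "2 powr \<alpha> \<le> K" "2 powr \<alpha> * R powr \<bar>\<alpha> - \<gamma>' * p\<bar> \<le> K" "0 \<le> K"
      by (auto simp: K_def distrib_left)
    have "X d e r \<le> K * (r powr (- b0) * d powr (- 0) + r powr (- (\<kappa> * p)))"
      if d: "0 < d" and e: "0 < e" "e \<le> R" and r: "0 < r" and le: "d \<le> e + r" for d e r
    proof (cases "e \<le> r")
      case er: True
      have "d powr \<alpha> \<le> (2 * r) powr \<alpha>" using d le er True by (intro powr_mono2) auto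
      also have "\<dots> = 2 powr \<alpha> * r powr \<alpha>" using r by (simp add: powr_mult)
      finally have da: "d powr \<alpha> \<le> 2 powr \<alpha> * r powr \<alpha>" .
      have "X d e r \<le> r powr (- (\<kappa> * p)) * 1 * r powr (- (\<gamma>' * p)) * (2 powr \<alpha> * r powr \<alpha>)"
        using m1[of "d / r" "\<gamma> * p"] d r \<gamma> p
        by (intro order_trans[OF Xle[OF d e(1) r]] mult_mono da) auto
      also have "\<dots> = 2 powr \<alpha> * r powr (- b0)"
        unfolding b0_def by (simp add: powr_add[symmetric] algebra_simps)
      also have "\<dots> \<le> K * (r powr (- b0) * d powr (- 0) + r powr (- (\<kappa> * p)))"
        using K d by (intro mult_mono) auto
      finally show ?thesis .
    next
      case er: False
      have "d powr \<alpha> \<le> (2 * e) powr \<alpha>" using d le er True by (intro powr_mono2) auto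
      also have "\<dots> = 2 powr \<alpha> * e powr \<alpha>" using e by (simp add: powr_mult)
      finally have da: "d powr \<alpha> \<le> 2 powr \<alpha> * e powr \<alpha>" .
      have "X d e r \<le> r powr (- (\<kappa> * p)) * 1 * (1 * e powr (- (\<gamma>' * p))) * (2 powr \<alpha> * e powr \<alpha>)"
        unfolding Xeq[OF d e(1) r] using m1[of "d / r" "\<gamma> * p"] m1[of "e / r" "\<gamma> * p"] d r e \<gamma> p
        by (intro mult_mono da) auto
      also have "\<dots> = 2 powr \<alpha> * (r powr (- (\<kappa> * p)) * e powr (\<alpha> - \<gamma>' * p))"
        by (simp add: powr_add[symmetric] algebra_simps)
      also have "r powr (- (\<kappa> * p)) * e powr (\<alpha> - \<gamma>' * p)
          \<le> r powr (- b0) + R powr \<bar>\<alpha> - \<gamma>' * p\<bar> * r powr (- (\<kappa> * p))"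
      \<comment> \<open>With a nonnegative exponent the power of \<open>e\<close> is bounded and the
        singularity \<open>\<kappa> * p\<close> remains, which \<open>c2\<close> makes integrable.
        With a negative one, \<open>r < e\<close> turns it into a power of \<open>r\<close> and
        gives \<open>b0\<close> again.\<close>
      proof (cases "0 \<le> \<alpha> - \<gamma>' * p")
        case True
        then have "e powr (\<alpha> - \<gamma>' * p) \<le> R powr \<bar>\<alpha> - \<gamma>' * p\<bar>" using e by (simp add: powr_mono2)
        then have "r powr (- (\<kappa> * p)) * e powr (\<alpha> - \<gamma>' * p) \<le> r powr (- (\<kappa> * p)) * R powr \<bar>\<alpha> - \<gamma>' * p\<bar>"
          by (intro mult_left_mono) auto
        then show ?thesis by (rule order_trans) simp
      next
        case False
        then have "e powr (\<alpha> - \<gamma>' * p) \<le> r powr (\<alpha> - \<gamma>' * p)" using e r er by (intro powr_mono2') auto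
        then have "r powr (- (\<kappa> * p)) * e powr (\<alpha> - \<gamma>' * p) \<le> r powr (- (\<kappa> * p)) * r powr (\<alpha> - \<gamma>' * p)"
          by (intro mult_left_mono) auto
        also have "\<dots> = r powr (- b0)" unfolding b0_def by (simp add: powr_add[symmetric] algebra_simps)
        finally show ?thesis by (simp add: add_increasing2)
      qed
      also have "2 powr \<alpha> * (r powr (- b0) + R powr \<bar>\<alpha> - \<gamma>' * p\<bar> * r powr (- (\<kappa> * p)))
          = 2 powr \<alpha> * r powr (- b0) + (2 powr \<alpha> * R powr \<bar>\<alpha> - \<gamma>' * p\<bar>) * r powr (- (\<kappa> * p))"
        by (simp add: algebra_simps)
      also have "\<dots> \<le> K * r powr (- b0) + K * r powr (- (\<kappa> * p))"
        using K by (intro add_mono mult_right_mono) auto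
      also have "\<dots> = K * (r powr (- b0) * d powr (- 0) + r powr (- (\<kappa> * p)))"
        using d by (simp add: distrib_left)
      finally show ?thesis by simp
    qed
    moreover have "\<kappa> * p < N" using c2 by (simp add: mult.commute)
    ultimately show "\<exists>K b \<beta> b'. 0 \<le> K \<and> 0 \<le> \<beta> \<and> \<beta> < 1 \<and> b + \<beta> < N \<and> b' < N \<and>
        (\<forall>d e r. 0 < d \<longrightarrow> 0 < e \<longrightarrow> e \<le> R \<longrightarrow> 0 < r \<longrightarrow> d \<le> e + r \<longrightarrow>
          X d e r \<le> K * (r powr (- b) * d powr (- \<beta>) + r powr (- b')))"
      using K(3) b0 by (intro exI[of _ K] exI[of _ b0] exI[of _ 0] exI[of _ "\<kappa> * p"]) auto
  next
    case \<alpha>: False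
    show "\<exists>K b \<beta> b'. 0 \<le> K \<and> 0 \<le> \<beta> \<and> \<beta> < 1 \<and> b + \<beta> < N \<and> b' < N \<and>
        (\<forall>d e r. 0 < d \<longrightarrow> 0 < e \<longrightarrow> e \<le> R \<longrightarrow> 0 < r \<longrightarrow> d \<le> e + r \<longrightarrow>
          X d e r \<le> K * (r powr (- b) * d powr (- \<beta>) + r powr (- b')))"
    proof (cases "0 \<le> p * \<gamma> + \<alpha>")
      case True
      have "X d e r \<le> 1 * (r powr (- b0) * d powr (- 0) + r powr (- b0))"
        if d: "0 < d" and e: "0 < e" and r: "0 < r" for d e r
      proof -
        have "min (d / r) 1 powr (\<gamma> * p) \<le> min (d / r) 1 powr (- \<alpha>)"
          using d r True by (intro powr_mono') (auto simp: mult.commute)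
        also have "\<dots> \<le> (d / r) powr (- \<alpha>)" using d r \<alpha> by (intro powr_mono2) auto
        finally have "min (d / r) 1 powr (\<gamma> * p) * d powr \<alpha> \<le> (d / r) powr (- \<alpha>) * d powr \<alpha>"
          by (intro mult_right_mono) auto
        also have "\<dots> = r powr \<alpha>" using d r by (simp add: powr_divide powr_minus field_simps)
        finally have *: "min (d / r) 1 powr (\<gamma> * p) * d powr \<alpha> \<le> r powr \<alpha>" .
        have "X d e r \<le> r powr (- (\<kappa> * p)) * r powr (- (\<gamma>' * p)) * (min (d / r) 1 powr (\<gamma> * p) * d powr \<alpha>)"
          using Xle[OF d e r] by (simp add: mult_ac)
        also have "\<dots> \<le> r powr (- (\<kappa> * p)) * r powr (- (\<gamma>' * p)) * r powr \<alpha>"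
          using * by (intro mult_left_mono) auto
        also have "\<dots> = r powr (- b0)" unfolding b0_def by (simp add: powr_add[symmetric] algebra_simps)
        finally have "X d e r \<le> r powr (- b0)" .
        moreover have "0 \<le> r powr (- b0)" by simp
        ultimately have "X d e r \<le> r powr (- b0) + r powr (- b0)" by linarith
        then show ?thesis using d by simp
      qed
      then show ?thesis
        using b0 by (intro exI[of _ 1] exI[of _ b0] exI[of _ 0] exI[of _ b0]) auto
    next
      case False
      \<comment> \<open>The part of the weight that the decay factor cannot absorb. Since
        \<open>b + \<beta> = b0\<close>, the total singularity is still governed by
        \<open>c1\<close>, and \<open>c3\<close> says \<open>\<beta> < 1\<close>.\<close>
      define \<beta> where "\<beta> = - (p * \<gamma> + \<alpha>)"
      define b where "b = (\<kappa> + \<gamma>' + \<gamma>) * p"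
      have "X d e r \<le> 1 * (r powr (- b) * d powr (- \<beta>) + r powr (- b0))"
        if d: "0 < d" and e: "0 < e" and r: "0 < r" for d e r
      proof -
        have "min (d / r) 1 powr (\<gamma> * p) \<le> (d / r) powr (\<gamma> * p)" using d r \<gamma> p by (intro powr_mono2) auto
        then have "min (d / r) 1 powr (\<gamma> * p) * d powr \<alpha> \<le> (d / r) powr (\<gamma> * p) * d powr \<alpha>"
          by (intro mult_right_mono) auto
        also have "\<dots> = r powr (- (\<gamma> * p)) * (d powr (\<gamma> * p) * d powr \<alpha>)"
          using d r by (simp add: powr_divide powr_minus field_simps)
        also have "d powr (\<gamma> * p) * d powr \<alpha> = d powr (- \<beta>)"
          by (simp add: \<beta>_def powr_add[symmetric] mult.commute)
        finally have *: "min (d / r) 1 powr (\<gamma> * p) * d powr \<alpha> \<le> r powr (- (\<gamma> * p)) * d powr (- \<beta>)" .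
        have "X d e r \<le> r powr (- (\<kappa> * p)) * r powr (- (\<gamma>' * p)) * (min (d / r) 1 powr (\<gamma> * p) * d powr \<alpha>)"
          using Xle[OF d e r] by (simp add: mult_ac)
        also have "\<dots> \<le> r powr (- (\<kappa> * p)) * r powr (- (\<gamma>' * p)) * (r powr (- (\<gamma> * p)) * d powr (- \<beta>))"
          using * by (intro mult_left_mono) auto
        also have "\<dots> = (r powr (- (\<kappa> * p)) * r powr (- (\<gamma>' * p)) * r powr (- (\<gamma> * p))) * d powr (- \<beta>)"
          by (simp add: mult.assoc)
        also have "r powr (- (\<kappa> * p)) * r powr (- (\<gamma>' * p)) * r powr (- (\<gamma> * p)) = r powr (- b)"
          unfolding b_def by (simp add: powr_add[symmetric] algebra_simps)
        finally show ?thesis by (simp add: add_increasing2)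
      qed
      moreover have "b + \<beta> < N" using b0 by (simp add: b_def \<beta>_def b0_def algebra_simps)
      moreover have "0 \<le> \<beta>" "\<beta> < 1" using False c3 by (auto simp: \<beta>_def)
      ultimately show ?thesis
        using b0 by (intro exI[of _ 1] exI[of _ b] exI[of _ \<beta>] exI[of _ b0]) auto
    qed
  qed
qed

section \<open>The quotient of the kernel by the weight: measurability and uniform bounds\<close>

text \<open>The value 0 off \<open>offdiag \<Omega>\<close> replaces the unconstrained values of
  \<open>G\<close>, so that the quotient is a nonnegative Borel function on the whole product
  space.\<close>

definition green_quot :: "'a::euclidean_space set \<Rightarrow> real \<Rightarrow> ('a \<Rightarrow> 'a \<Rightarrow> real) \<Rightarrow> 'a \<Rightarrow> 'a \<Rightarrow> real" where
  "green_quot \<Omega> \<gamma>' G x y = (if (x, y) \<in> offdiag \<Omega> then G x y / bdist \<Omega> y powr \<gamma>' else 0)"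

lemma green_quot_nonneg: "green_G1 \<Omega> s \<gamma> G \<Longrightarrow> 0 \<le> green_quot \<Omega> \<gamma>' G x y"
  unfolding green_quot_def green_G1_def by fastforce

lemma green_quot_le:
  fixes \<Omega> :: "'a::euclidean_space set"
  assumes G1: "green_G1 \<Omega> s \<gamma> G"
  shows "\<exists>C>0. \<forall>x\<in>\<Omega>. \<forall>y\<in>\<Omega>. x \<noteq> y \<longrightarrow> green_quot \<Omega> \<gamma>' G x y \<le> C *
    (dist x y powr (- (real DIM('a) - 2 * s)) * min (bdist \<Omega> x / dist x y) 1 powr \<gamma>
      * min (bdist \<Omega> y / dist x y) 1 powr \<gamma> * bdist \<Omega> y powr (- \<gamma>'))"
proof -
  obtain C where C: "0 < C" "\<And>x y. (x, y) \<in> offdiag \<Omega> \<Longrightarrow> G x y \<le> C * (1 / dist x y powr (real DIM('a) - 2 * s)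
              * min (bdist \<Omega> x / dist x y) 1 powr \<gamma> * min (bdist \<Omega> y / dist x y) 1 powr \<gamma>)"
  proof -
    obtain C where "0 < C" and C: "\<forall>(x, y) \<in> offdiag \<Omega>.
      let K = 1 / dist x y powr (real DIM('a) - 2 * s)
              * min (bdist \<Omega> x / dist x y) 1 powr \<gamma> * min (bdist \<Omega> y / dist x y) 1 powr \<gamma>
      in 1 / C * K \<le> G x y \<and> G x y \<le> C * K"
      using G1 unfolding green_G1_def by (elim conjE exE)
    show thesis
    proof (rule that)
      fix x y assume "(x, y) \<in> offdiag \<Omega>"
      with C show "G x y \<le> C * (1 / dist x y powr (real DIM('a) - 2 * s)
              * min (bdist \<Omega> x / dist x y) 1 powr \<gamma> * min (bdist \<Omega> y / dist x y) 1 powr \<gamma>)"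
        unfolding Let_def by (auto dest: bspec)
    qed fact
  qed
  have "green_quot \<Omega> \<gamma>' G x y \<le> C *
    (dist x y powr (- (real DIM('a) - 2 * s)) * min (bdist \<Omega> x / dist x y) 1 powr \<gamma>
      * min (bdist \<Omega> y / dist x y) 1 powr \<gamma> * bdist \<Omega> y powr (- \<gamma>'))" if "x \<in> \<Omega>" "y \<in> \<Omega>" "x \<noteq> y" for x y
  proof -
    have o: "(x, y) \<in> offdiag \<Omega>" using that by (simp add: offdiag_def)
    have "green_quot \<Omega> \<gamma>' G x y = G x y * bdist \<Omega> y powr (- \<gamma>')"
      using o by (simp add: green_quot_def powr_minus divide_inverse)
    also have "\<dots> \<le> C * (1 / dist x y powr (real DIM('a) - 2 * s)
              * min (bdist \<Omega> x / dist x y) 1 powr \<gamma> * min (bdist \<Omega> y / dist x y) 1 powr \<gamma>) * bdist \<Omega> y powr (- \<gamma>')"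
      using C(2)[OF o] by (intro mult_right_mono) auto
    also have "1 / dist x y powr (real DIM('a) - 2 * s) = dist x y powr (- (real DIM('a) - 2 * s))"
      by (simp only: powr_minus_divide)
    finally show ?thesis by (simp only: mult.assoc)
  qed
  with C(1) show ?thesis by blast
qed

text \<open>Joint measurability is what Tonelli's theorem will require. As
  \<open>offdiag \<Omega>\<close> is open, extension by 0 keeps the measurability given on the
  restricted space.\<close>

lemma borel_measurable_green_quot:
  fixes \<Omega> :: "'a::euclidean_space set"
  assumes G1: "green_G1 \<Omega> s \<gamma> G" and op: "open \<Omega>"
  shows "(\<lambda>z. green_quot \<Omega> \<gamma>' G (fst z) (snd z)) \<in> borel_measurable (borel \<Otimes>\<^sub>M borel)"
proof -
  have "offdiag \<Omega> = (\<Omega> \<times> \<Omega>) \<inter> {z. fst z \<noteq> snd z}" by (auto simp: offdiag_def)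
  also have "open \<dots>" using op by (intro open_Int open_Times open_Collect_neq continuous_intros)
  finally have [measurable]: "offdiag \<Omega> \<in> sets borel" by simp
  have "(\<lambda>(x, y). G x y) \<in> borel_measurable (restrict_space borel (offdiag \<Omega>))"
    using G1 unfolding green_G1_def by simp
  then have *: "(\<lambda>z. if z \<in> offdiag \<Omega> then (case z of (x, y) \<Rightarrow> G x y) else 0) \<in> borel_measurable borel"
    by (subst (asm) measurable_restrict_space_iff[where c = 0]) auto
  have "continuous_on UNIV (\<lambda>z :: 'a \<times> 'a. bdist \<Omega> (snd z))"
    unfolding bdist_def by (intro continuous_intros)
  then have [measurable]: "(\<lambda>z :: 'a \<times> 'a. bdist \<Omega> (snd z)) \<in> borel_measurable borel"
    by (rule borel_measurable_continuous_onI)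
  note *[measurable]
  have "(\<lambda>z. (if z \<in> offdiag \<Omega> then (case z of (x, y) \<Rightarrow> G x y) else 0) / bdist \<Omega> (snd z) powr \<gamma>')
      \<in> borel_measurable (borel :: ('a \<times> 'a) measure)"
    by measurable
  also have "(\<lambda>z. (if z \<in> offdiag \<Omega> then (case z of (x, y) \<Rightarrow> G x y) else 0) / bdist \<Omega> (snd z) powr \<gamma>')
      = (\<lambda>z. green_quot \<Omega> \<gamma>' G (fst z) (snd z))"
    by (auto simp: green_quot_def fun_eq_iff)
  finally show ?thesis by (simp add: borel_prod)
qed

lemma borel_measurable_green_quot_left:
  assumes G1: "green_G1 \<Omega> s \<gamma> G" and op: "open \<Omega>"
  shows "(\<lambda>x. green_quot \<Omega> \<gamma>' G x y) \<in> borel_measurable borel"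
    and "(\<lambda>y. green_quot \<Omega> \<gamma>' G x y) \<in> borel_measurable borel"
proof -
  note * = borel_measurable_green_quot[OF G1 op, of \<gamma>']
  have "(\<lambda>x. (x, y)) \<in> borel \<rightarrow>\<^sub>M borel \<Otimes>\<^sub>M borel" by measurable
  from measurable_compose[OF this *] show "(\<lambda>x. green_quot \<Omega> \<gamma>' G x y) \<in> borel_measurable borel" by simp
  have "(\<lambda>y. (x, y)) \<in> borel \<rightarrow>\<^sub>M borel \<Otimes>\<^sub>M borel" by measurable
  from measurable_compose[OF this *] show "(\<lambda>y. green_quot \<Omega> \<gamma>' G x y) \<in> borel_measurable borel" by simp
qed

lemma bdist_le_bound:
  fixes \<Omega> :: "'a::euclidean_space set"
  assumes op: "open \<Omega>" and bd: "bounded \<Omega>"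
  obtains R where "1 \<le> R" "\<And>x. bdist \<Omega> x \<le> R"
proof -
  obtain B where B: "\<And>x. x \<in> \<Omega> \<Longrightarrow> norm x \<le> B" using bd bounded_iff by metis
  obtain w where w: "w \<notin> \<Omega>" using bounded_neq_UNIV[OF bd] by auto
  have "bdist \<Omega> x \<le> max 1 (B + norm w)" for x
  proof (cases "x \<in> \<Omega>")
    case True
    have "bdist \<Omega> x \<le> dist x w" unfolding bdist_def using w by (intro infdist_le) simp
    also have "\<dots> \<le> norm x + norm w" unfolding dist_norm by (rule norm_triangle_ineq4)
    finally show ?thesis using B[OF True] by simp
  qed (simp add: bdist_eq_0)
  then show ?thesis using that[of "max 1 (B + norm w)"] by simp
qed

text \<open>The pointwise bound is integrated by two Riesz potentials, one with boundary exponent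
  \<beta> and one without. The exponents \<open>p\<close> and \<alpha> are free because the bound
  serves several times: for the exponents of the target space, for a larger power, and for a smaller
  weight exponent.\<close>

lemma green_quot_weighted_bounded:
  fixes \<Omega> :: "'a::euclidean_space set"
  assumes \<Omega>: "C2_domain \<Omega>" and bd: "bounded \<Omega>" and G1: "green_G1 \<Omega> s \<gamma> G"
    and \<gamma>': "0 \<le> \<gamma>'" "\<gamma>' \<le> \<gamma>" and p: "1 \<le> p"
    and c1: "p * (real DIM('a) - 2 * s + \<gamma>') < real DIM('a) + \<alpha>"
    and c2: "p * (real DIM('a) - 2 * s) < real DIM('a)" and c3: "- 1 < p * \<gamma> + \<alpha>"
  shows "\<exists>B\<ge>0. \<forall>y\<in>\<Omega>. (\<integral>\<^sup>+x\<in>\<Omega>. ennreal (green_quot \<Omega> \<gamma>' G x y powr p * bdist \<Omega> x powr \<alpha>) \<partial>lborel) \<le> ennreal B"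
proof -
  have op: "open \<Omega>" using \<Omega> unfolding C2_domain_def by simp
  have \<Omega>m[measurable]: "\<Omega> \<in> sets borel" using op by simp
  note \<delta>pos = bdist_pos[OF op bounded_neq_UNIV[OF bd]]
  obtain R where R: "1 \<le> R" "\<And>x. bdist \<Omega> x \<le> R" using bdist_le_bound[OF op bd] by blast
  define \<kappa> where "\<kappa> = real DIM('a) - 2 * s"
  have \<kappa>: "0 < \<kappa>" using G1 by (simp add: green_G1_def \<kappa>_def)
  obtain C where C: "0 < C" "\<And>x y. x \<in> \<Omega> \<Longrightarrow> y \<in> \<Omega> \<Longrightarrow> x \<noteq> y \<Longrightarrow> green_quot \<Omega> \<gamma>' G x y \<le> C *
    (dist x y powr (- \<kappa>) * min (bdist \<Omega> x / dist x y) 1 powr \<gamma>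
      * min (bdist \<Omega> y / dist x y) 1 powr \<gamma> * bdist \<Omega> y powr (- \<gamma>'))"
    using green_quot_le[OF G1, of \<gamma>'] unfolding \<kappa>_def by blast
  obtain K b \<beta> b' where K: "0 \<le> K" "0 \<le> \<beta>" "\<beta> < 1" "b + \<beta> < real DIM('a)" "b' < real DIM('a)"
    and K': "\<And>d e r. 0 < d \<Longrightarrow> 0 < e \<Longrightarrow> e \<le> R \<Longrightarrow> 0 < r \<Longrightarrow> d \<le> e + r \<Longrightarrow>
      (r powr (- \<kappa>) * min (d / r) 1 powr \<gamma> * min (e / r) 1 powr \<gamma> * e powr (- \<gamma>')) powr p * d powr \<alpha>
        \<le> K * (r powr (- b) * d powr (- \<beta>) + r powr (- b'))"
    using green_weight_pointwise_le[OF \<gamma>' \<kappa> p R(1) _ _ c3] c1 c2 unfolding \<kappa>_def by metis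
  obtain B1 where B1: "0 \<le> B1" "\<And>y. y \<in> \<Omega> \<Longrightarrow>
      (\<integral>\<^sup>+x\<in>\<Omega>. ennreal (dist x y powr (- b) * bdist \<Omega> x powr (- \<beta>)) \<partial>lborel) \<le> ennreal B1"
    using riesz_potential_boundary_weight_bounded[OF \<Omega> bd K(2-4)] by blast
  \<comment> \<open>The exponent \<open>- 0\<close> is kept so that the second term has the shape of
    the Riesz estimate with \<open>\<beta> = 0\<close>; on \<Omega> this factor equals 1.\<close>
  obtain B2 where B2: "0 \<le> B2" "\<And>y. y \<in> \<Omega> \<Longrightarrow>
      (\<integral>\<^sup>+x\<in>\<Omega>. ennreal (dist x y powr (- b') * bdist \<Omega> x powr (- 0)) \<partial>lborel) \<le> ennreal B2"
    using riesz_potential_boundary_weight_bounded[OF \<Omega> bd, of 0 b'] K(5) by auto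
  define A where "A = C powr p * K"
  have A: "0 \<le> A" unfolding A_def using K by simp
  have "(\<integral>\<^sup>+x\<in>\<Omega>. ennreal (green_quot \<Omega> \<gamma>' G x y powr p * bdist \<Omega> x powr \<alpha>) \<partial>lborel) \<le> ennreal (A * (B1 + B2))"
    if y: "y \<in> \<Omega>" for y
  proof -
    have pt: "ennreal (green_quot \<Omega> \<gamma>' G x y powr p * bdist \<Omega> x powr \<alpha>) * indicator \<Omega> x
      \<le> ennreal A * (ennreal (dist x y powr (- b) * bdist \<Omega> x powr (- \<beta>)) * indicator \<Omega> x
          + ennreal (dist x y powr (- b') * bdist \<Omega> x powr (- 0)) * indicator \<Omega> x)" for x
    proof (cases "x \<in> \<Omega> \<and> x \<noteq> y")
      case True
      then have x: "x \<in> \<Omega>" "x \<noteq> y" by auto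
      define r where "r = dist x y"
      have r: "0 < r" using x by (simp add: r_def)
      have dle: "bdist \<Omega> x \<le> bdist \<Omega> y + r" unfolding r_def by (rule bdist_triangle)
      define T where "T = r powr (- \<kappa>) * min (bdist \<Omega> x / r) 1 powr \<gamma> * min (bdist \<Omega> y / r) 1 powr \<gamma> * bdist \<Omega> y powr (- \<gamma>')"
      have "0 \<le> T" unfolding T_def by simp
      have "green_quot \<Omega> \<gamma>' G x y powr p \<le> (C * T) powr p"
        using C(2)[OF x(1) y x(2)] green_quot_nonneg[OF G1] p unfolding T_def r_def by (intro powr_mono2) auto
      also have "\<dots> = C powr p * T powr p" using C(1) \<open>0 \<le> T\<close> by (simp add: powr_mult)
      finally have "green_quot \<Omega> \<gamma>' G x y powr p * bdist \<Omega> x powr \<alpha> \<le> C powr p * (T powr p * bdist \<Omega> x powr \<alpha>)"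
        unfolding mult.assoc[symmetric] by (intro mult_right_mono) auto
      also have "\<dots> \<le> C powr p * (K * (r powr (- b) * bdist \<Omega> x powr (- \<beta>) + r powr (- b')))"
        using K'[OF \<delta>pos[OF x(1)] \<delta>pos[OF y] R(2) r dle] unfolding T_def by (intro mult_left_mono) auto
      also have "\<dots> = A * (r powr (- b) * bdist \<Omega> x powr (- \<beta>) + r powr (- b') * bdist \<Omega> x powr (- 0))"
        using \<delta>pos[OF x(1)] by (simp add: A_def mult.assoc)
      finally show ?thesis
        using x A by (simp add: r_def ennreal_leI flip: ennreal_plus ennreal_mult' del: powr_zero_eq_one)
    next
      case False
      then show ?thesis by (auto simp: green_quot_def offdiag_def indicator_def)
    qed
    have [measurable]: "(\<lambda>x. dist x y) \<in> borel_measurable borel"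
      by (intro borel_measurable_continuous_onI continuous_intros)
    have "(\<integral>\<^sup>+x\<in>\<Omega>. ennreal (green_quot \<Omega> \<gamma>' G x y powr p * bdist \<Omega> x powr \<alpha>) \<partial>lborel)
      \<le> (\<integral>\<^sup>+x. ennreal A * (ennreal (dist x y powr (- b) * bdist \<Omega> x powr (- \<beta>)) * indicator \<Omega> x
          + ennreal (dist x y powr (- b') * bdist \<Omega> x powr (- 0)) * indicator \<Omega> x) \<partial>lborel)"
      using pt by (intro nn_integral_mono) simp
    also have "\<dots> = ennreal A * ((\<integral>\<^sup>+x\<in>\<Omega>. ennreal (dist x y powr (- b) * bdist \<Omega> x powr (- \<beta>)) \<partial>lborel)
        + (\<integral>\<^sup>+x\<in>\<Omega>. ennreal (dist x y powr (- b') * bdist \<Omega> x powr (- 0)) \<partial>lborel))"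
      by (subst nn_integral_cmult, measurable, subst nn_integral_add, measurable)
    also have "\<dots> \<le> ennreal A * (ennreal B1 + ennreal B2)"
      using B1(2)[OF y] B2(2)[OF y] by (intro mult_left_mono add_mono) auto
    also have "\<dots> = ennreal (A * (B1 + B2))" using A B1(1) B2(1) by (simp add: ennreal_mult)
    finally show ?thesis .
  qed
  moreover have "0 \<le> A * (B1 + B2)" using A B1(1) B2(1) by simp
  ultimately show ?thesis by blast
qed

section \<open>Limits and oscillation of the columns\<close>

lemma abs_diff_powr_le:
  fixes a b p :: real
  assumes "1 \<le> p" "0 \<le> a" "0 \<le> b"
  shows "\<bar>a - b\<bar> powr p \<le> 2 powr p * (a powr p + b powr p)"
proof -
  have "\<bar>a - b\<bar> powr p \<le> (a + b) powr p" using assms by (intro powr_mono2) auto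
  also have "\<dots> \<le> 2 powr p * (a powr p + b powr p)" using assms by (rule powr_add_le)
  finally show ?thesis .
qed

lemma nn_integral_abs_diff_powr_le:
  fixes g g' w :: "'b \<Rightarrow> real"
  assumes p: "1 \<le> p" and pos: "\<And>x. 0 \<le> g x" "\<And>x. 0 \<le> g' x" "\<And>x. 0 \<le> w x"
    and [measurable]: "g \<in> borel_measurable M" "g' \<in> borel_measurable M" "w \<in> borel_measurable M" "S \<in> sets M"
    and B: "0 \<le> B" "(\<integral>\<^sup>+x\<in>S. ennreal (g x powr p * w x) \<partial>M) \<le> ennreal B"
      "(\<integral>\<^sup>+x\<in>S. ennreal (g' x powr p * w x) \<partial>M) \<le> ennreal B"
  shows "(\<integral>\<^sup>+x\<in>S. ennreal (\<bar>g x - g' x\<bar> powr p * w x) \<partial>M) \<le> ennreal (2 powr p * (2 * B))"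
proof -
  have "(\<integral>\<^sup>+x\<in>S. ennreal (\<bar>g x - g' x\<bar> powr p * w x) \<partial>M)
      \<le> (\<integral>\<^sup>+x. ennreal (2 powr p) * (ennreal (g x powr p * w x) * indicator S x
          + ennreal (g' x powr p * w x) * indicator S x) \<partial>M)"
  proof (intro nn_integral_mono)
    fix x
    have "\<bar>g x - g' x\<bar> powr p * w x \<le> 2 powr p * (g x powr p + g' x powr p) * w x"
      using abs_diff_powr_le[OF p pos(1,2)] pos(3) by (intro mult_right_mono)
    also have "\<dots> = 2 powr p * (g x powr p * w x + g' x powr p * w x)" by (simp add: algebra_simps)
    finally have "ennreal (\<bar>g x - g' x\<bar> powr p * w x) \<le> ennreal (2 powr p * (g x powr p * w x + g' x powr p * w x))"
      by (rule ennreal_leI)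
    also have "\<dots> = ennreal (2 powr p) * (ennreal (g x powr p * w x) + ennreal (g' x powr p * w x))"
      using pos(3)[of x] by (simp add: ennreal_mult')
    finally show "ennreal (\<bar>g x - g' x\<bar> powr p * w x) * indicator S x
        \<le> ennreal (2 powr p) * (ennreal (g x powr p * w x) * indicator S x + ennreal (g' x powr p * w x) * indicator S x)"
      by (simp add: indicator_def)
  qed
  also have "\<dots> = ennreal (2 powr p) * ((\<integral>\<^sup>+x\<in>S. ennreal (g x powr p * w x) \<partial>M)
      + (\<integral>\<^sup>+x\<in>S. ennreal (g' x powr p * w x) \<partial>M))"
    by (subst nn_integral_cmult, measurable, subst nn_integral_add, measurable)
  also have "\<dots> \<le> ennreal (2 powr p) * (ennreal B + ennreal B)"
    using B by (intro mult_left_mono add_mono) auto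
  also have "\<dots> = ennreal (2 powr p * (2 * B))"
    using B(1) by (simp add: ennreal_mult' flip: ennreal_plus)
  finally show ?thesis .
qed

text \<open>The limit \<open>l\<close> only serves to make \<open>g x (Y n) - g x (Y' n)\<close> tend to 0 for any two sequences
  converging to the same point \<open>z\<close> of the closure.\<close>

lemma green_quot_limit:
  fixes \<Omega> :: "'a::euclidean_space set"
  assumes op: "open \<Omega>" and bd: "bounded \<Omega>" and G1: "green_G1 \<Omega> s \<gamma> G" and G2: "green_G2 \<Omega> G"
    and \<gamma>': "0 \<le> \<gamma>'" "\<gamma>' < \<gamma> \<or> \<gamma>' = \<gamma> \<and> green_G3 \<Omega> \<gamma> G"
    and z: "z \<in> closure \<Omega>" and x: "x \<in> \<Omega>" "x \<noteq> z"
  shows "\<exists>l. \<forall>Y :: nat \<Rightarrow> 'a. (\<forall>n. Y n \<in> \<Omega>) \<longrightarrow> Y \<longlonglongrightarrow> z \<longrightarrow> (\<lambda>n. green_quot \<Omega> \<gamma>' G x (Y n)) \<longlonglongrightarrow> l"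
proof -
  note \<delta>pos = bdist_pos[OF op bounded_neq_UNIV[OF bd]]
  have ev_ne: "\<forall>\<^sub>F n in sequentially. Y n \<noteq> x" if "Y \<longlonglongrightarrow> z" for Y :: "nat \<Rightarrow> 'a"
    using that x(2) by (intro tendsto_imp_eventually_ne) auto
  have \<delta>lim: "(\<lambda>n. bdist \<Omega> (Y n)) \<longlonglongrightarrow> bdist \<Omega> z" if "Y \<longlonglongrightarrow> z" for Y :: "nat \<Rightarrow> 'a"
    unfolding bdist_def using that by (rule tendsto_infdist)
  have quot: "green_quot \<Omega> \<gamma>' G x y = G x y / bdist \<Omega> y powr \<gamma>'" if "y \<in> \<Omega>" "y \<noteq> x" for y
    using that x by (simp add: green_quot_def offdiag_def)
  show ?thesis
  proof (cases "z \<in> \<Omega>")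
    case True
    have "offdiag \<Omega> = (\<Omega> \<times> \<Omega>) \<inter> {z. fst z \<noteq> snd z}" by (auto simp: offdiag_def)
    also have "open \<dots>" using op by (intro open_Int open_Times open_Collect_neq continuous_intros)
    finally have oo: "open (offdiag \<Omega>)" .
    have "(x, z) \<in> offdiag \<Omega>" using x True by (simp add: offdiag_def)
    then have "isCont (\<lambda>(x, y). G x y) (x, z)"
      using G2 oo unfolding green_G2_def by (simp add: continuous_on_eq_continuous_at)
    have "(\<lambda>n. green_quot \<Omega> \<gamma>' G x (Y n)) \<longlonglongrightarrow> G x z / bdist \<Omega> z powr \<gamma>'"
      if Y: "\<forall>n. Y n \<in> \<Omega>" "Y \<longlonglongrightarrow> z" for Y :: "nat \<Rightarrow> 'a"
    proof -
      have "(\<lambda>n. (x, Y n)) \<longlonglongrightarrow> (x, z)" using Y(2) by (intro tendsto_Pair tendsto_const)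
      from isCont_tendsto_compose[OF \<open>isCont _ _\<close> this] have "(\<lambda>n. G x (Y n)) \<longlonglongrightarrow> G x z" by simp
      then have "(\<lambda>n. G x (Y n) / bdist \<Omega> (Y n) powr \<gamma>') \<longlonglongrightarrow> G x z / bdist \<Omega> z powr \<gamma>'"
        using \<delta>lim[OF Y(2)] \<delta>pos[OF True] by (intro tendsto_intros) auto
      moreover have "\<forall>\<^sub>F n in sequentially. G x (Y n) / bdist \<Omega> (Y n) powr \<gamma>' = green_quot \<Omega> \<gamma>' G x (Y n)"
        using ev_ne[OF Y(2)] by eventually_elim (use Y(1) quot in simp)
      ultimately show ?thesis by (rule Lim_transform_eventually)
    qed
    then show ?thesis by blast
  next
    case False
    then have zf: "z \<in> frontier \<Omega>" using z op by (simp add: frontier_def interior_open)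
    have \<delta>z: "bdist \<Omega> z = 0" using False by (rule bdist_eq_0)
    from \<gamma>'(2) show ?thesis
    proof
      assume lt: "\<gamma>' < \<gamma>"
      define \<kappa> where "\<kappa> = real DIM('a) - 2 * s"
      have \<gamma>0: "0 < \<gamma>" using G1 by (simp add: green_G1_def)
      obtain C where C: "0 < C" "\<And>x y. x \<in> \<Omega> \<Longrightarrow> y \<in> \<Omega> \<Longrightarrow> x \<noteq> y \<Longrightarrow> green_quot \<Omega> \<gamma>' G x y \<le> C *
        (dist x y powr (- \<kappa>) * min (bdist \<Omega> x / dist x y) 1 powr \<gamma>
          * min (bdist \<Omega> y / dist x y) 1 powr \<gamma> * bdist \<Omega> y powr (- \<gamma>'))"
        using green_quot_le[OF G1, of \<gamma>'] unfolding \<kappa>_def by blast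
      have "(\<lambda>n. green_quot \<Omega> \<gamma>' G x (Y n)) \<longlonglongrightarrow> 0"
        if Y: "\<forall>n. Y n \<in> \<Omega>" "Y \<longlonglongrightarrow> z" for Y :: "nat \<Rightarrow> 'a"
      proof (rule tendsto_sandwich[OF _ _ tendsto_const])
        show "\<forall>\<^sub>F n in sequentially. 0 \<le> green_quot \<Omega> \<gamma>' G x (Y n)"
          using green_quot_nonneg[OF G1] by simp
        \<comment> \<open>The decay in \<open>y\<close> contributes the power \<gamma> of the
          boundary distance and the quotient takes away \<gamma>'; the positive power left over
          forces the limit 0, since \<open>x\<close> stays away from \<open>z\<close>.\<close>
        show "\<forall>\<^sub>F n in sequentially. green_quot \<Omega> \<gamma>' G x (Y n)
            \<le> C * (dist x (Y n) powr (- \<kappa>) * dist x (Y n) powr (- \<gamma>) * bdist \<Omega> (Y n) powr (\<gamma> - \<gamma>'))"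
          using ev_ne[OF Y(2)]
        proof eventually_elim
          case (elim n)
          define r e where "r = dist x (Y n)" and "e = bdist \<Omega> (Y n)"
          have r: "0 < r" using elim by (simp add: r_def dist_commute)
          have e: "0 < e" using Y(1) \<delta>pos by (simp add: e_def)
          have dx: "0 < bdist \<Omega> x" using \<delta>pos x by simp
          have "green_quot \<Omega> \<gamma>' G x (Y n) \<le> C * (r powr (- \<kappa>) * min (bdist \<Omega> x / r) 1 powr \<gamma>
              * min (e / r) 1 powr \<gamma> * e powr (- \<gamma>'))"
            unfolding r_def e_def using C(2)[OF x(1)] Y(1) elim by simp
          also have "\<dots> \<le> C * (r powr (- \<kappa>) * 1 * (e / r) powr \<gamma> * e powr (- \<gamma>'))"
            using C(1) r e dx \<gamma>0 by (intro mult_left_mono mult_right_mono mult_mono powr_mono2 powr_le1) auto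
          also have "\<dots> = C * (r powr (- \<kappa>) * r powr (- \<gamma>) * e powr (\<gamma> - \<gamma>'))"
            using r e by (simp add: powr_divide powr_minus powr_diff field_simps)
          finally show ?case unfolding r_def e_def .
        qed
        have "(\<lambda>n. C * (dist x (Y n) powr (- \<kappa>) * dist x (Y n) powr (- \<gamma>) * bdist \<Omega> (Y n) powr (\<gamma> - \<gamma>')))
            \<longlonglongrightarrow> C * (dist x z powr (- \<kappa>) * dist x z powr (- \<gamma>) * 0 powr (\<gamma> - \<gamma>'))"
          using Y(2) x(2) lt \<delta>lim[OF Y(2)] \<delta>z bdist_nonneg[of \<Omega>]
          by (intro tendsto_mult tendsto_const tendsto_powr tendsto_powr' tendsto_dist) auto
        then show "(\<lambda>n. C * (dist x (Y n) powr (- \<kappa>) * dist x (Y n) powr (- \<gamma>) * bdist \<Omega> (Y n) powr (\<gamma> - \<gamma>')))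
            \<longlonglongrightarrow> 0" by simp
      qed
      then show ?thesis by blast
    next
      assume G3: "\<gamma>' = \<gamma> \<and> green_G3 \<Omega> \<gamma> G"
      then obtain M :: "'a \<Rightarrow> 'a \<Rightarrow> real" where
        "\<forall>x\<^sub>0\<in>\<Omega>. \<forall>z\<^sub>0\<in>frontier \<Omega>. 0 < M x\<^sub>0 z\<^sub>0 \<and>
          ((\<lambda>(x, y). G x y / bdist \<Omega> y powr \<gamma>) \<longlongrightarrow> M x\<^sub>0 z\<^sub>0) (at (x\<^sub>0, z\<^sub>0) within offdiag \<Omega>)"
        unfolding green_G3_def by (elim conjE exE)
      then have M: "((\<lambda>(x, y). G x y / bdist \<Omega> y powr \<gamma>) \<longlongrightarrow> M x z) (at (x, z) within offdiag \<Omega>)"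
        using x(1) zf by simp
      have "(\<lambda>n. green_quot \<Omega> \<gamma>' G x (Y n)) \<longlonglongrightarrow> M x z"
        if Y: "\<forall>n. Y n \<in> \<Omega>" "Y \<longlonglongrightarrow> z" for Y :: "nat \<Rightarrow> 'a"
      proof -
        \<comment> \<open>The joint limit of (G3) is taken along pairs whose first component is
          frozen at \<open>x\<close>.\<close>
        have "(\<lambda>n. (x, Y n)) \<longlonglongrightarrow> (x, z)" using Y(2) by (intro tendsto_Pair tendsto_const)
        moreover have "\<forall>\<^sub>F n in sequentially. (x, Y n) \<in> offdiag \<Omega> \<and> (x, Y n) \<noteq> (x, z)"
          using ev_ne[OF Y(2)] by eventually_elim (use Y(1) x False in \<open>auto simp: offdiag_def\<close>)
        ultimately have "filterlim (\<lambda>n. (x, Y n)) (at (x, z) within offdiag \<Omega>) sequentially"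
          unfolding filterlim_at by (simp add: eventually_mono)
        from filterlim_compose[OF M this] have "(\<lambda>n. G x (Y n) / bdist \<Omega> (Y n) powr \<gamma>) \<longlonglongrightarrow> M x z" by simp
        moreover have "\<forall>\<^sub>F n in sequentially. G x (Y n) / bdist \<Omega> (Y n) powr \<gamma> = green_quot \<Omega> \<gamma>' G x (Y n)"
          using ev_ne[OF Y(2)] by eventually_elim (use Y(1) quot G3 in simp)
        ultimately show ?thesis by (rule Lim_transform_eventually)
      qed
      then show ?thesis by blast
    qed
  qed
qed

text \<open>If the oscillation stayed above \<epsilon> in every ball around \<open>z\<close>, two
  sequences tending to \<open>z\<close> would have columns with differences \<open>f n\<close>
  bounded away from 0 in the mean. But \<open>f n\<close> tends to 0 almost everywhere, and the two
  uniform bounds make it almost dominated.\<close>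

lemma green_quot_local_oscillation:
  fixes \<Omega> :: "'a::euclidean_space set"
  assumes \<Omega>: "C2_domain \<Omega>" and bd: "bounded \<Omega>" and G1: "green_G1 \<Omega> s \<gamma> G" and G2: "green_G2 \<Omega> G"
    and \<gamma>': "0 \<le> \<gamma>'" "\<gamma>' < \<gamma> \<or> \<gamma>' = \<gamma> \<and> green_G3 \<Omega> \<gamma> G" and q: "1 \<le> q"
    and c1: "q * (real DIM('a) - 2 * s + \<gamma>') < real DIM('a) + \<alpha>"
    and c2: "q * (real DIM('a) - 2 * s) < real DIM('a)" and c3: "- 1 < q * \<gamma> + \<alpha>"
    and z: "z \<in> closure \<Omega>" and \<epsilon>: "0 < \<epsilon>"
  shows "\<exists>r>0. \<forall>y\<in>\<Omega> \<inter> ball z r. \<forall>y'\<in>\<Omega> \<inter> ball z r.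
    (\<integral>\<^sup>+x\<in>\<Omega>. ennreal (\<bar>green_quot \<Omega> \<gamma>' G x y - green_quot \<Omega> \<gamma>' G x y'\<bar> powr q * bdist \<Omega> x powr \<alpha>) \<partial>lborel) \<le> ennreal \<epsilon>"
proof (rule ccontr)
  assume neg: "\<not> ?thesis"
  have op: "open \<Omega>" using \<Omega> unfolding C2_domain_def by simp
  have \<Omega>m[measurable]: "\<Omega> \<in> sets borel" using op by simp
  note \<delta>pos = bdist_pos[OF op bounded_neq_UNIV[OF bd]]
  define g where "g = green_quot \<Omega> \<gamma>' G"
  have g0: "0 \<le> g x y" for x y unfolding g_def by (rule green_quot_nonneg[OF G1])
  have [measurable]: "(\<lambda>x. g x y) \<in> borel_measurable borel" for y
    unfolding g_def by (rule borel_measurable_green_quot_left[OF G1 op])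
  have g\<gamma>: "\<gamma>' \<le> \<gamma>" using \<gamma>'(2) by auto
  have \<kappa>: "0 < real DIM('a) - 2 * s" using G1 by (simp add: green_G1_def)
  obtain y y' where yy: "\<And>n :: nat. y n \<in> \<Omega> \<inter> ball z (1 / Suc n)" "\<And>n :: nat. y' n \<in> \<Omega> \<inter> ball z (1 / Suc n)"
    "\<And>n :: nat. \<not> (\<integral>\<^sup>+x\<in>\<Omega>. ennreal (\<bar>g x (y n) - g x (y' n)\<bar> powr q * bdist \<Omega> x powr \<alpha>) \<partial>lborel) \<le> ennreal \<epsilon>"
  proof -
    define P where "P n w \<longleftrightarrow> fst w \<in> \<Omega> \<inter> ball z (1 / Suc n) \<and> snd w \<in> \<Omega> \<inter> ball z (1 / Suc n) \<and>
      \<not> (\<integral>\<^sup>+x\<in>\<Omega>. ennreal (\<bar>g x (fst w) - g x (snd w)\<bar> powr q * bdist \<Omega> x powr \<alpha>) \<partial>lborel) \<le> ennreal \<epsilon>"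
      for n :: nat and w :: "'a \<times> 'a"
    have "\<exists>w. P n w" for n
    proof -
      have "0 < 1 / real (Suc n)" by simp
      then obtain a b where "a \<in> \<Omega> \<inter> ball z (1 / Suc n)" "b \<in> \<Omega> \<inter> ball z (1 / Suc n)"
        "\<not> (\<integral>\<^sup>+x\<in>\<Omega>. ennreal (\<bar>g x a - g x b\<bar> powr q * bdist \<Omega> x powr \<alpha>) \<partial>lborel) \<le> ennreal \<epsilon>"
        using neg unfolding g_def by (meson Int_iff)
      then show ?thesis unfolding P_def by (intro exI[of _ "(a, b)"]) simp
    qed
    then obtain w where w: "\<And>n. P n (w n)" by metis
    show thesis
      by (rule that[of "\<lambda>n. fst (w n)" "\<lambda>n. snd (w n)"]) (use w[unfolded P_def] in blast)+
  qed
  have to_z: "Y \<longlonglongrightarrow> z" if "\<And>n. Y n \<in> \<Omega> \<inter> ball z (1 / Suc n)" for Y :: "nat \<Rightarrow> 'a"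
  proof (rule metric_tendsto_imp_tendsto)
    show "(\<lambda>n. 1 / real (Suc n)) \<longlonglongrightarrow> 0" using LIMSEQ_inverse_real_of_nat by (simp add: inverse_eq_divide)
    show "\<forall>\<^sub>F n in sequentially. dist (Y n) z \<le> dist (1 / real (Suc n)) 0"
      using that by (intro always_eventually allI) (auto simp: dist_commute less_imp_le)
  qed
  \<comment> \<open>The hypotheses are open conditions, so they leave room for a slightly larger exponent and a slightly
    smaller weight exponent.\<close>
  define \<tau> where "\<tau> = Min {(real DIM('a) + \<alpha> - q * (real DIM('a) - 2 * s + \<gamma>')) / (2 * (real DIM('a) - 2 * s + \<gamma>')),
    (real DIM('a) - q * (real DIM('a) - 2 * s)) / (2 * (real DIM('a) - 2 * s))}"
  define \<eta> where "\<eta> = min ((real DIM('a) + \<alpha> - q * (real DIM('a) - 2 * s + \<gamma>')) / 2) ((q * \<gamma> + \<alpha> + 1) / 2)"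
  define p where "p = q + \<tau>"
  have \<tau>: "0 < \<tau>" unfolding \<tau>_def using c1 c2 \<kappa> \<gamma>'(1) by simp
  have \<eta>: "0 < \<eta>" unfolding \<eta>_def using c1 c3 by simp
  have t1: "\<tau> * (real DIM('a) - 2 * s + \<gamma>') < real DIM('a) + \<alpha> - q * (real DIM('a) - 2 * s + \<gamma>')"
  proof -
    have pos: "0 < real DIM('a) - 2 * s + \<gamma>'" using \<kappa> \<gamma>'(1) by linarith
    have "\<tau> \<le> (real DIM('a) + \<alpha> - q * (real DIM('a) - 2 * s + \<gamma>')) / (2 * (real DIM('a) - 2 * s + \<gamma>'))"
      unfolding \<tau>_def by simp
    then have "\<tau> * (2 * (real DIM('a) - 2 * s + \<gamma>')) \<le> real DIM('a) + \<alpha> - q * (real DIM('a) - 2 * s + \<gamma>')"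
      using pos by (subst (asm) pos_le_divide_eq) auto
    then show ?thesis using mult_pos_pos[OF \<tau> pos] by linarith
  qed
  have t2: "\<tau> * (real DIM('a) - 2 * s) < real DIM('a) - q * (real DIM('a) - 2 * s)"
  proof -
    have "\<tau> \<le> (real DIM('a) - q * (real DIM('a) - 2 * s)) / (2 * (real DIM('a) - 2 * s))"
      unfolding \<tau>_def by simp
    then have "\<tau> * (2 * (real DIM('a) - 2 * s)) \<le> real DIM('a) - q * (real DIM('a) - 2 * s)"
      using \<kappa> by (subst (asm) pos_le_divide_eq) auto
    then show ?thesis using mult_pos_pos[OF \<tau> \<kappa>] by linarith
  qed
  have \<gamma>0: "0 < \<gamma>" using G1 by (simp add: green_G1_def)
  have p1: "1 \<le> p" "q < p" using q \<tau> by (auto simp: p_def)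
  have e1: "p * (real DIM('a) - 2 * s + \<gamma>') < real DIM('a) + \<alpha>"
    using t1 unfolding p_def distrib_right by linarith
  have e2: "p * (real DIM('a) - 2 * s) < real DIM('a)"
    using t2 unfolding p_def distrib_right by linarith
  have e3: "- 1 < p * \<gamma> + \<alpha>" using c3 mult_pos_pos[OF \<tau> \<gamma>0] unfolding p_def distrib_right by linarith
  have f1: "q * (real DIM('a) - 2 * s + \<gamma>') < real DIM('a) + (\<alpha> - \<eta>)" and f3: "- 1 < q * \<gamma> + (\<alpha> - \<eta>)"
    using c1 c3 unfolding \<eta>_def by (auto simp: min_def field_simps)
  obtain B1 where B1: "0 \<le> B1" "\<And>y. y \<in> \<Omega> \<Longrightarrow>
      (\<integral>\<^sup>+x\<in>\<Omega>. ennreal (g x y powr p * bdist \<Omega> x powr \<alpha>) \<partial>lborel) \<le> ennreal B1"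
    using green_quot_weighted_bounded[OF \<Omega> bd G1 \<gamma>'(1) g\<gamma> p1(1) e1 e2 e3] unfolding g_def by blast
  obtain B2 where B2: "0 \<le> B2" "\<And>y. y \<in> \<Omega> \<Longrightarrow>
      (\<integral>\<^sup>+x\<in>\<Omega>. ennreal (g x y powr q * bdist \<Omega> x powr (\<alpha> - \<eta>)) \<partial>lborel) \<le> ennreal B2"
    using green_quot_weighted_bounded[OF \<Omega> bd G1 \<gamma>'(1) g\<gamma> q f1 c2 f3] unfolding g_def by blast
  obtain R where R: "1 \<le> R" "\<And>x. bdist \<Omega> x \<le> R" using bdist_le_bound[OF op bd] by blast
  define f where "f n x = \<bar>g x (y n) - g x (y' n)\<bar>" for n x
  have [measurable]: "f n \<in> borel_measurable borel" for n unfolding f_def[abs_def] by measurable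
  have D1: "(\<integral>\<^sup>+x\<in>\<Omega>. ennreal (f n x powr p * bdist \<Omega> x powr \<alpha>) \<partial>lborel) \<le> ennreal (2 powr p * (2 * B1))" for n
    unfolding f_def using yy(1,2)[of n] by (intro nn_integral_abs_diff_powr_le p1 B1 g0) auto
  have D2: "(\<integral>\<^sup>+x\<in>\<Omega>. ennreal (f n x powr q * bdist \<Omega> x powr (\<alpha> - \<eta>)) \<partial>lborel) \<le> ennreal (2 powr q * (2 * B2))" for n
    unfolding f_def using yy(1,2)[of n] by (intro nn_integral_abs_diff_powr_le q B2 g0) auto
  have "(\<lambda>n. \<integral>\<^sup>+x. ennreal (f n x powr q * bdist \<Omega> x powr \<alpha>) * indicator \<Omega> x \<partial>lborel) \<longlonglongrightarrow> 0"
  proof (rule nn_integral_tendsto_0_of_almost_dominated)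
    \<comment> \<open>At \<open>x = z\<close> itself the columns need not converge, but a point is a
      null set.\<close>
    have "AE x in lborel. x \<noteq> z" by (rule AE_lborel_singleton)
    then show "AE x in lborel. (\<lambda>n. ennreal (f n x powr q * bdist \<Omega> x powr \<alpha>) * indicator \<Omega> x) \<longlonglongrightarrow> 0"
    proof eventually_elim
      case (elim x)
      show ?case
      proof (cases "x \<in> \<Omega>")
        case True
        obtain l where l: "\<And>Y. (\<forall>n. Y n \<in> \<Omega>) \<Longrightarrow> Y \<longlonglongrightarrow> z \<Longrightarrow> (\<lambda>n. g x (Y n)) \<longlonglongrightarrow> l"
          using green_quot_limit[OF op bd G1 G2 \<gamma>' z True elim] unfolding g_def by blast
        have "(\<lambda>n. g x (y n)) \<longlonglongrightarrow> l" using yy(1) to_z[OF yy(1)] by (intro l) auto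
        moreover have "(\<lambda>n. g x (y' n)) \<longlonglongrightarrow> l" using yy(2) to_z[OF yy(2)] by (intro l) auto
        ultimately have "(\<lambda>n. f n x) \<longlonglongrightarrow> \<bar>l - l\<bar>" unfolding f_def by (intro tendsto_rabs tendsto_diff)
        then have "(\<lambda>n. f n x powr q * bdist \<Omega> x powr \<alpha>) \<longlonglongrightarrow> 0 powr q * bdist \<Omega> x powr \<alpha>"
          using q by (intro tendsto_mult tendsto_const tendsto_powr') (auto simp: f_def)
        then have "(\<lambda>n. ennreal (f n x powr q * bdist \<Omega> x powr \<alpha>)) \<longlonglongrightarrow> ennreal 0"
          by (intro tendsto_ennrealI) simp
        then show ?thesis using True by simp
      qed simp
    qed
  next
    fix e :: real assume e: "0 < e"
    \<comment> \<open>The added 1 keeps the constants positive, since they are divided by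
      next.\<close>
    define P Q where "P = 2 powr p * (2 * B1) + 1" and "Q = 2 powr q * (2 * B2) + 1"
    have PQ: "0 < P" "0 < Q" "2 powr p * (2 * B1) \<le> P" "2 powr q * (2 * B2) \<le> Q"
      using B1(1) B2(1) by (auto simp: P_def Q_def intro!: add_nonneg_pos)
    \<comment> \<open>Both parameters are solved from the error budget: the layer of width
      \<open>t\<close> and the region where \<open>f n\<close> exceeds \<open>m\<close> each
      contribute at most \<open>e / 2\<close>. As \<open>q - p\<close> is negative, a small error
      means a large \<open>m\<close>.\<close>
    define t where "t = (e / (2 * Q)) powr (1 / \<eta>)"
    define m where "m = (e / (2 * P)) powr (1 / (q - p))"
    have t: "0 < t" "t powr \<eta> * Q = e / 2" using e PQ \<eta> by (auto simp: t_def powr_powr field_simps)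
    have m: "0 < m" "m powr (q - p) * P = e / 2" using e PQ p1 by (auto simp: m_def powr_powr field_simps)
    define H where "H x = ennreal (m powr q * (t powr \<alpha> + R powr \<alpha>)) * indicator \<Omega> x" for x
    define S where "S n x = ennreal (t powr \<eta>) * (ennreal (f n x powr q * bdist \<Omega> x powr (\<alpha> - \<eta>)) * indicator \<Omega> x)
      + ennreal (m powr (q - p)) * (ennreal (f n x powr p * bdist \<Omega> x powr \<alpha>) * indicator \<Omega> x)" for n x
    have "emeasure lborel \<Omega> < \<infinity>" using emeasure_bounded_finite[OF bd] by simp
    then have H: "(\<integral>\<^sup>+x. H x \<partial>lborel) < \<infinity>"
      unfolding H_def by (simp add: nn_integral_cmult ennreal_mult_less_top)
    have Sint: "(\<integral>\<^sup>+x. S n x \<partial>lborel) \<le> ennreal e" for n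
    proof -
      have "(\<integral>\<^sup>+x. S n x \<partial>lborel)
        = ennreal (t powr \<eta>) * (\<integral>\<^sup>+x\<in>\<Omega>. ennreal (f n x powr q * bdist \<Omega> x powr (\<alpha> - \<eta>)) \<partial>lborel)
          + ennreal (m powr (q - p)) * (\<integral>\<^sup>+x\<in>\<Omega>. ennreal (f n x powr p * bdist \<Omega> x powr \<alpha>) \<partial>lborel)"
        unfolding S_def by (subst nn_integral_add, measurable) (simp add: nn_integral_cmult)
      also have "\<dots> \<le> ennreal (t powr \<eta>) * ennreal Q + ennreal (m powr (q - p)) * ennreal P"
        using D1[of n] D2[of n] PQ
        by (intro add_mono mult_left_mono) (auto intro: order_trans ennreal_leI)
      also have "\<dots> = ennreal (e / 2) + ennreal (e / 2)"
      proof -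
        have "ennreal (t powr \<eta>) * ennreal Q = ennreal (e / 2)"
          unfolding t(2)[symmetric] by (rule ennreal_mult'[symmetric]) simp
        moreover have "ennreal (m powr (q - p)) * ennreal P = ennreal (e / 2)"
          unfolding m(2)[symmetric] by (rule ennreal_mult'[symmetric]) simp
        ultimately show ?thesis by simp
      qed
      also have "\<dots> = ennreal e" using e by (simp flip: ennreal_plus)
      finally show ?thesis .
    qed
    have dom: "ennreal (f n x powr q * bdist \<Omega> x powr \<alpha>) * indicator \<Omega> x \<le> H x + S n x" for n x
    proof (cases "x \<in> \<Omega>")
      case True
      define d where "d = bdist \<Omega> x"
      have d: "0 < d" "d \<le> R" using \<delta>pos[OF True] R by (auto simp: d_def)
      have f0: "0 \<le> f n x" by (simp add: f_def)
      \<comment> \<open>In the layer the gain is \<open>t powr \<eta>\<close>; above the level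
        \<open>m\<close> it is \<open>m powr (q - p)\<close>. Where neither holds,
        \<open>f n\<close> and the weight are bounded, and
        \<open>t powr \<alpha> + R powr \<alpha>\<close> covers both signs of \<alpha>.\<close>
      consider "d < t" | "t \<le> d" "f n x \<le> m" | "m < f n x" by linarith
      then show ?thesis
      proof cases
        case 1
        have "d powr \<alpha> = d powr \<eta> * d powr (\<alpha> - \<eta>)" by (simp add: powr_add[symmetric])
        also have "\<dots> \<le> t powr \<eta> * d powr (\<alpha> - \<eta>)" using 1 d \<eta> by (intro mult_right_mono powr_mono2) auto
        finally have "f n x powr q * d powr \<alpha> \<le> f n x powr q * (t powr \<eta> * d powr (\<alpha> - \<eta>))"
          by (intro mult_left_mono) auto
        also have "\<dots> = t powr \<eta> * (f n x powr q * d powr (\<alpha> - \<eta>))" by simp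
        finally have "ennreal (f n x powr q * d powr \<alpha>) \<le> ennreal (t powr \<eta>) * ennreal (f n x powr q * d powr (\<alpha> - \<eta>))"
          by (simp add: ennreal_leI flip: ennreal_mult')
        then show ?thesis using True unfolding S_def d_def by (simp add: add_increasing add_increasing2)
      next
        case 2
        have "d powr \<alpha> \<le> t powr \<alpha> + R powr \<alpha>"
        proof (cases "0 \<le> \<alpha>")
          case True
          then have "d powr \<alpha> \<le> R powr \<alpha>" using d by (intro powr_mono2) auto
          then show ?thesis by (simp add: add_increasing)
        next
          case False
          then have "d powr \<alpha> \<le> t powr \<alpha>" using 2 t by (intro powr_mono2') auto
          then show ?thesis by (simp add: add_increasing2)
        qed
        then have "f n x powr q * d powr \<alpha> \<le> m powr q * (t powr \<alpha> + R powr \<alpha>)"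
          using 2 f0 q by (intro mult_mono powr_mono2) auto
        then have "ennreal (f n x powr q * d powr \<alpha>) \<le> ennreal (m powr q * (t powr \<alpha> + R powr \<alpha>))"
          by (rule ennreal_leI)
        then show ?thesis using True unfolding H_def d_def by (simp add: add_increasing2)
      next
        case 3
        have "f n x powr q = f n x powr (q - p) * f n x powr p" by (simp add: powr_add[symmetric])
        also have "\<dots> \<le> m powr (q - p) * f n x powr p"
          using 3 m p1 by (intro mult_right_mono powr_mono2') auto
        finally have "f n x powr q * d powr \<alpha> \<le> m powr (q - p) * f n x powr p * d powr \<alpha>"
          by (intro mult_right_mono) auto
        then have "ennreal (f n x powr q * d powr \<alpha>) \<le> ennreal (m powr (q - p)) * ennreal (f n x powr p * d powr \<alpha>)"
          by (simp add: mult.assoc ennreal_leI flip: ennreal_mult')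
        then show ?thesis using True unfolding S_def d_def by (simp add: add_increasing add_increasing2)
      qed
    qed simp
    have Hm: "H \<in> borel_measurable lborel" unfolding H_def[abs_def] by measurable
    have Sm: "S n \<in> borel_measurable lborel" for n unfolding S_def[abs_def] by measurable
    show "\<exists>H S. H \<in> borel_measurable lborel \<and> (\<integral>\<^sup>+x. H x \<partial>lborel) < \<infinity> \<and>
      (\<forall>n. S n \<in> borel_measurable lborel \<and> (\<integral>\<^sup>+x. S n x \<partial>lborel) \<le> ennreal e \<and>
        (\<forall>x. ennreal (f n x powr q * bdist \<Omega> x powr \<alpha>) * indicator \<Omega> x \<le> H x + S n x))"
      by (rule exI[of _ H], rule exI[of _ S]) (intro conjI allI Hm H Sm Sint dom)
  qed measurable
  then have "\<forall>\<^sub>F n in sequentially. (\<integral>\<^sup>+x\<in>\<Omega>. ennreal (f n x powr q * bdist \<Omega> x powr \<alpha>) \<partial>lborel) < ennreal \<epsilon>"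
    using \<epsilon> by (intro order_tendstoD(2)) auto
  then obtain n where "(\<integral>\<^sup>+x\<in>\<Omega>. ennreal (f n x powr q * bdist \<Omega> x powr \<alpha>) \<partial>lborel) < ennreal \<epsilon>"
    by (auto simp: eventually_sequentially)
  with yy(3)[of n] show False unfolding f_def by simp
qed

section \<open>Weighted Lebesgue spaces\<close>

text \<open>The density is placed on the completed measure, so that \<open>Lp_fun\<close> of it
  coincides with \<open>Lq_space\<close>, whose members are merely Lebesgue measurable.\<close>

definition weighted_lebesgue :: "'a::euclidean_space set \<Rightarrow> real \<Rightarrow> 'a measure" where
  "weighted_lebesgue \<Omega> \<alpha> = density (lebesgue_on \<Omega>) (\<lambda>x. ennreal (bdist \<Omega> x powr \<alpha>))"

lemma borel_measurable_lebesgue_onI: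
  "f \<in> borel_measurable borel \<Longrightarrow> f \<in> borel_measurable (lebesgue_on \<Omega>)"
  by (intro measurable_restrict_space1 measurable_completion) simp

lemma measurable_weighted_lebesgue:
  "borel_measurable (weighted_lebesgue \<Omega> \<alpha>) = borel_measurable (lebesgue_on \<Omega>)"
  by (rule measurable_cong_sets) (simp_all add: weighted_lebesgue_def)

lemma nn_integral_weighted_lebesgue:
  assumes "\<Omega> \<in> sets borel" "f \<in> borel_measurable (lebesgue_on \<Omega>)"
  shows "(\<integral>\<^sup>+x. f x \<partial>weighted_lebesgue \<Omega> \<alpha>) = (\<integral>\<^sup>+x\<in>\<Omega>. ennreal (bdist \<Omega> x powr \<alpha>) * f x \<partial>lebesgue)"
proof -
  have "(\<integral>\<^sup>+x. f x \<partial>weighted_lebesgue \<Omega> \<alpha>) = (\<integral>\<^sup>+x. ennreal (bdist \<Omega> x powr \<alpha>) * f x \<partial>lebesgue_on \<Omega>)"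
    unfolding weighted_lebesgue_def
    by (intro nn_integral_density assms borel_measurable_lebesgue_onI) measurable
  also have "\<dots> = (\<integral>\<^sup>+x\<in>\<Omega>. ennreal (bdist \<Omega> x powr \<alpha>) * f x \<partial>lebesgue)"
    using assms by (intro nn_integral_restrict_space) simp
  finally show ?thesis .
qed

text \<open>For Borel integrands the completion does not matter; this leads back to
  \<open>lborel\<close>, where the kernel estimates and Tonelli's theorem live.\<close>

lemma nn_integral_weighted_lebesgue_borel:
  assumes \<Omega>: "\<Omega> \<in> sets borel" and f: "f \<in> borel_measurable borel" and pos: "\<And>x. 0 \<le> f x"
  shows "(\<integral>\<^sup>+x. ennreal (f x) \<partial>weighted_lebesgue \<Omega> \<alpha>) = (\<integral>\<^sup>+x\<in>\<Omega>. ennreal (f x * bdist \<Omega> x powr \<alpha>) \<partial>lborel)"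
proof -
  note [measurable] = \<Omega> f
  have "(\<integral>\<^sup>+x. ennreal (f x) \<partial>weighted_lebesgue \<Omega> \<alpha>)
      = (\<integral>\<^sup>+x\<in>\<Omega>. ennreal (bdist \<Omega> x powr \<alpha>) * ennreal (f x) \<partial>lebesgue)"
    by (intro nn_integral_weighted_lebesgue \<Omega> borel_measurable_lebesgue_onI) measurable
  also have "\<dots> = (\<integral>\<^sup>+x\<in>\<Omega>. ennreal (bdist \<Omega> x powr \<alpha>) * ennreal (f x) \<partial>lborel)"
    by (rule nn_integral_completion)
  also have "\<dots> = (\<integral>\<^sup>+x\<in>\<Omega>. ennreal (f x * bdist \<Omega> x powr \<alpha>) \<partial>lborel)"
    using pos by (simp add: ennreal_mult' mult.commute)
  finally show ?thesis .
qed

text \<open>Integrability of the power of \<open>\<bar>u\<bar>\<close> says nothing about the sign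
  of \<open>u\<close>; measurability comes from local integrability, as \<open>u\<close> is the
  pointwise limit of its restrictions to an exhaustion by compact sets.\<close>

lemma Lq_space_measurable:
  assumes op: "open \<Omega>" "bounded \<Omega>" and u: "u \<in> Lq_space \<Omega> q \<alpha>"
  shows "u \<in> borel_measurable (lebesgue_on \<Omega>)"
proof -
  obtain K where K: "\<And>n :: nat. compact (K n)" "\<And>n. K n \<subseteq> \<Omega>" "incseq K" "(\<Union>n. K n) = \<Omega>"
    using compact_exhaustion[OF op] by blast
  have m: "(\<lambda>x. indicator (K n) x *\<^sub>R u x) \<in> borel_measurable lebesgue" for n
    using u K(1,2)[of n] unfolding Lq_space_def set_integrable_def
    by (auto dest: borel_measurable_integrable)
  have "(\<lambda>x. indicator \<Omega> x *\<^sub>R u x) \<in> borel_measurable lebesgue"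
  proof (rule borel_measurable_LIMSEQ_real[OF _ m])
    fix x
    have "(\<lambda>n. indicator (K n) x :: real) \<longlonglongrightarrow> indicator (\<Union>n. K n) x"
      by (rule LIMSEQ_indicator_incseq[OF K(3)])
    then show "(\<lambda>n. indicator (K n) x *\<^sub>R u x) \<longlonglongrightarrow> indicator \<Omega> x *\<^sub>R u x"
      unfolding K(4) by (intro tendsto_intros)
  qed
  then show ?thesis using op by (subst borel_measurable_restrict_space_iff) simp_all
qed

text \<open>For \<open>0 \<le> \<alpha>\<close> the positive minimum of \<open>bdist\<close> on
  \<open>K\<close> gives the bound; for \<open>\<alpha> < 0\<close> its upper bound on all of
  \<Omega> does.\<close>

lemma bdist_powr_ge_on_compact:
  assumes op: "open \<Omega>" "bounded \<Omega>" and K: "compact K" "K \<subseteq> \<Omega>"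
  obtains c where "0 < c" "\<And>x. x \<in> K \<Longrightarrow> c \<le> bdist \<Omega> x powr \<alpha>"
proof -
  have "K \<in> rc_borel \<Omega>" using K by (rule rc_borel_compact)
  then obtain c where c: "0 < c" "\<And>x. x \<in> K \<Longrightarrow> c \<le> bdist \<Omega> x"
    using bdist_ge_on_rc_borel[OF op(1) bounded_neq_UNIV[OF op(2)]] by blast
  obtain R where R: "1 \<le> R" "\<And>x. bdist \<Omega> x \<le> R" using bdist_le_bound[OF op] by blast
  show ?thesis
  proof (rule that)
    show "0 < min (c powr \<alpha>) (R powr \<alpha>)" using c R by simp
    fix x assume x: "x \<in> K"
    show "min (c powr \<alpha>) (R powr \<alpha>) \<le> bdist \<Omega> x powr \<alpha>"
    proof (cases "0 \<le> \<alpha>")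
      case True
      then have "c powr \<alpha> \<le> bdist \<Omega> x powr \<alpha>" using c(1) c(2)[OF x] by (intro powr_mono2) auto
      then show ?thesis by simp
    next
      case False
      then have "R powr \<alpha> \<le> bdist \<Omega> x powr \<alpha>"
        using c(1) c(2)[OF x] R(2)[of x] by (intro powr_mono2') auto
      then show ?thesis by simp
    qed
  qed
qed

lemma le_one_plus_powr: "1 \<le> q \<Longrightarrow> 0 \<le> t \<Longrightarrow> t \<le> 1 + t powr q" for t q :: real
proof (cases "t \<le> 1")
  case False
  assume "1 \<le> q" "0 \<le> t"
  then have "t powr 1 \<le> t powr q" using False by (intro powr_mono) auto
  then show ?thesis using False by simp
qed (simp add: add_increasing2)

text \<open>For measurable \<open>u\<close>, the weighted condition already implies local
  integrability: \<open>\<bar>u\<bar> \<le> 1 + \<bar>u\<bar> powr q\<close>, and the weight is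
  bounded below on compact sets.\<close>

lemma Lq_space_eq_Lp_fun:
  assumes op: "open \<Omega>" "bounded \<Omega>" and q: "1 \<le> q"
  shows "Lq_space \<Omega> q \<alpha> = Lp_fun (weighted_lebesgue \<Omega> \<alpha>) q"
proof -
  have \<Omega>: "\<Omega> \<in> sets borel" using op by simp
  then have \<Omega>l: "\<Omega> \<in> sets lebesgue" by simp
  have iff: "u \<in> Lp_fun (weighted_lebesgue \<Omega> \<alpha>) q \<longleftrightarrow> (\<lambda>x. \<bar>u x\<bar> powr q * bdist \<Omega> x powr \<alpha>) absolutely_integrable_on \<Omega>"
    if u: "u \<in> borel_measurable (lebesgue_on \<Omega>)" for u
  proof -
    note [measurable] = u borel_measurable_lebesgue_onI[OF borel_measurable_bdist, of \<Omega> \<Omega>]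
    have "u \<in> Lp_fun (weighted_lebesgue \<Omega> \<alpha>) q \<longleftrightarrow> integrable (weighted_lebesgue \<Omega> \<alpha>) (\<lambda>x. \<bar>u x\<bar> powr q)"
      using u by (simp add: Lp_fun_def measurable_weighted_lebesgue)
    also have "\<dots> \<longleftrightarrow> integrable (lebesgue_on \<Omega>) (\<lambda>x. bdist \<Omega> x powr \<alpha> *\<^sub>R \<bar>u x\<bar> powr q)"
      unfolding weighted_lebesgue_def by (rule integrable_density) auto
    also have "\<dots> \<longleftrightarrow> (\<lambda>x. \<bar>u x\<bar> powr q * bdist \<Omega> x powr \<alpha>) absolutely_integrable_on \<Omega>"
      unfolding set_integrable_def using \<Omega>l by (subst integrable_restrict_space) (simp_all add: mult.commute)
    finally show ?thesis .
  qed
  show ?thesis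
  proof (rule set_eqI, rule iffI)
    fix u assume u: "u \<in> Lq_space \<Omega> q \<alpha>"
    then show "u \<in> Lp_fun (weighted_lebesgue \<Omega> \<alpha>) q"
      using iff[OF Lq_space_measurable[OF op u]] by (simp add: Lq_space_def)
  next
    fix u assume u: "u \<in> Lp_fun (weighted_lebesgue \<Omega> \<alpha>) q"
    then have um: "u \<in> borel_measurable (lebesgue_on \<Omega>)" by (simp add: Lp_fun_def measurable_weighted_lebesgue)
    have ai: "(\<lambda>x. \<bar>u x\<bar> powr q * bdist \<Omega> x powr \<alpha>) absolutely_integrable_on \<Omega>" using iff[OF um] u by simp
    have "u absolutely_integrable_on K" if K: "compact K" "K \<subseteq> \<Omega>" for K
    proof -
      obtain c where c: "0 < c" "\<And>x. x \<in> K \<Longrightarrow> c \<le> bdist \<Omega> x powr \<alpha>"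
        using bdist_powr_ge_on_compact[OF op K] by blast
      have Kb: "K \<in> sets borel" using K(1) by (simp add: compact_imp_closed borel_closed)
      show ?thesis
        unfolding set_integrable_def
      proof (rule Bochner_Integration.integrable_bound)
        have "integrable lebesgue (indicator K :: 'a \<Rightarrow> real)"
          using emeasure_bounded_finite[OF compact_imp_bounded[OF K(1)]] Kb
          by (intro integrable_real_indicator) auto
        moreover have "integrable lebesgue (\<lambda>x. indicator \<Omega> x *\<^sub>R (\<bar>u x\<bar> powr q * bdist \<Omega> x powr \<alpha>))"
          using ai unfolding set_integrable_def .
        ultimately show "integrable lebesgue (\<lambda>x. indicator K x + (1 / c) * (indicator \<Omega> x *\<^sub>R (\<bar>u x\<bar> powr q * bdist \<Omega> x powr \<alpha>)))"
          by (intro Bochner_Integration.integrable_add integrable_mult_right)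
        have "(\<lambda>x. indicator \<Omega> x *\<^sub>R u x) \<in> borel_measurable lebesgue"
          using um \<Omega>l by (subst (asm) borel_measurable_restrict_space_iff) simp_all
        from borel_measurable_scaleR[OF borel_measurable_indicator this]
        have "(\<lambda>x. indicator K x *\<^sub>R (indicator \<Omega> x *\<^sub>R u x)) \<in> borel_measurable lebesgue"
          using Kb by simp
        also have "(\<lambda>x. indicator K x *\<^sub>R (indicator \<Omega> x *\<^sub>R u x)) = (\<lambda>x. indicator K x *\<^sub>R u x)"
          using K(2) by (auto simp: indicator_def fun_eq_iff)
        finally show "(\<lambda>x. indicator K x *\<^sub>R u x) \<in> borel_measurable lebesgue" .
        show "AE x in lebesgue. norm (indicator K x *\<^sub>R u x)
          \<le> norm (indicator K x + (1 / c) * (indicator \<Omega> x *\<^sub>R (\<bar>u x\<bar> powr q * bdist \<Omega> x powr \<alpha>)))"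
        proof (rule AE_I2)
          fix x
          show "norm (indicator K x *\<^sub>R u x)
            \<le> norm (indicator K x + (1 / c) * (indicator \<Omega> x *\<^sub>R (\<bar>u x\<bar> powr q * bdist \<Omega> x powr \<alpha>)))"
          proof (cases "x \<in> K")
            case True
            have "\<bar>u x\<bar> \<le> 1 + \<bar>u x\<bar> powr q" using q by (intro le_one_plus_powr) auto
            also have "\<bar>u x\<bar> powr q \<le> (1 / c) * (\<bar>u x\<bar> powr q * bdist \<Omega> x powr \<alpha>)"
              using mult_left_mono[OF c(2)[OF True], of "\<bar>u x\<bar> powr q"] c(1) by (simp add: field_simps)
            finally show ?thesis using True K(2) c(1) by (auto simp: subset_eq)
          qed simp
        qed
      qed
    qed
    then show "u \<in> Lq_space \<Omega> q \<alpha>" unfolding Lq_space_def using ai by simp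
  qed
qed

lemma Lq_norm_eq_Lp_seminorm:
  assumes op: "open \<Omega>" and u: "u \<in> Lp_fun (weighted_lebesgue \<Omega> \<alpha>) q"
  shows "Lq_norm \<Omega> q \<alpha> u = Lp_seminorm (weighted_lebesgue \<Omega> \<alpha>) q u"
proof -
  have [measurable]: "u \<in> borel_measurable (lebesgue_on \<Omega>)" "bdist \<Omega> \<in> borel_measurable (lebesgue_on \<Omega>)"
    using u by (simp_all add: Lp_fun_def measurable_weighted_lebesgue borel_measurable_lebesgue_onI)
  have "(\<integral>x. \<bar>u x\<bar> powr q \<partial>weighted_lebesgue \<Omega> \<alpha>) = (\<integral>x. bdist \<Omega> x powr \<alpha> *\<^sub>R \<bar>u x\<bar> powr q \<partial>lebesgue_on \<Omega>)"
    unfolding weighted_lebesgue_def by (rule integral_density) auto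
  also have "\<dots> = (LINT x:\<Omega>|lebesgue. \<bar>u x\<bar> powr q * bdist \<Omega> x powr \<alpha>)"
    unfolding set_lebesgue_integral_def using op by (subst integral_restrict_space) (simp_all add: mult.commute)
  finally show ?thesis unfolding Lq_norm_def Lp_seminorm_def by simp
qed

text \<open>Completeness of the seminormed space reduces relative compactness in the topology of the
  statement to the existence of finite nets, whose points may lie outside \<open>S\<close>.\<close>

theorem relatively_compact_in_Lq_topology:
  assumes op: "open \<Omega>" "bounded \<Omega>" and q: "1 \<le> q"
    and S: "S \<subseteq> Lp_fun (weighted_lebesgue \<Omega> \<alpha>) q"
    and tb: "\<And>e. 0 < e \<Longrightarrow> \<exists>F. finite F \<and> F \<subseteq> Lp_fun (weighted_lebesgue \<Omega> \<alpha>) q \<and>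
      (\<forall>u\<in>S. \<exists>f\<in>F. Lp_seminorm (weighted_lebesgue \<Omega> \<alpha>) q (\<lambda>x. u x - f x) < e)"
  shows "relatively_compact_in (Lq_topology \<Omega> q \<alpha>) S"
proof -
  define W where "W = weighted_lebesgue \<Omega> \<alpha>"
  define L where "L = Lq_space \<Omega> q \<alpha>"
  have L: "L = Lp_fun W q" unfolding L_def W_def by (rule Lq_space_eq_Lp_fun[OF op q])
  define d where "d u v = Lq_norm \<Omega> q \<alpha> (\<lambda>x. v x - u x)" for u v
  have d_eq: "d u v = Lp_seminorm W q (\<lambda>x. u x - v x)" if "u \<in> L" "v \<in> L" for u v
    unfolding d_def W_def Lp_seminorm_minus_commute[of _ _ u]
    by (rule Lq_norm_eq_Lp_seminorm[OF op(1)])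
       (use that in \<open>auto simp: L W_def intro!: Lp_fun_diff[OF q]\<close>)
  have X: "openin (Lq_topology \<Omega> q \<alpha>) U \<longleftrightarrow> U \<subseteq> L \<and> (\<forall>u\<in>U. \<exists>r>0. \<forall>v\<in>L. d u v < r \<longrightarrow> v \<in> U)" for U
    unfolding openin_Lq_topology L_def d_def ..
  have "compactin (Lq_topology \<Omega> q \<alpha>) (Lq_topology \<Omega> q \<alpha> closure_of S)"
  proof (rule compactin_closure_of_pseudometric[where d = d and L = L])
    show "0 \<le> d x y" for x y unfolding d_def Lq_norm_def by simp
    show "d x y = d y x" for x y unfolding d_def Lq_norm_def by (simp add: abs_minus_commute)
    show "d x x = 0" for x unfolding d_def Lq_norm_def by simp
    show "d x z \<le> d x y + d y z" if "x \<in> L" "y \<in> L" "z \<in> L" for x y z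
      using Lp_seminorm_diff_triangle[OF q, of x W y z] that by (simp add: d_eq) (simp add: L)
    show "S \<subseteq> L" using S unfolding L W_def .
    show "\<exists>l\<in>L. (\<lambda>n. d (\<sigma> n) l) \<longlonglongrightarrow> 0"
      if \<sigma>: "range \<sigma> \<subseteq> L" and C: "\<forall>e>0. \<exists>N. \<forall>m\<ge>N. \<forall>n\<ge>N. d (\<sigma> m) (\<sigma> n) < e" for \<sigma> :: "nat \<Rightarrow> 'a \<Rightarrow> real"
    proof -
      have \<sigma>L: "\<sigma> n \<in> L" for n using \<sigma> by auto
      have "\<exists>l\<in>Lp_fun W q. (\<lambda>n. Lp_seminorm W q (\<lambda>x. \<sigma> n x - l x)) \<longlonglongrightarrow> 0"
      proof (rule Lp_complete[OF q])
        show "\<sigma> n \<in> Lp_fun W q" for n using \<sigma>L unfolding L .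
        show "\<exists>N. \<forall>m\<ge>N. \<forall>n\<ge>N. Lp_seminorm W q (\<lambda>x. \<sigma> m x - \<sigma> n x) < e" if "0 < e" for e
          using C[rule_format, OF that] unfolding d_eq[OF \<sigma>L \<sigma>L] .
      qed
      then obtain l where l: "l \<in> L" "(\<lambda>n. Lp_seminorm W q (\<lambda>x. \<sigma> n x - l x)) \<longlonglongrightarrow> 0" unfolding L ..
      then show ?thesis using d_eq[OF \<sigma>L l(1)] by (intro bexI[of _ l]) simp_all
    qed
    show "\<exists>F. finite F \<and> F \<subseteq> L \<and> (\<forall>s\<in>S. \<exists>f\<in>F. d s f < e)" if e: "0 < e" for e
    proof -
      obtain F where F: "finite F" "F \<subseteq> Lp_fun W q" "\<And>u. u \<in> S \<Longrightarrow> \<exists>f\<in>F. Lp_seminorm W q (\<lambda>x. u x - f x) < e"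
        using tb[OF e] unfolding W_def by blast
      have "\<exists>f\<in>F. d s f < e" if s: "s \<in> S" for s
      proof -
        obtain f where f: "f \<in> F" "Lp_seminorm W q (\<lambda>x. s x - f x) < e" using F(3)[OF s] ..
        moreover have "s \<in> L" "f \<in> L" using s S f(1) F(2) unfolding L W_def by auto
        ultimately show ?thesis using d_eq[of s f] by (intro bexI[of _ f]) simp_all
      qed
      then show ?thesis using F(1,2) unfolding L by blast
    qed
  qed (rule X)
  moreover have "openin (Lq_topology \<Omega> q \<alpha>) L" unfolding X by (auto intro: zero_less_one)
  then have "L \<subseteq> topspace (Lq_topology \<Omega> q \<alpha>)" by (rule openin_subset)
  moreover have "S \<subseteq> L" using S unfolding L W_def .
  ultimately show ?thesis unfolding relatively_compact_in_def by (meson order_trans)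
qed

section \<open>Compactness of the Green operator\<close>

text \<open>The inequalities \<open>c1\<close>, \<open>c2\<close>, \<open>c3\<close> are those of
  the uniform column bound with \<open>p = q\<close>. The disjunction on \<gamma>' treats both parts
  of the theorem together.\<close>

locale green_weighted =
  fixes \<Omega> :: "'a::euclidean_space set" and G :: "'a \<Rightarrow> 'a \<Rightarrow> real" and s \<gamma> \<gamma>' q \<alpha> :: real
  assumes \<Omega>: "C2_domain \<Omega>" and bd: "bounded \<Omega>" and G1: "green_G1 \<Omega> s \<gamma> G" and G2: "green_G2 \<Omega> G"
    and \<gamma>'0: "0 \<le> \<gamma>'" and \<gamma>'\<gamma>: "\<gamma>' < \<gamma> \<or> \<gamma>' = \<gamma> \<and> green_G3 \<Omega> \<gamma> G" and q: "1 \<le> q"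
    and c1: "q * (real DIM('a) - 2 * s + \<gamma>') < real DIM('a) + \<alpha>"
    and c2: "q * (real DIM('a) - 2 * s) < real DIM('a)" and c3: "- 1 < q * \<gamma> + \<alpha>"
begin

lemma op: "open \<Omega>" and ne: "\<Omega> \<noteq> {}"
  using \<Omega> unfolding C2_domain_def by auto

lemma \<Omega>_borel[measurable]: "\<Omega> \<in> sets borel"
  using op by simp

lemmas \<delta>_pos = bdist_pos[OF op bounded_neq_UNIV[OF bd]]

abbreviation W where "W \<equiv> weighted_lebesgue \<Omega> \<alpha>"

definition g :: "'a \<Rightarrow> 'a \<Rightarrow> real" where "g = green_quot \<Omega> \<gamma>' G"

lemma g_nonneg: "0 \<le> g x y"
  unfolding g_def by (rule green_quot_nonneg[OF G1])

lemma g_measurable2: "(\<lambda>z. g (fst z) (snd z)) \<in> borel_measurable (borel \<Otimes>\<^sub>M borel)"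
  unfolding g_def by (rule borel_measurable_green_quot[OF G1 op])

lemma g_measurable[measurable]:
  shows "(\<lambda>x. g x y) \<in> borel_measurable borel" and "(\<lambda>y. g x y) \<in> borel_measurable borel"
  unfolding g_def by (rule borel_measurable_green_quot_left[OF G1 op])+

lemma g_bounded: "\<exists>B\<ge>0. \<forall>y\<in>\<Omega>. (\<integral>\<^sup>+x. ennreal (g x y powr q) \<partial>W) \<le> ennreal B"
proof -
  have "(\<integral>\<^sup>+x. ennreal (g x y powr q) \<partial>W) = (\<integral>\<^sup>+x\<in>\<Omega>. ennreal (g x y powr q * bdist \<Omega> x powr \<alpha>) \<partial>lborel)" for y
    by (rule nn_integral_weighted_lebesgue_borel[OF \<Omega>_borel]) simp_all
  moreover have "\<gamma>' \<le> \<gamma>" using \<gamma>'\<gamma> by auto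
  ultimately show ?thesis
    using green_quot_weighted_bounded[OF \<Omega> bd G1 \<gamma>'0 _ q c1 c2 c3] unfolding g_def by simp
qed

lemma g_Lp: "y \<in> \<Omega> \<Longrightarrow> (\<lambda>x. g x y) \<in> Lp_fun W q"
  unfolding Lp_fun_iff_nn measurable_weighted_lebesgue
  using g_bounded g_nonneg by (auto intro!: borel_measurable_lebesgue_onI intro: order_le_less_trans)

section \<open>Finite nets of columns and approximation of potentials\<close>

text \<open>Compactness of the closure yields finitely many balls of small oscillation; cutting them
  into disjoint Borel pieces of \<Omega> allows a measure to be split along them.\<close>

lemma g_finite_net:
  assumes \<epsilon>: "0 < \<epsilon>"
  shows "\<exists>(n :: nat) A ys. (\<forall>i<n. A i \<in> sets borel \<and> ys i \<in> \<Omega>) \<and> disjoint_family A \<and> \<Omega> = (\<Union>i<n. A i) \<and>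
    (\<forall>i<n. \<forall>y\<in>A i. (\<integral>\<^sup>+x. ennreal (\<bar>g x y - g x (ys i)\<bar> powr q) \<partial>W) \<le> ennreal \<epsilon>)"
proof -
  define Q where "Q z r \<longleftrightarrow> 0 < r \<and> (\<forall>y\<in>\<Omega> \<inter> ball z r. \<forall>y'\<in>\<Omega> \<inter> ball z r.
      (\<integral>\<^sup>+x. ennreal (\<bar>g x y - g x y'\<bar> powr q) \<partial>W) \<le> ennreal \<epsilon>)" for z r
  have "\<exists>r. Q z r" if z: "z \<in> closure \<Omega>" for z
  proof -
    have "(\<integral>\<^sup>+x. ennreal (\<bar>g x y - g x y'\<bar> powr q) \<partial>W)
        = (\<integral>\<^sup>+x\<in>\<Omega>. ennreal (\<bar>g x y - g x y'\<bar> powr q * bdist \<Omega> x powr \<alpha>) \<partial>lborel)" for y y'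
      by (rule nn_integral_weighted_lebesgue_borel[OF \<Omega>_borel]) simp_all
    then show ?thesis
      using green_quot_local_oscillation[OF \<Omega> bd G1 G2 \<gamma>'0 \<gamma>'\<gamma> q c1 c2 c3 z \<epsilon>]
      unfolding g_def Q_def by simp
  qed
  then obtain r where Q: "\<And>z. z \<in> closure \<Omega> \<Longrightarrow> Q z (r z)" by metis
  have r: "0 < r z"
    "y \<in> \<Omega> \<inter> ball z (r z) \<Longrightarrow> y' \<in> \<Omega> \<inter> ball z (r z) \<Longrightarrow>
      (\<integral>\<^sup>+x. ennreal (\<bar>g x y - g x y'\<bar> powr q) \<partial>W) \<le> ennreal \<epsilon>"
    if "z \<in> closure \<Omega>" for z y y'
    using Q[OF that] unfolding Q_def by blast+
  have cpt: "compact (closure \<Omega>)" using bd by (simp add: compact_closure)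
  have cover: "closure \<Omega> \<subseteq> (\<Union>z\<in>closure \<Omega>. ball z (r z))" using r(1) by force
  obtain F where F: "F \<subseteq> closure \<Omega>" "finite F" "closure \<Omega> \<subseteq> (\<Union>z\<in>F. ball z (r z))"
    by (rule compactE_image[OF cpt _ cover]) auto
  obtain h where h: "bij_betw h {0..<card F} F" using ex_bij_betw_nat_finite[OF F(2)] by blast
  define n where "n = card F"
  \<comment> \<open>Indices beyond \<open>n\<close> get the empty set, so that
    \<open>disjointed\<close> on all naturals partitions \<Omega> into the first \<open>n\<close>
    pieces.\<close>
  define U where "U i = (if i < n then \<Omega> \<inter> ball (h i) (r (h i)) else {})" for i
  define A where "A = disjointed U"
  \<comment> \<open>The centre \<open>h i\<close> may be a frontier point, so the sample point is
    taken from the piece itself and shares its ball. For an empty piece any point of \<Omega> will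
    do.\<close>
  define ys where "ys i = (if A i = {} then (SOME y. y \<in> \<Omega>) else (SOME y. y \<in> A i))" for i
  have hF: "h i \<in> F" if "i < n" for i using h that unfolding n_def bij_betw_def by auto
  have AU: "A i \<subseteq> U i" for i unfolding A_def by (rule disjointed_subset)
  have U\<Omega>: "U i \<subseteq> \<Omega>" for i by (auto simp: U_def)
  have ysA: "ys i \<in> A i" if "A i \<noteq> {}" for i using that some_in_eq[of "A i"] by (simp add: ys_def)
  have ys\<Omega>: "ys i \<in> \<Omega>" for i
  proof (cases "A i = {}")
    case True then show ?thesis using some_in_eq[of \<Omega>] ne by (simp add: ys_def)
  next
    case False then show ?thesis using ysA AU U\<Omega> by blast
  qed
  have "\<Omega> \<subseteq> (\<Union>i. U i)"
  proof
    fix x assume x: "x \<in> \<Omega>"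
    then obtain z where z: "z \<in> F" "x \<in> ball z (r z)" using F(3) closure_subset[of \<Omega>] by auto
    moreover have "F = h ` {0..<n}" using h by (simp add: n_def bij_betw_def)
    ultimately obtain i where "i < n" "h i = z" by auto
    then show "x \<in> (\<Union>i. U i)" using x z by (auto simp: U_def)
  qed
  then have "(\<Union>i. A i) = \<Omega>" unfolding A_def UN_disjointed_eq using U\<Omega> by auto
  moreover have "A i = {}" if "\<not> i < n" for i using AU[of i] that by (simp add: U_def)
  ultimately have un: "\<Omega> = (\<Union>i<n. A i)" by auto
  have Am: "A i \<in> sets borel" for i
  proof -
    have "range U \<subseteq> sets borel" using op by (auto simp: U_def)
    then have "range A \<subseteq> sets borel" unfolding A_def by (rule sets.range_disjointed_sets)
    then show ?thesis by auto
  qed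
  have net: "(\<integral>\<^sup>+x. ennreal (\<bar>g x y - g x (ys i)\<bar> powr q) \<partial>W) \<le> ennreal \<epsilon>" if i: "i < n" and y: "y \<in> A i" for i y
  proof (rule r(2))
    show "h i \<in> closure \<Omega>" using hF[OF i] F(1) by auto
    have "ys i \<in> A i" using ysA y by auto
    then show "y \<in> \<Omega> \<inter> ball (h i) (r (h i))" "ys i \<in> \<Omega> \<inter> ball (h i) (r (h i))"
      using AU[of i] y i by (auto simp: U_def)
  qed
  have dj: "disjoint_family A" unfolding A_def by (rule disjoint_family_disjointed)
  show ?thesis
    by (rule exI[of _ n], rule exI[of _ A], rule exI[of _ ys])
       (intro conjI allI impI ballI Am ys\<Omega> dj un net)
qed

text \<open>Minkowski's integral inequality, weakened to a supremum over columns. Jensen's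
  inequality costs \<open>m powr (q - 1)\<close>, Tonelli exchanges the integrals, and the mass
  supplies the last factor \<open>m\<close>. Almost everywhere integrability is recorded because a
  Bochner integral is 0 where it diverges.\<close>

lemma mixed_norm_bound:
  fixes \<nu> :: "'a measure" and k :: "'a \<Rightarrow> 'a \<Rightarrow> real"
  assumes \<nu>: "finite_measure \<nu>" "sets \<nu> = sets (restrict_space borel \<Omega>)" "emeasure \<nu> (space \<nu>) \<le> ennreal m"
    and m: "0 < m" and k: "(\<lambda>z. k (fst z) (snd z)) \<in> borel_measurable (borel \<Otimes>\<^sub>M borel)" "\<And>x y. 0 \<le> k x y"
    and e: "0 \<le> e" "\<And>y. y \<in> \<Omega> \<Longrightarrow> (\<integral>\<^sup>+x. ennreal (k x y powr q) \<partial>W) \<le> ennreal e"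
  shows "AE x in W. integrable \<nu> (\<lambda>y. k x y)"
    and "(\<integral>\<^sup>+x. ennreal ((\<integral>y. k x y \<partial>\<nu>) powr q) \<partial>W) \<le> ennreal (m powr q * e)"
    and "(\<lambda>x. \<integral>y. k x y \<partial>\<nu>) \<in> borel_measurable borel"
proof -
  interpret N: finite_measure \<nu> by fact
  interpret P: pair_sigma_finite "lborel :: 'a measure" \<nu> ..
  have sp: "space \<nu> = \<Omega>" using sets_eq_imp_space_eq[OF \<nu>(2)] by (simp add: space_restrict_space)
  \<comment> \<open>The measure lives on the trace of the Borel sets on \<Omega>; composing with the
    inclusion transports the measurability of \<open>k\<close>.\<close>
  have "(\<lambda>y. y) \<in> restrict_space borel \<Omega> \<rightarrow>\<^sub>M borel" by (rule measurable_restrict_space1) simp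
  then have id[measurable]: "(\<lambda>y. y) \<in> \<nu> \<rightarrow>\<^sub>M borel" unfolding measurable_cong_sets[OF \<nu>(2) refl] .
  have "(\<lambda>z. (fst z, snd z)) \<in> borel \<Otimes>\<^sub>M \<nu> \<rightarrow>\<^sub>M borel \<Otimes>\<^sub>M borel"
    by (intro measurable_Pair measurable_fst measurable_compose[OF measurable_snd id])
  from measurable_compose[OF this k(1)]
  have k2: "(\<lambda>z. k (fst z) (snd z)) \<in> borel_measurable (borel \<Otimes>\<^sub>M \<nu>)" by simp
  then have k2': "(\<lambda>(x, y). k x y) \<in> borel_measurable (borel \<Otimes>\<^sub>M \<nu>)" by (simp add: case_prod_beta')
  have kx: "(\<lambda>y. k x y) \<in> borel_measurable \<nu>" for x
    using measurable_compose[OF measurable_Pair1' k2, of x] by simp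
  show Im: "(\<lambda>x. \<integral>y. k x y \<partial>\<nu>) \<in> borel_measurable borel"
    by (rule N.borel_measurable_lebesgue_integral[OF k2'])
  define J where "J x = (\<integral>\<^sup>+y. ennreal (k x y powr q) \<partial>\<nu>)" for x
  have kq2: "(\<lambda>z. ennreal (k (fst z) (snd z) powr q)) \<in> borel_measurable (borel \<Otimes>\<^sub>M \<nu>)"
    using k2 by (intro measurable_compose[OF _ measurable_ennreal] powr_real_measurable) simp_all
  have Jm: "J \<in> borel_measurable borel"
    unfolding J_def[abs_def] using kq2 by (intro N.borel_measurable_nn_integral) (simp add: case_prod_beta')
  have kqx: "(\<lambda>y. k x y powr q) \<in> borel_measurable \<nu>" for x
    using kx by (intro powr_real_measurable) simp_all
  have Wk: "(\<integral>\<^sup>+x. ennreal (k x y powr q) \<partial>W) = (\<integral>\<^sup>+x. ennreal (bdist \<Omega> x powr \<alpha>) * indicator \<Omega> x * ennreal (k x y powr q) \<partial>lborel)" for y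
  proof -
    have "(\<lambda>x. k x y) \<in> borel_measurable borel"
      using measurable_compose[OF measurable_Pair2' k(1), of y] by simp
    then have "(\<lambda>x. k x y powr q) \<in> borel_measurable borel" by (intro powr_real_measurable) simp_all
    from nn_integral_weighted_lebesgue_borel[OF \<Omega>_borel this, of \<alpha>] show ?thesis
      by (simp add: ennreal_mult' mult_ac)
  qed
  have "(\<integral>\<^sup>+x. J x \<partial>W) = (\<integral>\<^sup>+x\<in>\<Omega>. ennreal (bdist \<Omega> x powr \<alpha>) * J x \<partial>lebesgue)"
    by (rule nn_integral_weighted_lebesgue[OF \<Omega>_borel borel_measurable_lebesgue_onI[OF Jm]])
  also have "\<dots> = (\<integral>\<^sup>+x. ennreal (bdist \<Omega> x powr \<alpha>) * indicator \<Omega> x * J x \<partial>lborel)"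
    by (simp add: nn_integral_completion mult_ac)
  also have "\<dots> = (\<integral>\<^sup>+x. \<integral>\<^sup>+y. ennreal (bdist \<Omega> x powr \<alpha>) * indicator \<Omega> x * ennreal (k x y powr q) \<partial>\<nu> \<partial>lborel)"
    unfolding J_def using kqx by (simp add: nn_integral_cmult)
  also have "\<dots> = (\<integral>\<^sup>+y. \<integral>\<^sup>+x. ennreal (bdist \<Omega> x powr \<alpha>) * indicator \<Omega> x * ennreal (k x y powr q) \<partial>lborel \<partial>\<nu>)"
  proof (rule P.Fubini'[symmetric])
    have "(\<lambda>z. ennreal (bdist \<Omega> (fst z) powr \<alpha>) * indicator \<Omega> (fst z) * ennreal (k (fst z) (snd z) powr q))
        \<in> borel_measurable (borel \<Otimes>\<^sub>M \<nu>)"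
      using kq2 by measurable
    then show "(\<lambda>(x, y). ennreal (bdist \<Omega> x powr \<alpha>) * indicator \<Omega> x * ennreal (k x y powr q)) \<in> borel_measurable (lborel \<Otimes>\<^sub>M \<nu>)"
      by (simp add: case_prod_beta')
  qed
  also have "\<dots> \<le> (\<integral>\<^sup>+y. ennreal e \<partial>\<nu>)"
    unfolding Wk[symmetric] using e(2) sp by (intro nn_integral_mono) simp
  also have "\<dots> = ennreal e * emeasure \<nu> (space \<nu>)" by simp
  also have "\<dots> \<le> ennreal e * ennreal m" using \<nu>(3) by (intro mult_left_mono) auto
  finally have J: "(\<integral>\<^sup>+x. J x \<partial>W) \<le> ennreal e * ennreal m" .
  have JmW: "J \<in> borel_measurable W"
    unfolding measurable_weighted_lebesgue by (rule borel_measurable_lebesgue_onI[OF Jm])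
  have "(\<integral>\<^sup>+x. J x \<partial>W) \<noteq> \<infinity>" using J by (auto simp: top_unique ennreal_mult_eq_top_iff)
  then have "AE x in W. J x \<noteq> \<infinity>" by (intro nn_integral_PInf_AE JmW)
  then show "AE x in W. integrable \<nu> (\<lambda>y. k x y)"
  proof eventually_elim
    case (elim x)
    have "integrable \<nu> (\<lambda>y. k x y powr q)"
      using elim kqx unfolding J_def by (intro integrableI_nonneg) (auto simp: less_top)
    then have "integrable \<nu> (\<lambda>y. 1 + k x y powr q)" by simp
    then show ?case
    proof (rule Bochner_Integration.integrable_bound)
      show "AE y in \<nu>. norm (k x y) \<le> norm (1 + k x y powr q)"
        using le_one_plus_powr[OF q k(2)] k(2) by (intro AE_I2) (simp add: order_trans[OF _ abs_ge_self])
    qed (rule kx)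
  qed
  have "(\<integral>\<^sup>+x. ennreal ((\<integral>y. k x y \<partial>\<nu>) powr q) \<partial>W) \<le> (\<integral>\<^sup>+x. ennreal (m powr (q - 1)) * J x \<partial>W)"
    unfolding J_def by (intro nn_integral_mono powr_lebesgue_integral_le \<nu> m q kx k(2))
  also have "\<dots> = ennreal (m powr (q - 1)) * (\<integral>\<^sup>+x. J x \<partial>W)"
    using JmW by (rule nn_integral_cmult)
  also have "\<dots> \<le> ennreal (m powr (q - 1)) * (ennreal e * ennreal m)"
    using J by (intro mult_left_mono) auto
  also have "\<dots> = ennreal (m powr (q - 1) * (e * m))" using e(1) m by (simp add: ennreal_mult)
  also have "m powr (q - 1) * (e * m) = m powr q * e" using m by (simp add: powr_diff)
  finally show "(\<integral>\<^sup>+x. ennreal ((\<integral>y. k x y \<partial>\<nu>) powr q) \<partial>W) \<le> ennreal (m powr q * e)" .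
qed

text \<open>Replacing each column by the sample column of its piece turns the potential into a
  finite sum; the mixed norm bound for the difference kernel costs the mass times the mesh.\<close>

lemma approx_by_net:
  fixes \<nu> :: "'a measure" and A :: "nat \<Rightarrow> 'a set"
  assumes \<nu>: "finite_measure \<nu>" "sets \<nu> = sets (restrict_space borel \<Omega>)" "emeasure \<nu> (space \<nu>) \<le> ennreal m"
    and m: "0 < m" and \<epsilon>: "0 < \<epsilon>"
    and A: "\<And>i. i < n \<Longrightarrow> A i \<in> sets borel" "\<And>i. i < n \<Longrightarrow> ys i \<in> \<Omega>" "disjoint_family A" "\<Omega> = (\<Union>i<n. A i)"
    and net: "\<And>i y. i < n \<Longrightarrow> y \<in> A i \<Longrightarrow> (\<integral>\<^sup>+x. ennreal (\<bar>g x y - g x (ys i)\<bar> powr q) \<partial>W) \<le> ennreal (\<epsilon> powr q)"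
  shows "(\<lambda>x. \<integral>y. g x y \<partial>\<nu>) \<in> Lp_fun W q"
    and "Lp_seminorm W q (\<lambda>x. (\<integral>y. g x y \<partial>\<nu>) - (\<Sum>i<n. measure \<nu> (A i) * g x (ys i))) \<le> m * \<epsilon>"
proof -
  interpret finite_measure \<nu> by fact
  obtain B where B: "0 \<le> B" "\<And>y. y \<in> \<Omega> \<Longrightarrow> (\<integral>\<^sup>+x. ennreal (g x y powr q) \<partial>W) \<le> ennreal B"
    using g_bounded by blast
  have g_int: "AE x in W. integrable \<nu> (\<lambda>y. g x y)"
    by (rule mixed_norm_bound(1)[OF \<nu> m g_measurable2 g_nonneg B(1)]) (rule B(2))
  have g_norm: "(\<integral>\<^sup>+x. ennreal ((\<integral>y. g x y \<partial>\<nu>) powr q) \<partial>W) \<le> ennreal (m powr q * B)"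
    by (rule mixed_norm_bound(2)[OF \<nu> m g_measurable2 g_nonneg B(1)]) (rule B(2))
  have g_meas: "(\<lambda>x. \<integral>y. g x y \<partial>\<nu>) \<in> borel_measurable borel"
    by (rule mixed_norm_bound(3)[OF \<nu> m g_measurable2 g_nonneg B(1)]) (rule B(2))
  have uabs: "\<bar>\<integral>y. g x y \<partial>\<nu>\<bar> = (\<integral>y. g x y \<partial>\<nu>)" for x
    using g_nonneg by (simp add: integral_nonneg_AE)
  show uLp: "(\<lambda>x. \<integral>y. g x y \<partial>\<nu>) \<in> Lp_fun W q"
    unfolding Lp_fun_iff_nn measurable_weighted_lebesgue uabs
    using g_meas g_norm by (auto intro!: borel_measurable_lebesgue_onI intro: order_le_less_trans)
  \<comment> \<open>The pieces are disjoint, so for \<open>y\<close> in \<open>A i\<close> the sum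
    reduces to the single column \<open>g x (ys i)\<close>; one jointly measurable kernel thus
    carries all the errors.\<close>
  define k where "k x y = \<bar>g x y - (\<Sum>i<n. indicator (A i) y * g x (ys i))\<bar>" for x y
  have g2[measurable]: "(\<lambda>z. g (fst z) (snd z)) \<in> borel_measurable (borel \<Otimes>\<^sub>M borel)" by (rule g_measurable2)
  have gy: "(\<lambda>z. g (fst z) y) \<in> borel_measurable (borel \<Otimes>\<^sub>M borel)" for y :: 'a
    using measurable_compose[OF measurable_fst g_measurable(1)] .
  have ind: "(\<lambda>z. indicator (A i) (snd z) :: real) \<in> borel_measurable (borel \<Otimes>\<^sub>M borel)" if "i < n" for i
    using measurable_compose[OF measurable_snd borel_measurable_indicator[OF A(1)[OF that]]] .
  have km: "(\<lambda>z. k (fst z) (snd z)) \<in> borel_measurable (borel \<Otimes>\<^sub>M borel)"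
    unfolding k_def
    by (intro borel_measurable_abs borel_measurable_diff g2 borel_measurable_sum borel_measurable_times gy ind) simp
  have kval: "k x y = \<bar>g x y - g x (ys i)\<bar>" if i: "i < n" "y \<in> A i" for x y i
  proof -
    have "y \<notin> A j" if "j \<noteq> i" for j using A(3) i(2) that by (auto simp: disjoint_family_on_def)
    then have "(\<Sum>j<n. indicator (A j) y * g x (ys j)) = (\<Sum>j<n. if j = i then g x (ys i) else 0)"
      using i by (intro sum.cong) (auto simp: indicator_def)
    also have "\<dots> = g x (ys i)" using i by simp
    finally show ?thesis by (simp add: k_def)
  qed
  have kb: "(\<integral>\<^sup>+x. ennreal (k x y powr q) \<partial>W) \<le> ennreal (\<epsilon> powr q)" if y: "y \<in> \<Omega>" for y
  proof -
    obtain i where i: "i < n" "y \<in> A i" using y A(4) by auto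
    show ?thesis unfolding kval[OF i] by (rule net[OF i])
  qed
  have k0: "0 \<le> k x y" for x y by (simp add: k_def)
  have k_norm: "(\<integral>\<^sup>+x. ennreal ((\<integral>y. k x y \<partial>\<nu>) powr q) \<partial>W) \<le> ennreal (m powr q * \<epsilon> powr q)"
    by (rule mixed_norm_bound(2)[OF \<nu> m km k0]) (simp, rule kb)
  define S where "S x = (\<Sum>i<n. measure \<nu> (A i) * g x (ys i))" for x
  have SLp: "S \<in> Lp_fun W q"
    unfolding S_def[abs_def] using A(2) by (intro Lp_fun_sum q Lp_fun_cmult g_Lp) auto
  have A\<nu>: "A i \<in> sets \<nu>" if "i < n" for i
    using A(1)[OF that] A(4) that unfolding \<nu>(2) borel_subsets_eq[OF \<Omega>_borel, symmetric] by auto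
  have "Lp_seminorm W q (\<lambda>x. (\<integral>y. g x y \<partial>\<nu>) - S x) \<le> m * \<epsilon>"
  proof (rule iffD2[OF Lp_seminorm_le_iff[OF q Lp_fun_diff[OF q uLp SLp]]])
    show "0 \<le> m * \<epsilon>" using m \<epsilon> by simp
    have "(\<integral>\<^sup>+x. ennreal (\<bar>(\<integral>y. g x y \<partial>\<nu>) - S x\<bar> powr q) \<partial>W) \<le> (\<integral>\<^sup>+x. ennreal ((\<integral>y. k x y \<partial>\<nu>) powr q) \<partial>W)"
    proof (rule nn_integral_mono_AE)
      \<comment> \<open>The difference of the integrals is the integral of the difference where the
        column integral converges, that is, for almost every \<open>x\<close>.\<close>
      show "AE x in W. ennreal (\<bar>(\<integral>y. g x y \<partial>\<nu>) - S x\<bar> powr q) \<le> ennreal ((\<integral>y. k x y \<partial>\<nu>) powr q)"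
        using g_int
      proof eventually_elim
        case (elim x)
        have int: "integrable \<nu> (\<lambda>y. \<Sum>i<n. indicator (A i) y * g x (ys i))"
          using A\<nu> by (intro Bochner_Integration.integrable_sum integrable_mult_left integrable_real_indicator)
            (auto simp: emeasure_eq_measure)
        have "(\<integral>y. (\<Sum>i<n. indicator (A i) y * g x (ys i)) \<partial>\<nu>) = S x"
          unfolding S_def using A\<nu>
          by (subst Bochner_Integration.integral_sum)
             (auto intro!: integrable_mult_left integrable_real_indicator simp: emeasure_eq_measure)
        then have "(\<integral>y. g x y \<partial>\<nu>) - S x = (\<integral>y. g x y - (\<Sum>i<n. indicator (A i) y * g x (ys i)) \<partial>\<nu>)"
          using elim int by simp
        also have "\<bar>\<dots>\<bar> \<le> (\<integral>y. k x y \<partial>\<nu>)"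
          unfolding k_def by (rule integral_abs_bound)
        finally show ?case using q by (intro ennreal_leI powr_mono2) auto
      qed
    qed
    also have "\<dots> \<le> ennreal (m powr q * \<epsilon> powr q)" by (rule k_norm)
    also have "m powr q * \<epsilon> powr q = (m * \<epsilon>) powr q" using m \<epsilon> by (simp add: powr_mult)
    finally show "(\<integral>\<^sup>+x. ennreal (\<bar>(\<integral>y. g x y \<partial>\<nu>) - S x\<bar> powr q) \<partial>W) \<le> ennreal ((m * \<epsilon>) powr q)" .
  qed
  then show "Lp_seminorm W q (\<lambda>x. (\<integral>y. g x y \<partial>\<nu>) - (\<Sum>i<n. measure \<nu> (A i) * g x (ys i))) \<le> m * \<epsilon>"
    by (simp add: S_def)
qed

section \<open>Potentials of the weighted variations\<close>

definition weighted_measure :: "'a measure \<Rightarrow> 'a measure" where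
  "weighted_measure P = density P (\<lambda>y. ennreal (bdist \<Omega> y powr \<gamma>'))"

lemma measurable_variation:
  assumes "sets P = sets (restrict_space borel \<Omega>)" "f \<in> borel_measurable borel"
  shows "f \<in> borel_measurable P"
  unfolding measurable_cong_sets[OF assms(1) refl] by (rule measurable_restrict_space1[OF assms(2)])

lemma weighted_measure_finite:
  assumes P: "sets P = sets (restrict_space borel \<Omega>)"
    and m: "(\<integral>\<^sup>+y. ennreal (bdist \<Omega> y powr \<gamma>') \<partial>P) \<le> ennreal m"
  shows "finite_measure (weighted_measure P)" "sets (weighted_measure P) = sets (restrict_space borel \<Omega>)"
    "emeasure (weighted_measure P) (space (weighted_measure P)) \<le> ennreal m"
proof -
  have f: "(\<lambda>y. ennreal (bdist \<Omega> y powr \<gamma>')) \<in> borel_measurable P"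
    by (rule measurable_variation[OF P]) measurable
  show "sets (weighted_measure P) = sets (restrict_space borel \<Omega>)" by (simp add: weighted_measure_def P)
  have "emeasure (weighted_measure P) (space (weighted_measure P)) = (\<integral>\<^sup>+y. ennreal (bdist \<Omega> y powr \<gamma>') \<partial>P)"
    unfolding weighted_measure_def using f by (simp add: emeasure_density cong: nn_integral_cong)
  then show "emeasure (weighted_measure P) (space (weighted_measure P)) \<le> ennreal m" using m by simp
  then show "finite_measure (weighted_measure P)" by (intro finite_measureI) (auto simp: top_unique)
qed

lemma weighted_measure_integral_g:
  assumes P: "sets P = sets (restrict_space borel \<Omega>)"
  shows "(\<integral>y. g x y \<partial>weighted_measure P)
    = enn2real (\<integral>\<^sup>+y. ennreal (bdist \<Omega> y powr \<gamma>') * ennreal (g x y) \<partial>P)"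
proof -
  have gm: "(\<lambda>y. g x y) \<in> borel_measurable P" by (rule measurable_variation[OF P g_measurable(2)])
  have "(\<integral>y. g x y \<partial>weighted_measure P) = enn2real (\<integral>\<^sup>+y. ennreal (g x y) \<partial>weighted_measure P)"
    using gm g_nonneg by (intro integral_eq_nn_integral) (simp_all add: weighted_measure_def)
  also have "(\<integral>\<^sup>+y. ennreal (g x y) \<partial>weighted_measure P) = (\<integral>\<^sup>+y. ennreal (bdist \<Omega> y powr \<gamma>') * ennreal (g x y) \<partial>P)"
    unfolding weighted_measure_def
    by (intro nn_integral_density measurable_variation[OF P]) measurable
  finally show ?thesis .
qed

text \<open>A change of density that cancels the division by the weight. It fails when
  \<open>x\<close> is an atom, since \<open>G x x\<close> is arbitrary while \<open>g x x\<close> is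
  0; hence the hypothesis on the mass of \<open>{x}\<close>.\<close>

lemma green_integral_eq:
  assumes P: "sets P = sets (restrict_space borel \<Omega>)" and x: "x \<in> \<Omega>"
    and fin: "finite_measure (weighted_measure P)" and nx: "measure (weighted_measure P) {x} = 0"
  shows "(\<integral>y. G x y \<partial>P) = (\<integral>y. g x y \<partial>weighted_measure P)"
proof -
  interpret N: finite_measure "weighted_measure P" by fact
  have sp: "space P = \<Omega>" using sets_eq_imp_space_eq[OF P] by (simp add: space_restrict_space)
  have f: "(\<lambda>y. ennreal (bdist \<Omega> y powr \<gamma>')) \<in> borel_measurable P"
    by (rule measurable_variation[OF P]) measurable
  have xs: "{x} \<in> sets P" using x unfolding P borel_subsets_eq[OF \<Omega>_borel, symmetric] by simp
  \<comment> \<open>The density is positive at \<open>x\<close>, so a weighted mass 0 at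
    \<open>x\<close> forces the original mass to be 0.\<close>
  have "0 = emeasure (weighted_measure P) {x}" using nx by (simp add: N.emeasure_eq_measure)
  also have "\<dots> = (\<integral>\<^sup>+y. ennreal (bdist \<Omega> y powr \<gamma>') * indicator {x} y \<partial>P)"
    unfolding weighted_measure_def using f xs by (simp add: emeasure_density)
  also have "\<dots> = ennreal (bdist \<Omega> x powr \<gamma>') * emeasure P {x}"
    using xs by (simp add: nn_integral_indicator_singleton)
  finally have "emeasure P {x} = 0" using \<delta>_pos[OF x] by (simp add: ennreal_eq_0_iff)
  then have "AE y in P. y \<noteq> x" using xs by (intro AE_I[of _ _ "{x}"]) auto
  \<comment> \<open>\<open>G x\<close> is constrained on \<Omega> alone; \<open>h\<close> agrees
    with it there, is Borel on the whole space, and differs from the weighted quotient at most at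
    \<open>x\<close>.\<close>
  define h where "h y = (if y = x then G x x else bdist \<Omega> y powr \<gamma>' * g x y)" for y
  have hb: "(\<lambda>y. bdist \<Omega> y powr \<gamma>' * g x y) \<in> borel_measurable P"
    by (rule measurable_variation[OF P]) measurable
  have hm: "h \<in> borel_measurable P"
  proof (rule measurable_variation[OF P])
    show "h \<in> borel_measurable borel" unfolding h_def[abs_def] by measurable
  qed
  have "(\<integral>y. G x y \<partial>P) = (\<integral>y. h y \<partial>P)"
  proof (rule Bochner_Integration.integral_cong[OF refl])
    fix y assume "y \<in> space P"
    then have y: "y \<in> \<Omega>" by (simp add: sp)
    show "G x y = h y" using x y \<delta>_pos[OF y] by (auto simp: h_def g_def green_quot_def offdiag_def)
  qed
  also have "\<dots> = (\<integral>y. bdist \<Omega> y powr \<gamma>' * g x y \<partial>P)"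
  proof (rule integral_cong_AE[OF hm hb])
    show "AE y in P. h y = bdist \<Omega> y powr \<gamma>' * g x y"
      using \<open>AE y in P. y \<noteq> x\<close> by eventually_elim (simp add: h_def)
  qed
  also have "\<dots> = (\<integral>y. g x y \<partial>weighted_measure P)"
    unfolding weighted_measure_def
    by (subst integral_density) (auto intro!: measurable_variation[OF P])
  finally show ?thesis .
qed

text \<open>The density is positive throughout \<Omega>, so both measures have the same null
  sets.\<close>

lemma AE_W: "(AE x in W. Q x) \<longleftrightarrow> (AE x in lebesgue_on \<Omega>. Q x)"
proof -
  have "(AE x in W. Q x) \<longleftrightarrow> (AE x in lebesgue_on \<Omega>. 0 < ennreal (bdist \<Omega> x powr \<alpha>) \<longrightarrow> Q x)"
    unfolding weighted_lebesgue_def by (rule AE_density) (rule borel_measurable_lebesgue_onI, measurable)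
  also have "\<dots> \<longleftrightarrow> (AE x in lebesgue_on \<Omega>. Q x)"
  proof (rule AE_cong)
    fix x assume "x \<in> space (lebesgue_on \<Omega>)"
    then have "0 < bdist \<Omega> x" using \<delta>_pos by simp
    then show "(0 < ennreal (bdist \<Omega> x powr \<alpha>) \<longrightarrow> Q x) = Q x" by simp
  qed
  finally show ?thesis .
qed

lemma AE_W_countable:
  assumes "countable X" "\<And>x. x \<in> \<Omega> \<Longrightarrow> x \<notin> X \<Longrightarrow> Q x"
  shows "AE x in W. Q x"
proof -
  have "X \<in> null_sets lebesgue"
    by (rule null_sets_completionI[OF countable_imp_null_set_lborel[OF assms(1)]])
  then have "AE x in lebesgue. x \<notin> X" by (rule AE_not_in)
  then have "AE x in lebesgue. x \<in> \<Omega> \<longrightarrow> Q x" by eventually_elim (use assms(2) in auto)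
  then show ?thesis unfolding AE_W using op by (subst AE_restrict_space_iff) auto
qed

text \<open>The potential written with the quotient \<open>g\<close> instead of \<open>G\<close>: it
  is insensitive to the free diagonal values of \<open>G\<close> and serves as the measurable
  representative of \<open>green_op\<close>.\<close>

definition U :: "('a set \<Rightarrow> real) \<Rightarrow> 'a \<Rightarrow> real" where
  "U \<mu> x = (\<integral>y. g x y \<partial>weighted_measure (pos_variation \<Omega> \<mu>)) - (\<integral>y. g x y \<partial>weighted_measure (neg_variation \<Omega> \<mu>))"

lemma sets_variations:
  "sets (pos_variation \<Omega> \<mu>) = sets (restrict_space borel \<Omega>)"
  "sets (neg_variation \<Omega> \<mu>) = sets (restrict_space borel \<Omega>)"
  unfolding neg_variation_def by (rule sets_pos_variation(1)[OF \<Omega>_borel])+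

lemma M_norm_leD:
  assumes "M_norm \<Omega> \<gamma>' \<mu> \<le> ennreal m"
  shows "(\<integral>\<^sup>+y. ennreal (bdist \<Omega> y powr \<gamma>') \<partial>pos_variation \<Omega> \<mu>) \<le> ennreal m"
    "(\<integral>\<^sup>+y. ennreal (bdist \<Omega> y powr \<gamma>') \<partial>neg_variation \<Omega> \<mu>) \<le> ennreal m"
  using assms unfolding M_norm_eq[OF \<Omega>_borel]
  by (auto intro: order_trans[rotated] simp: add_increasing add_increasing2)

lemma M_space_norm_bound:
  assumes "\<mu> \<in> M_space \<Omega> \<gamma>'"
  obtains m where "0 < m" "M_norm \<Omega> \<gamma>' \<mu> \<le> ennreal m"
proof -
  have "M_norm \<Omega> \<gamma>' \<mu> < top" using assms by (simp add: M_space_def)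
  then have "M_norm \<Omega> \<gamma>' \<mu> = ennreal (enn2real (M_norm \<Omega> \<gamma>' \<mu>))" by simp
  also have "\<dots> \<le> ennreal (enn2real (M_norm \<Omega> \<gamma>' \<mu>) + 1)" by (intro ennreal_leI) simp
  finally show thesis by (intro that[of "enn2real (M_norm \<Omega> \<gamma>' \<mu>) + 1"]) (auto intro: add_nonneg_pos)
qed

text \<open>A net of mesh 1 is enough to instantiate the approximation lemma, which delivers
  membership; integrability comes from the mixed norm bound.\<close>

lemma potential_Lp:
  assumes \<nu>: "finite_measure \<nu>" "sets \<nu> = sets (restrict_space borel \<Omega>)" "emeasure \<nu> (space \<nu>) \<le> ennreal m"
    and m: "0 < m"
  shows "(\<lambda>x. \<integral>y. g x y \<partial>\<nu>) \<in> Lp_fun W q" and "AE x in W. integrable \<nu> (\<lambda>y. g x y)"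
proof -
  obtain n A ys where "\<forall>i<n::nat. A i \<in> sets borel \<and> ys i \<in> \<Omega>" "disjoint_family A" "\<Omega> = (\<Union>i<n. A i)"
    "\<forall>i<n. \<forall>y\<in>A i. (\<integral>\<^sup>+x. ennreal (\<bar>g x y - g x (ys i)\<bar> powr q) \<partial>W) \<le> ennreal (1 powr q)"
    using g_finite_net[of "1 powr q"] by auto
  then show "(\<lambda>x. \<integral>y. g x y \<partial>\<nu>) \<in> Lp_fun W q"
    by (intro approx_by_net(1)[OF \<nu> m, of 1 n A ys]) auto
  obtain B where B: "0 \<le> B" "\<And>y. y \<in> \<Omega> \<Longrightarrow> (\<integral>\<^sup>+x. ennreal (g x y powr q) \<partial>W) \<le> ennreal B"
    using g_bounded by blast
  show "AE x in W. integrable \<nu> (\<lambda>y. g x y)"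
    by (rule mixed_norm_bound(1)[OF \<nu> m g_measurable2 g_nonneg B(1)]) (rule B(2))
qed

text \<open>The exceptional set consists of the atoms of the two weighted variations, and a finite
  measure has countably many atoms.\<close>

lemma green_op_eq_U:
  assumes \<mu>: "\<mu> \<in> M_space \<Omega> \<gamma>'"
  shows "\<exists>X. countable X \<and> (\<forall>x\<in>\<Omega> - X. green_op \<Omega> G \<mu> x = U \<mu> x)"
proof -
  obtain m where m: "0 < m" "M_norm \<Omega> \<gamma>' \<mu> \<le> ennreal m" using M_space_norm_bound[OF \<mu>] .
  note P = weighted_measure_finite[OF sets_variations(1) M_norm_leD(1)[OF m(2)]]
  note N = weighted_measure_finite[OF sets_variations(2) M_norm_leD(2)[OF m(2)]]
  define X where "X = {x. measure (weighted_measure (pos_variation \<Omega> \<mu>)) {x} \<noteq> 0}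
    \<union> {x. measure (weighted_measure (neg_variation \<Omega> \<mu>)) {x} \<noteq> 0}"
  have "countable X"
    unfolding X_def using finite_measure.countable_support[OF P(1)] finite_measure.countable_support[OF N(1)] by simp
  moreover have "green_op \<Omega> G \<mu> x = U \<mu> x" if "x \<in> \<Omega> - X" for x
    unfolding green_op_def U_def using that
    by (auto simp: X_def green_integral_eq[OF sets_variations(1) _ P(1)] green_integral_eq[OF sets_variations(2) _ N(1)])
  ultimately show ?thesis by blast
qed

lemma AE_green_op_eq_U:
  assumes \<mu>: "\<mu> \<in> M_space \<Omega> \<gamma>'"
  shows "AE x in W. green_op \<Omega> G \<mu> x = U \<mu> x"
proof -
  obtain X where X: "countable X" "\<forall>x\<in>\<Omega> - X. green_op \<Omega> G \<mu> x = U \<mu> x"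
    using green_op_eq_U[OF \<mu>] by blast
  show ?thesis by (rule AE_W_countable[OF X(1)]) (use X(2) in simp)
qed

lemma U_Lp:
  assumes \<mu>: "\<mu> \<in> M_space \<Omega> \<gamma>'"
  shows "U \<mu> \<in> Lp_fun W q"
proof -
  obtain m where m: "0 < m" "M_norm \<Omega> \<gamma>' \<mu> \<le> ennreal m" using M_space_norm_bound[OF \<mu>] .
  note P = weighted_measure_finite[OF sets_variations(1) M_norm_leD(1)[OF m(2)]]
  note N = weighted_measure_finite[OF sets_variations(2) M_norm_leD(2)[OF m(2)]]
  show ?thesis unfolding U_def[abs_def]
    by (intro Lp_fun_diff q potential_Lp(1)[OF P m(1)] potential_Lp(1)[OF N m(1)])
qed

text \<open>Membership passes from \<open>U \<mu>\<close> to a function that differs from it on a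
  countable set, where the values depend on the free diagonal of \<open>G\<close>.\<close>

lemma green_op_Lp:
  assumes \<mu>: "\<mu> \<in> M_space \<Omega> \<gamma>'"
  shows "green_op \<Omega> G \<mu> \<in> Lp_fun W q"
proof -
  obtain X where X: "countable X" "\<And>x. x \<in> \<Omega> - X \<Longrightarrow> green_op \<Omega> G \<mu> x = U \<mu> x"
    using green_op_eq_U[OF \<mu>] by blast
  have U: "U \<mu> \<in> borel_measurable (lebesgue_on \<Omega>)" "(\<integral>\<^sup>+x. ennreal (\<bar>U \<mu> x\<bar> powr q) \<partial>W) < \<infinity>"
    using U_Lp[OF \<mu>] unfolding Lp_fun_iff_nn measurable_weighted_lebesgue by auto
  have "green_op \<Omega> G \<mu> \<in> borel_measurable (lebesgue_on \<Omega>)"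
  proof (rule measurable_discrete_difference[OF U(1), of "X \<inter> \<Omega>"])
    show "countable (X \<inter> \<Omega>)" using X(1) by (rule countable_Int1)
    show "{x} \<in> sets (lebesgue_on \<Omega>)" if "x \<in> X \<inter> \<Omega>" for x
      using that op by (simp add: sets_restrict_space_iff)
  qed (use X(2) in auto)
  moreover have "(\<integral>\<^sup>+x. ennreal (\<bar>green_op \<Omega> G \<mu> x\<bar> powr q) \<partial>W) = (\<integral>\<^sup>+x. ennreal (\<bar>U \<mu> x\<bar> powr q) \<partial>W)"
    using AE_green_op_eq_U[OF \<mu>] by (intro nn_integral_cong_AE) auto
  ultimately show ?thesis
    unfolding Lp_fun_iff_nn measurable_weighted_lebesgue using U(2) by simp
qed

section \<open>Linearity of the potential\<close>

text \<open>Valid at every point, also where the integrals diverge, because \<open>enn2real\<close>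
  is multiplicative. A negative factor exchanges the two variations.\<close>

lemma U_cmult:
  assumes \<mu>: "\<mu> \<in> M_space \<Omega> \<gamma>'"
  shows "U (\<lambda>A. a * \<mu> A) x = a * U \<mu> x"
proof -
  have r: "signed_radon \<Omega> \<mu>" using \<mu> by (simp add: M_space_def)
  define I where "I P = (\<integral>\<^sup>+y. ennreal (bdist \<Omega> y powr \<gamma>') * ennreal (g x y) \<partial>P)" for P
  have Ueq: "U \<kappa> x = enn2real (I (pos_variation \<Omega> \<kappa>)) - enn2real (I (neg_variation \<Omega> \<kappa>))" for \<kappa>
    unfolding U_def I_def by (simp add: weighted_measure_integral_g sets_variations)
  have sc: "enn2real (I (scale_measure (ennreal c) P)) = c * enn2real (I P)"
    if "0 \<le> c" "sets P = sets (restrict_space borel \<Omega>)" for c P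
    unfolding I_def
    by (subst nn_integral_scale_measure)
       (auto simp: enn2real_mult that intro!: measurable_variation[OF that(2)])
  show ?thesis
  proof (cases "0 \<le> a")
    case True
    then show ?thesis
      unfolding Ueq variations_cmult(1,2)[OF r \<Omega>_borel True]
      by (simp add: sc sets_variations right_diff_distrib)
  next
    case False
    then have "a \<le> 0" by simp
    then show ?thesis
      unfolding Ueq variations_cmult(3,4)[OF r \<Omega>_borel \<open>a \<le> 0\<close>]
      by (simp add: sc sets_variations algebra_simps)
  qed
qed

text \<open>The subtraction-free identity for the variations is integrated and sent to the reals.
  Additivity of \<open>enn2real\<close> requires finite terms, which are available almost
  everywhere.\<close>

lemma U_add:
  assumes \<mu>: "\<mu> \<in> M_space \<Omega> \<gamma>'" and \<nu>: "\<nu> \<in> M_space \<Omega> \<gamma>'"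
  shows "AE x in W. U (\<lambda>A. \<mu> A + \<nu> A) x = U \<mu> x + U \<nu> x"
proof -
  define \<rho> where "\<rho> = (\<lambda>A. \<mu> A + \<nu> A)"
  have \<rho>: "\<rho> \<in> M_space \<Omega> \<gamma>'" unfolding \<rho>_def by (rule M_space_add[OF \<mu> \<nu> \<Omega>_borel])
  define I where "I x P = (\<integral>\<^sup>+y. ennreal (bdist \<Omega> y powr \<gamma>') * ennreal (g x y) \<partial>P)" for x P
  have Ueq: "U \<kappa> x = enn2real (I x (pos_variation \<Omega> \<kappa>)) - enn2real (I x (neg_variation \<Omega> \<kappa>))" for \<kappa> x
    unfolding U_def I_def by (simp add: weighted_measure_integral_g sets_variations)
  have fin: "AE x in W. I x (pos_variation \<Omega> \<kappa>) < top \<and> I x (neg_variation \<Omega> \<kappa>) < top" if \<kappa>: "\<kappa> \<in> M_space \<Omega> \<gamma>'" for \<kappa>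
  proof -
    obtain m where m: "0 < m" "M_norm \<Omega> \<gamma>' \<kappa> \<le> ennreal m" using M_space_norm_bound[OF \<kappa>] .
    note P = weighted_measure_finite[OF sets_variations(1) M_norm_leD(1)[OF m(2)]]
    note N = weighted_measure_finite[OF sets_variations(2) M_norm_leD(2)[OF m(2)]]
    have If: "I x Q < top" if "integrable (weighted_measure Q) (\<lambda>y. g x y)" "sets Q = sets (restrict_space borel \<Omega>)" for x Q
    proof -
      have "I x Q = (\<integral>\<^sup>+y. ennreal (g x y) \<partial>weighted_measure Q)"
        unfolding I_def weighted_measure_def
        by (intro nn_integral_density[symmetric] measurable_variation[OF that(2)]) measurable
      also have "\<dots> < top" using that(1) g_nonneg by (simp add: integrable_iff_bounded)
      finally show ?thesis .
    qed
    from potential_Lp(2)[OF P m(1)] potential_Lp(2)[OF N m(1)] show ?thesis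
      by eventually_elim (intro conjI If sets_variations)
  qed
  from fin[OF \<rho>] fin[OF \<mu>] fin[OF \<nu>] have "AE x in W. U \<rho> x = U \<mu> x + U \<nu> x"
  proof eventually_elim
    case (elim x)
    have "(\<lambda>y. ennreal (bdist \<Omega> y powr \<gamma>') * ennreal (g x y)) \<in> borel_measurable (restrict_space borel \<Omega>)"
      by (rule measurable_restrict_space1) measurable
    from nn_integral_variations_add[OF op bd \<gamma>'0 \<mu> \<nu> this]
    have "I x (pos_variation \<Omega> \<rho>) + I x (neg_variation \<Omega> \<mu>) + I x (neg_variation \<Omega> \<nu>)
        = I x (neg_variation \<Omega> \<rho>) + I x (pos_variation \<Omega> \<mu>) + I x (pos_variation \<Omega> \<nu>)"
      unfolding I_def \<rho>_def .
    from arg_cong[OF this, of enn2real]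
    have "enn2real (I x (pos_variation \<Omega> \<rho>)) + enn2real (I x (neg_variation \<Omega> \<mu>)) + enn2real (I x (neg_variation \<Omega> \<nu>))
        = enn2real (I x (neg_variation \<Omega> \<rho>)) + enn2real (I x (pos_variation \<Omega> \<mu>)) + enn2real (I x (pos_variation \<Omega> \<nu>))"
      using elim by (simp add: enn2real_plus)
    then show ?case unfolding Ueq by linarith
  qed
  then show ?thesis unfolding \<rho>_def .
qed

lemma green_op_linear:
  assumes \<mu>: "\<mu> \<in> M_space \<Omega> \<gamma>'" and \<nu>: "\<nu> \<in> M_space \<Omega> \<gamma>'"
  shows "AE x in lebesgue_on \<Omega>. green_op \<Omega> G (\<lambda>A. a * \<mu> A + b * \<nu> A) x = a * green_op \<Omega> G \<mu> x + b * green_op \<Omega> G \<nu> x"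
proof -
  have a: "(\<lambda>A. a * \<mu> A) \<in> M_space \<Omega> \<gamma>'" and b: "(\<lambda>A. b * \<nu> A) \<in> M_space \<Omega> \<gamma>'"
    using \<mu> \<nu> by (auto intro: M_space_cmult)
  from AE_green_op_eq_U[OF M_space_add[OF a b \<Omega>_borel]] U_add[OF a b] AE_green_op_eq_U[OF \<mu>] AE_green_op_eq_U[OF \<nu>]
  have "AE x in W. green_op \<Omega> G (\<lambda>A. a * \<mu> A + b * \<nu> A) x = a * green_op \<Omega> G \<mu> x + b * green_op \<Omega> G \<nu> x"
    by eventually_elim (simp add: U_cmult \<mu> \<nu>)
  then show ?thesis unfolding AE_W .
qed

section \<open>Total boundedness and compactness\<close>

text \<open>Each potential is close to a combination of the fixed columns \<open>g x (ys i)\<close>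
  with coefficients in \<open>[- m, m]\<close>; rounding these to multiples of \<theta> leaves
  finitely many combinations, independent of the measure.\<close>

lemma green_op_totally_bounded:
  assumes S: "S \<subseteq> M_space \<Omega> \<gamma>'" and m: "0 < m" "\<And>\<mu>. \<mu> \<in> S \<Longrightarrow> M_norm \<Omega> \<gamma>' \<mu> \<le> ennreal m" and e: "0 < e"
  shows "\<exists>F. finite F \<and> F \<subseteq> Lp_fun W q \<and> (\<forall>u\<in>green_op \<Omega> G ` S. \<exists>f\<in>F. Lp_seminorm W q (\<lambda>x. u x - f x) < e)"
proof -
  \<comment> \<open>The two variations are approximated within \<open>e / 6\<close> each, and
    rounding costs at most \<open>e / 3\<close>; the total \<open>2 * e / 3\<close> is strictly
    below \<open>e\<close>.\<close>
  define \<epsilon> where "\<epsilon> = e / (6 * m)"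
  have \<epsilon>: "0 < \<epsilon>" "m * \<epsilon> = e / 6" using e m(1) by (simp_all add: \<epsilon>_def)
  obtain n A ys where A: "\<forall>i<n::nat. A i \<in> sets borel \<and> ys i \<in> \<Omega>" "disjoint_family A" "\<Omega> = (\<Union>i<n. A i)"
    "\<forall>i<n. \<forall>y\<in>A i. (\<integral>\<^sup>+x. ennreal (\<bar>g x y - g x (ys i)\<bar> powr q) \<partial>W) \<le> ennreal (\<epsilon> powr q)"
    using g_finite_net[of "\<epsilon> powr q"] \<epsilon>(1) by auto
  have yLp: "(\<lambda>x. g x (ys i)) \<in> Lp_fun W q" if "i < n" for i using A(1) that by (intro g_Lp) auto
  define B where "B = (\<Sum>i<n. Lp_seminorm W q (\<lambda>x. g x (ys i)))"
  have B: "0 \<le> B" unfolding B_def by (intro sum_nonneg Lp_seminorm_nonneg)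
  \<comment> \<open>The rounding error is at most \<open>\<theta> * B\<close>; the 1 avoids a
    division by 0 when all sample columns have seminorm 0.\<close>
  define \<theta> where "\<theta> = e / (3 * (B + 1))"
  have \<theta>: "0 < \<theta>" "\<theta> * B \<le> e / 3" using e B by (simp_all add: \<theta>_def field_simps)
  define J where "J = \<lceil>m / \<theta>\<rceil> + 1"
  define comb where "comb c x = (\<Sum>i<n. c i * g x (ys i))" for c :: "nat \<Rightarrow> real" and x
  have combLp: "comb c \<in> Lp_fun W q" for c
    unfolding comb_def[abs_def] using yLp by (intro Lp_fun_sum q Lp_fun_cmult) auto
  define F where "F = (\<lambda>j. comb (\<lambda>i. \<theta> * of_int (j i))) ` (PiE {..<n} (\<lambda>_. {-J..J}))"
  have "finite F" unfolding F_def by (intro finite_imageI finite_PiE) auto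
  moreover have "F \<subseteq> Lp_fun W q" unfolding F_def using combLp by auto
  moreover have "\<exists>f\<in>F. Lp_seminorm W q (\<lambda>x. green_op \<Omega> G \<mu> x - f x) < e" if \<mu>: "\<mu> \<in> S" for \<mu>
  proof -
    have \<mu>M: "\<mu> \<in> M_space \<Omega> \<gamma>'" using S \<mu> by auto
    define \<nu>p \<nu>n where "\<nu>p = weighted_measure (pos_variation \<Omega> \<mu>)" and "\<nu>n = weighted_measure (neg_variation \<Omega> \<mu>)"
    note P = weighted_measure_finite[OF sets_variations(1) M_norm_leD(1)[OF m(2)[OF \<mu>]], folded \<nu>p_def]
    note N = weighted_measure_finite[OF sets_variations(2) M_norm_leD(2)[OF m(2)[OF \<mu>]], folded \<nu>n_def]
    define up un where "up x = (\<integral>y. g x y \<partial>\<nu>p)" and "un x = (\<integral>y. g x y \<partial>\<nu>n)" for x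
    have U: "U \<mu> x = up x - un x" for x unfolding U_def up_def un_def \<nu>p_def \<nu>n_def ..
    have upLp: "up \<in> Lp_fun W q" and unLp: "un \<in> Lp_fun W q"
      unfolding up_def[abs_def] un_def[abs_def]
      by (rule potential_Lp(1)[OF P m(1)], rule potential_Lp(1)[OF N m(1)])
    define cp cn where "cp i = measure \<nu>p (A i)" and "cn i = measure \<nu>n (A i)" for i
    have mass: "measure \<nu> X \<le> m" if "finite_measure \<nu>" "emeasure \<nu> (space \<nu>) \<le> ennreal m" for \<nu> :: "'a measure" and X
    proof -
      interpret finite_measure \<nu> by fact
      have "measure \<nu> X \<le> measure \<nu> (space \<nu>)" by (rule bounded_measure)
      also have "\<dots> \<le> m" using that(2) m(1) by (simp add: emeasure_eq_measure)
      finally show ?thesis .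
    qed
    have ap: "Lp_seminorm W q (\<lambda>x. up x - comb cp x) \<le> e / 6"
      unfolding up_def comb_def cp_def \<epsilon>(2)[symmetric]
      using A by (intro approx_by_net(2)[OF P m(1) \<epsilon>(1)]) auto
    have an: "Lp_seminorm W q (\<lambda>x. un x - comb cn x) \<le> e / 6"
      unfolding un_def comb_def cn_def \<epsilon>(2)[symmetric]
      using A by (intro approx_by_net(2)[OF N m(1) \<epsilon>(1)]) auto
    define c where "c i = cp i - cn i" for i
    have comb_c: "comb c x = comb cp x - comb cn x" for x
      by (simp add: comb_def c_def left_diff_distrib sum_subtractf)
    have c_le: "\<bar>c i\<bar> \<le> m" for i
    proof -
      have "0 \<le> cp i" "0 \<le> cn i" by (simp_all add: cp_def cn_def)
      moreover have "cp i \<le> m" "cn i \<le> m" unfolding cp_def cn_def by (rule mass[OF P(1,3)], rule mass[OF N(1,3)])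
      ultimately show ?thesis unfolding c_def by linarith
    qed
    \<comment> \<open>\<open>restrict\<close> makes the vector of rounded coefficients extensional,
      as \<open>PiE\<close> demands.\<close>
    define j where "j = restrict (\<lambda>i. \<lfloor>c i / \<theta>\<rfloor>) {..<n}"
    have jF: "j \<in> PiE {..<n} (\<lambda>_. {-J..J})"
    proof (rule PiE_I)
      fix i assume i: "i \<in> {..<n}"
      have "\<bar>c i / \<theta>\<bar> \<le> m / \<theta>" using c_le[of i] \<theta>(1) by (simp add: divide_right_mono)
      then have "- J \<le> \<lfloor>c i / \<theta>\<rfloor> \<and> \<lfloor>c i / \<theta>\<rfloor> \<le> J" unfolding J_def by linarith
      then show "j i \<in> {- J..J}" using i by (simp add: j_def)
    qed (simp add: j_def)
    define f where "f = comb (\<lambda>i. \<theta> * of_int (j i))"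
    have "f \<in> F" unfolding f_def F_def using jF by (rule imageI)
    have fLp: "f \<in> Lp_fun W q" unfolding f_def by (rule combLp)
    have cj: "\<bar>c i - \<theta> * of_int (j i)\<bar> \<le> \<theta>" if "i < n" for i
    proof -
      have "c i / \<theta> - of_int \<lfloor>c i / \<theta>\<rfloor> \<le> 1" "0 \<le> c i / \<theta> - of_int \<lfloor>c i / \<theta>\<rfloor>" by linarith+
      then have "\<theta> * \<bar>c i / \<theta> - of_int \<lfloor>c i / \<theta>\<rfloor>\<bar> \<le> \<theta> * 1" using \<theta>(1) by (intro mult_left_mono) auto
      also have "\<theta> * \<bar>c i / \<theta> - of_int \<lfloor>c i / \<theta>\<rfloor>\<bar> = \<bar>\<theta> * (c i / \<theta> - of_int \<lfloor>c i / \<theta>\<rfloor>)\<bar>"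
        using \<theta>(1) by (simp add: abs_mult)
      also have "\<theta> * (c i / \<theta> - of_int \<lfloor>c i / \<theta>\<rfloor>) = c i - \<theta> * of_int (j i)"
        using \<theta>(1) that by (simp add: j_def right_diff_distrib)
      finally show ?thesis by simp
    qed
    have "Lp_seminorm W q (\<lambda>x. comb c x - f x) = Lp_seminorm W q (\<lambda>x. \<Sum>i<n. (c i - \<theta> * of_int (j i)) * g x (ys i))"
      unfolding f_def comb_def by (simp add: sum_subtractf left_diff_distrib)
    also have "\<dots> \<le> (\<Sum>i<n. Lp_seminorm W q (\<lambda>x. (c i - \<theta> * of_int (j i)) * g x (ys i)))"
      using yLp by (intro Lp_seminorm_sum_le q Lp_fun_cmult) auto
    also have "\<dots> \<le> (\<Sum>i<n. \<theta> * Lp_seminorm W q (\<lambda>x. g x (ys i)))"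
      using cj by (intro sum_mono) (auto simp: Lp_seminorm_cmult[OF q] intro!: mult_right_mono Lp_seminorm_nonneg)
    also have "\<dots> = \<theta> * B" by (simp add: B_def sum_distrib_left)
    finally have 3: "Lp_seminorm W q (\<lambda>x. comb c x - f x) \<le> e / 3" using \<theta>(2) by linarith
    have "Lp_seminorm W q (\<lambda>x. (up x - un x) - comb c x)
        \<le> Lp_seminorm W q (\<lambda>x. (up x - un x) - (comb cp x - un x)) + Lp_seminorm W q (\<lambda>x. (comb cp x - un x) - comb c x)"
      by (intro Lp_seminorm_diff_triangle q Lp_fun_diff upLp unLp combLp)
    also have "(\<lambda>x. (up x - un x) - (comb cp x - un x)) = (\<lambda>x. up x - comb cp x)" by auto
    also have "(\<lambda>x. (comb cp x - un x) - comb c x) = (\<lambda>x. comb cn x - un x)" by (simp add: comb_c)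
    also have "Lp_seminorm W q (\<lambda>x. comb cn x - un x) = Lp_seminorm W q (\<lambda>x. un x - comb cn x)"
      by (rule Lp_seminorm_minus_commute)
    finally have 2: "Lp_seminorm W q (\<lambda>x. (up x - un x) - comb c x) \<le> e / 3" using ap an by linarith
    have "Lp_seminorm W q (\<lambda>x. green_op \<Omega> G \<mu> x - f x) = Lp_seminorm W q (\<lambda>x. (up x - un x) - f x)"
    proof -
      have "(\<lambda>x. green_op \<Omega> G \<mu> x - f x) \<in> borel_measurable W" "(\<lambda>x. (up x - un x) - f x) \<in> borel_measurable W"
        using Lp_fun_diff[OF q green_op_Lp[OF \<mu>M] fLp] Lp_fun_diff[OF q Lp_fun_diff[OF q upLp unLp] fLp]
        by (simp_all add: Lp_fun_def)
      then have "(\<integral>x. \<bar>green_op \<Omega> G \<mu> x - f x\<bar> powr q \<partial>W) = (\<integral>x. \<bar>(up x - un x) - f x\<bar> powr q \<partial>W)"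
        using AE_green_op_eq_U[OF \<mu>M] unfolding U
        by (intro integral_cong_AE powr_real_measurable borel_measurable_abs) auto
      then show ?thesis by (simp add: Lp_seminorm_def)
    qed
    also have "\<dots> \<le> Lp_seminorm W q (\<lambda>x. (up x - un x) - comb c x) + Lp_seminorm W q (\<lambda>x. comb c x - f x)"
      by (intro Lp_seminorm_diff_triangle q Lp_fun_diff upLp unLp combLp fLp)
    also have "\<dots> < e" using 2 3 e by linarith
    finally show ?thesis using \<open>f \<in> F\<close> by blast
  qed
  ultimately show ?thesis by (intro exI[of _ F]) simp
qed

theorem compact_linear_map_green_op: "compact_linear_map \<Omega> \<gamma>' q \<alpha> (green_op \<Omega> G)"
  unfolding compact_linear_map_def
proof (intro conjI ballI allI impI)
  show "green_op \<Omega> G \<mu> \<in> Lq_space \<Omega> q \<alpha>" if "\<mu> \<in> M_space \<Omega> \<gamma>'" for \<mu>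
    unfolding Lq_space_eq_Lp_fun[OF op bd q] using that by (rule green_op_Lp)
  show "AE x in lebesgue_on \<Omega>. green_op \<Omega> G (\<lambda>A. a * \<mu> A + b * \<nu> A) x = a * green_op \<Omega> G \<mu> x + b * green_op \<Omega> G \<nu> x"
    if "\<mu> \<in> M_space \<Omega> \<gamma>'" "\<nu> \<in> M_space \<Omega> \<gamma>'" for \<mu> \<nu> a b
    using that by (rule green_op_linear)
  fix S assume "M_bounded \<Omega> \<gamma>' S"
  then obtain C where S: "S \<subseteq> M_space \<Omega> \<gamma>'" and C: "\<And>\<mu>. \<mu> \<in> S \<Longrightarrow> M_norm \<Omega> \<gamma>' \<mu> \<le> ennreal C"
    unfolding M_bounded_def by blast
  \<comment> \<open>The bound \<open>C\<close> may be 0 or negative, while the estimates ask for a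
    positive mass bound.\<close>
  define m where "m = max C 0 + 1"
  have m: "0 < m" by (simp add: m_def)
  have Cm: "M_norm \<Omega> \<gamma>' \<mu> \<le> ennreal m" if "\<mu> \<in> S" for \<mu>
    using C[OF that] by (rule order_trans) (intro ennreal_leI, simp add: m_def)
  show "relatively_compact_in (Lq_topology \<Omega> q \<alpha>) (green_op \<Omega> G ` S)"
  proof (rule relatively_compact_in_Lq_topology[OF op bd q])
    show "green_op \<Omega> G ` S \<subseteq> Lp_fun W q" using S green_op_Lp by auto
    show "\<exists>F. finite F \<and> F \<subseteq> Lp_fun W q \<and> (\<forall>u\<in>green_op \<Omega> G ` S. \<exists>f\<in>F. Lp_seminorm W q (\<lambda>x. u x - f x) < e)"
      if "0 < e" for e using green_op_totally_bounded[OF S m Cm that] .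
  qed
qed

end

section \<open>From the exponents of the statement to those of the estimates\<close>

text \<open>The upper bound on \<alpha> is equivalent to
  \<open>(N + \<alpha>) / (N - 2 * s + \<gamma>') < N / (N - 2 * s)\<close>, so
  \<open>q < p_crit\<close> also gives the second inequality. The third follows from
  \<open>- \<gamma>' - 1 < \<alpha>\<close> and \<open>\<gamma>' \<le> q * \<gamma>\<close>.\<close>

lemma admissible_weight_kernel_exponents:
  assumes N: "2 * s < N" and \<gamma>: "0 \<le> \<gamma>'" "\<gamma>' \<le> \<gamma>" and \<alpha>: "admissible_weight N s \<gamma>' \<alpha>"
    and q: "1 \<le> q" "q < p_crit N s \<gamma>' \<alpha>"
  shows "q * (N - 2 * s + \<gamma>') < N + \<alpha>" and "q * (N - 2 * s) < N" and "- 1 < q * \<gamma> + \<alpha>"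
proof -
  have pos: "0 < N + \<gamma>' - 2 * s" "0 < N - 2 * s" using N \<gamma> by auto
  have \<alpha>1: "- \<gamma>' - 1 < \<alpha>" and \<alpha>2: "\<alpha> < \<gamma>' * N / (N - 2 * s)"
    using \<alpha> unfolding admissible_weight_def by auto
  have "q * (N + \<gamma>' - 2 * s) < N + \<alpha>"
    using q(2) pos(1) unfolding p_crit_def by (simp add: pos_less_divide_eq)
  then show 1: "q * (N - 2 * s + \<gamma>') < N + \<alpha>" by (simp add: algebra_simps)
  have "\<alpha> * (N - 2 * s) < \<gamma>' * N" using \<alpha>2 pos(2) by (simp add: pos_less_divide_eq)
  then have "(N + \<alpha>) * (N - 2 * s) < N * (N - 2 * s + \<gamma>')" by (simp add: algebra_simps)
  moreover have "q * (N - 2 * s + \<gamma>') * (N - 2 * s) < (N + \<alpha>) * (N - 2 * s)"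
    using 1 pos(2) by (rule mult_strict_right_mono)
  ultimately have "(q * (N - 2 * s)) * (N - 2 * s + \<gamma>') < N * (N - 2 * s + \<gamma>')" by (simp add: algebra_simps)
  then show "q * (N - 2 * s) < N" using pos by (simp add: mult_less_cancel_right)
  have "1 * \<gamma>' \<le> q * \<gamma>" using q(1) \<gamma> by (intro mult_mono) auto
  then show "- 1 < q * \<gamma> + \<alpha>" using \<alpha>1 by linarith
qed

theorem theorem3p1:
  fixes \<Omega> :: "(real ^ 'n) set" and G :: "real ^ 'n \<Rightarrow> real ^ 'n \<Rightarrow> real" and s \<gamma> N :: real
  defines "N \<equiv> real CARD('n)"
  assumes "3 \<le> CARD('n)"
    and "bounded \<Omega>" and "C2_domain \<Omega>"
    and "green_G1 \<Omega> s \<gamma> G" and "green_G2 \<Omega> G"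
  shows "(\<forall>\<gamma>' \<alpha>. 0 \<le> \<gamma>' \<and> \<gamma>' < \<gamma> \<and> admissible_weight N s \<gamma>' \<alpha> \<longrightarrow>
            (\<forall>q. 1 \<le> q \<and> q < p_crit N s \<gamma>' \<alpha> \<longrightarrow>
              compact_linear_map \<Omega> \<gamma>' q \<alpha> (green_op \<Omega> G)))
       \<and> (green_G3 \<Omega> \<gamma> G \<longrightarrow>
          (\<forall>\<alpha>. admissible_weight N s \<gamma> \<alpha> \<longrightarrow>
            (\<forall>q. 1 \<le> q \<and> q < p_crit N s \<gamma> \<alpha> \<longrightarrow>
              compact_linear_map \<Omega> \<gamma> q \<alpha> (green_op \<Omega> G))))"
proof -
  have N: "2 * s < N" "real DIM(real ^ 'n) = N" and \<gamma>: "0 < \<gamma>"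
    using assms(5) unfolding green_G1_def N_def by auto
  have main: "compact_linear_map \<Omega> \<gamma>' q \<alpha> (green_op \<Omega> G)"
    if \<gamma>': "0 \<le> \<gamma>'" "\<gamma>' < \<gamma> \<or> \<gamma>' = \<gamma> \<and> green_G3 \<Omega> \<gamma> G" and \<alpha>: "admissible_weight N s \<gamma>' \<alpha>"
      and q: "1 \<le> q" "q < p_crit N s \<gamma>' \<alpha>" for \<gamma>' \<alpha> q
  proof -
    have "\<gamma>' \<le> \<gamma>" using \<gamma>'(2) by auto
    note exps = admissible_weight_kernel_exponents[OF N(1) \<gamma>'(1) this \<alpha> q]
    interpret green_weighted \<Omega> G s \<gamma> \<gamma>' q \<alpha>
      by unfold_locales (use assms(3-6) \<gamma>' q(1) exps in \<open>simp_all only: N(2)\<close>)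
    show ?thesis by (rule compact_linear_map_green_op)
  qed
  show ?thesis
  proof (intro conjI allI impI)
    fix \<gamma>' \<alpha> q
    assume "0 \<le> \<gamma>' \<and> \<gamma>' < \<gamma> \<and> admissible_weight N s \<gamma>' \<alpha>" "1 \<le> q \<and> q < p_crit N s \<gamma>' \<alpha>"
    then show "compact_linear_map \<Omega> \<gamma>' q \<alpha> (green_op \<Omega> G)" by (intro main) auto
  next
    fix \<alpha> q
    assume "green_G3 \<Omega> \<gamma> G" "admissible_weight N s \<gamma> \<alpha>" "1 \<le> q \<and> q < p_crit N s \<gamma> \<alpha>"
    then show "compact_linear_map \<Omega> \<gamma> q \<alpha> (green_op \<Omega> G)" using \<gamma> by (intro main) auto
  qed
qed

end
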